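(* Let $1\ne w\in\mathbf{F}_r$ and write $w=u^d$ with $d\ge1$ and $u\in\mathbf{F}_r$ not a proper power of any other element of $\mathbf{F}_r$. Then for all $\ell\ge1$ and all nonzero integers $j_1,\ldots,j_\ell$, the limit $$\lim_{n\to\infty}\mathcal{T}r^{\mathrm{O}}_{w^{j_1},\ldots,w^{j_\ell}}(n)$$ exists and depends only on $d$ and on $j_1,\ldots,j_\ell$, not on $u$. Moreover, this collection of limits (over all $\ell$ and $j_1,\ldots,j_\ell$) determines $d$. The same result holds with $\mathrm{O}$ replaced by $\mathrm{Sp}$.
   Context: $\mathbf{F}_r$ is the free group with basis $\{x_1,\ldots,x_r\}$; $w(g_1,\ldots,g_r)$ is obtained by substituting $g_i$ for $x_i$. $\mathrm{O}(n)$ is the group of real orthogonal $n\times n$ matrices and $\mathrm{Sp}(n)=\{A\in M_{2n}(\mathbb{C}): A^*A=\mathrm{Id}_{2n},\ A^TJA=J\}$, $J=\begin{pmatrix}0_n&\mathrm{Id}_n\\-\mathrm{Id}_n&0_n\end{pmatrix}$. For $G=\mathrm{O},\mathrm{Sp}$ with Haar probability measure $\mu_n$ on $G(n)$, $\mathcal{T}r^{G}_{w_1,\ldots,w_\ell}(n)=\int_{G(n)^r}\prod_{j=1}^{\ell}\mathrm{tr}(w_j(g_1,\ldots,g_r))\,d\mu_n(g_1)\cdots d\mu_n(g_r)$. *)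

theory Defs
  imports
    "HOL-Probability.Probability"
    "HOL-Algebra.Coset"
    "Jordan_Normal_Form.Schur_Decomposition"
begin

section \<open>Free groups\<close>

text \<open>The letter \<open>(i, True)\<close> stands for the basis element \<open>x\<^sub>i\<close> and \<open>(i, False)\<close> for its
  inverse. Elements of the free group are represented by their unique reduced words.\<close>

type_synonym fg_word = "(nat \<times> bool) list"

definition inv_letter :: "nat \<times> bool \<Rightarrow> nat \<times> bool" where
  "inv_letter a = (fst a, \<not> snd a)"

definition reduced_word :: "fg_word \<Rightarrow> bool" where
  "reduced_word w \<longleftrightarrow> successively (\<lambda>a b. b \<noteq> inv_letter a) w"

text \<open>Left multiplication of a reduced word by a single letter, followed by reduction.\<close>

fun cons_reduce :: "nat \<times> bool \<Rightarrow> fg_word \<Rightarrow> fg_word" where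
  "cons_reduce a [] = [a]"
| "cons_reduce a (b # w) = (if b = inv_letter a then w else a # b # w)"

definition free_group :: "nat \<Rightarrow> fg_word monoid" where
  "free_group r =
     \<lparr>carrier = {w. reduced_word w \<and> fst ` set w \<subseteq> {1..r}},
      monoid.mult = (\<lambda>u v. foldr cons_reduce u v),
      one = []\<rparr>"

definition proper_power :: "('a, 'b) monoid_scheme \<Rightarrow> 'a \<Rightarrow> bool" where
  "proper_power G u \<longleftrightarrow> (\<exists>v\<in>carrier G. v \<noteq> u \<and> (\<exists>k::nat. k \<ge> 2 \<and> u = v [^]\<^bsub>G\<^esub> k))"

definition word_subst :: "('a, 'b) monoid_scheme \<Rightarrow> (nat \<Rightarrow> 'a) \<Rightarrow> fg_word \<Rightarrow> 'a" where
  "word_subst G g w =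
     foldr (\<lambda>(i, b) x. (if b then g i else inv\<^bsub>G\<^esub> (g i)) \<otimes>\<^bsub>G\<^esub> x) w \<one>\<^bsub>G\<^esub>"

lemma inv_letter_inv_letter [simp]: "inv_letter (inv_letter a) = a"
  by (simp add: inv_letter_def)

lemma fst_inv_letter [simp]: "fst (inv_letter a) = fst a"
  by (simp add: inv_letter_def)

lemma reduced_Nil [simp]: "reduced_word []"
  by (simp add: reduced_word_def)

lemma reduced_Cons:
  "reduced_word (a # w) \<longleftrightarrow> reduced_word w \<and> (w \<noteq> [] \<longrightarrow> hd w \<noteq> inv_letter a)"
  by (cases w) (auto simp: reduced_word_def)

lemma reduced_cons_reduce: "reduced_word w \<Longrightarrow> reduced_word (cons_reduce a w)"
  by (cases w) (auto simp: reduced_Cons)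

lemma set_cons_reduce: "set (cons_reduce a w) \<subseteq> insert a (set w)"
  by (cases w) auto

lemma reduced_foldr: "reduced_word v \<Longrightarrow> reduced_word (foldr cons_reduce u v)"
  by (induction u) (auto intro: reduced_cons_reduce)

lemma set_foldr_cons_reduce: "set (foldr cons_reduce u v) \<subseteq> set u \<union> set v"
proof (induction u)
  case (Cons a u)
  then show ?case
    using set_cons_reduce[of a "foldr cons_reduce u v"] by auto
qed auto

lemma cons_reduce_cancel:
  "reduced_word w \<Longrightarrow> cons_reduce (inv_letter a) (cons_reduce a w) = w"
  by (cases w; cases "tl w") (auto simp: reduced_Cons)

lemma cons_reduce_cancel':
  "reduced_word w \<Longrightarrow> cons_reduce a (cons_reduce (inv_letter a) w) = w"
  using cons_reduce_cancel[of w "inv_letter a"] by simp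

lemma foldr_cons_reduce:
  assumes "reduced_word w"
  shows "foldr cons_reduce (cons_reduce a v) w = cons_reduce a (foldr cons_reduce v w)"
proof (cases v)
  case (Cons b v')
  then show ?thesis
    using assms by (auto simp: cons_reduce_cancel' reduced_foldr)
qed auto

lemma foldr_cons_reduce_assoc:
  assumes "reduced_word w"
  shows "foldr cons_reduce (foldr cons_reduce u v) w = foldr cons_reduce u (foldr cons_reduce v w)"
  by (induction u) (auto simp: foldr_cons_reduce assms)

lemma foldr_cons_reduce_Nil: "reduced_word u \<Longrightarrow> foldr cons_reduce u [] = u"
proof (induction u)
  case (Cons a u)
  then show ?case by (cases u) (auto simp: reduced_Cons)
qed auto

lemma foldr_cons_reduce_inverse:
  assumes "reduced_word w"
  shows "foldr cons_reduce (rev (map inv_letter u)) (foldr cons_reduce u w) = w"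
  by (induction u) (auto simp: cons_reduce_cancel reduced_foldr assms)

lemma group_free_group: "group (free_group r)"
proof (rule groupI)
  fix x y assume "x \<in> carrier (free_group r)" "y \<in> carrier (free_group r)"
  then show "x \<otimes>\<^bsub>free_group r\<^esub> y \<in> carrier (free_group r)"
    using image_mono[OF set_foldr_cons_reduce[of x y], of fst] reduced_foldr[of y x]
    by (simp add: free_group_def image_Un) (meson Un_least subset_trans)
next
  fix x assume x: "x \<in> carrier (free_group r)"
  define y where "y = foldr cons_reduce (rev (map inv_letter x)) []"
  have "y \<in> carrier (free_group r)"
    using x image_mono[OF set_foldr_cons_reduce[of "rev (map inv_letter x)" "[]"], of fst]
      reduced_foldr[of "[]" "rev (map inv_letter x)"]
    by (simp add: free_group_def y_def image_image) (meson subset_trans)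
  moreover have "y \<otimes>\<^bsub>free_group r\<^esub> x = \<one>\<^bsub>free_group r\<^esub>"
    using x foldr_cons_reduce_inverse[of "[]" x]
    by (simp add: free_group_def y_def foldr_cons_reduce_assoc foldr_cons_reduce_Nil)
  ultimately show "\<exists>y\<in>carrier (free_group r). y \<otimes>\<^bsub>free_group r\<^esub> x = \<one>\<^bsub>free_group r\<^esub>"
    by blast
qed (auto simp: free_group_def foldr_cons_reduce_assoc)


section \<open>The compact groups\<close>

definition mat_trace :: "'a::comm_monoid_add mat \<Rightarrow> 'a" where
  "mat_trace A = (\<Sum>i<dim_row A. A $$ (i, i))"

definition orthogonal_group :: "nat \<Rightarrow> real mat monoid" where
  "orthogonal_group n =
     \<lparr>carrier = {A \<in> carrier_mat n n. transpose_mat A * A = 1\<^sub>m n},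
      monoid.mult = (*),
      one = 1\<^sub>m n\<rparr>"

definition symplectic_form :: "nat \<Rightarrow> complex mat" where
  "symplectic_form n = four_block_mat (0\<^sub>m n n) (1\<^sub>m n) (- 1\<^sub>m n) (0\<^sub>m n n)"

definition symplectic_group :: "nat \<Rightarrow> complex mat monoid" where
  "symplectic_group n =
     \<lparr>carrier = {A \<in> carrier_mat (2 * n) (2 * n).
        mat_adjoint A * A = 1\<^sub>m (2 * n) \<and>
        transpose_mat A * symplectic_form n * A = symplectic_form n},
      monoid.mult = (*),
      one = 1\<^sub>m (2 * n)\<rparr>"

text \<open>Matrices carry no topology in the library. The zero-padded entry map identifies the
  \<open>n \<times> n\<close> matrices homeomorphically with a closed subspace of the product space of all families
  indexed by \<open>nat \<times> nat\<close>, so pulling back \<open>borel\<close> along it yields the usual Borel sets of a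
  group of \<open>n \<times> n\<close> matrices.\<close>

definition mat_entries :: "'a::zero mat \<Rightarrow> nat \<times> nat \<Rightarrow> 'a" where
  "mat_entries A = (\<lambda>(i, j). if i < dim_row A \<and> j < dim_col A then A $$ (i, j) else 0)"

text \<open>For a compact group left invariance already implies right invariance, and it determines the
  probability measure uniquely.\<close>

definition haar_probability :: "'a::{topological_space, zero} mat monoid \<Rightarrow> 'a mat measure \<Rightarrow> bool" where
  "haar_probability G \<mu> \<longleftrightarrow>
     prob_space \<mu> \<and>
     space \<mu> = carrier G \<and>
     sets \<mu> = sets (vimage_algebra (carrier G) mat_entries borel) \<and>
     (\<forall>a\<in>carrier G. \<forall>X\<in>sets \<mu>. emeasure \<mu> (a <#\<^bsub>G\<^esub> X) = emeasure \<mu> X)"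

definition trace_integral ::
  "'a::{real_normed_field, banach, second_countable_topology} mat monoid \<Rightarrow> 'a mat measure \<Rightarrow>
     nat \<Rightarrow> fg_word list \<Rightarrow> 'a" where
  "trace_integral G \<mu> r ws =
     (\<integral>g. (\<Prod>w\<leftarrow>ws. mat_trace (word_subst G g w)) \<partial>(\<Pi>\<^sub>M i\<in>{1..r}. \<mu>))"

lemma mat_adjoint_carrier: "A \<in> carrier_mat n m \<Longrightarrow> mat_adjoint A \<in> carrier_mat m n"
  by (auto simp: mat_adjoint_def)

lemma mat_adjoint_conv: "mat_adjoint A = transpose_mat (map_mat conjugate A)"
  by (rule eq_matI) (auto simp: mat_adjoint_def mat_of_rows_def)

lemma group_orthogonal_group: "group (orthogonal_group n)"
proof (rule groupI)
  fix x y assume "x \<in> carrier (orthogonal_group n)" "y \<in> carrier (orthogonal_group n)"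
  then have c: "x \<in> carrier_mat n n" "y \<in> carrier_mat n n"
    and o: "transpose_mat x * x = 1\<^sub>m n" "transpose_mat y * y = 1\<^sub>m n"
    by (auto simp: orthogonal_group_def)
  have "transpose_mat (x * y) * (x * y) = transpose_mat y * ((transpose_mat x * x) * y)"
    using c by (simp add: transpose_mult[of _ n n] assoc_mult_mat[of _ n n _ n _ n])
  then show "x \<otimes>\<^bsub>orthogonal_group n\<^esub> y \<in> carrier (orthogonal_group n)"
    using c o by (simp add: orthogonal_group_def)
next
  fix x assume "x \<in> carrier (orthogonal_group n)"
  then have c: "x \<in> carrier_mat n n" and o: "transpose_mat x * x = 1\<^sub>m n"
    by (auto simp: orthogonal_group_def)
  then have "x * transpose_mat x = 1\<^sub>m n"
    using mat_mult_left_right_inverse[of "transpose_mat x" n x] by simp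
  then show "\<exists>y\<in>carrier (orthogonal_group n). y \<otimes>\<^bsub>orthogonal_group n\<^esub> x = \<one>\<^bsub>orthogonal_group n\<^esub>"
    using c o by (intro bexI[of _ "transpose_mat x"]) (auto simp: orthogonal_group_def)
qed (auto simp: orthogonal_group_def assoc_mult_mat[of _ n n _ n _ n])

lemma symplectic_form_carrier: "symplectic_form n \<in> carrier_mat (2 * n) (2 * n)"
  unfolding symplectic_form_def mult_2 by (rule four_block_carrier_mat) auto

lemma group_symplectic_group: "group (symplectic_group n)"
proof (rule groupI)
  let ?m = "2 * n"
  let ?J = "symplectic_form n"
  note J = symplectic_form_carrier[of n]
  note assoc = assoc_mult_mat[of _ ?m ?m _ ?m _ ?m]
  {
    fix x y assume "x \<in> carrier (symplectic_group n)" "y \<in> carrier (symplectic_group n)"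
    then have c: "x \<in> carrier_mat ?m ?m" "y \<in> carrier_mat ?m ?m"
      and u: "mat_adjoint x * x = 1\<^sub>m ?m" "mat_adjoint y * y = 1\<^sub>m ?m"
      and s: "transpose_mat x * ?J * x = ?J" "transpose_mat y * ?J * y = ?J"
      by (auto simp: symplectic_group_def)
    note a = mat_adjoint_carrier[OF c(1)] mat_adjoint_carrier[OF c(2)]
    have map: "map_mat conjugate (x * y) = map_mat conjugate x * map_mat conjugate y"
      using c by (intro eq_matI) (auto simp: scalar_prod_def)
    have "mat_adjoint (x * y) = mat_adjoint y * mat_adjoint x"
      unfolding mat_adjoint_conv map using c by (intro transpose_mult[of _ ?m ?m]) auto
    then have "mat_adjoint (x * y) * (x * y) = mat_adjoint y * ((mat_adjoint x * x) * y)"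
      using c a by (simp add: assoc)
    also have "\<dots> = 1\<^sub>m ?m" using c u by simp
    finally have 1: "mat_adjoint (x * y) * (x * y) = 1\<^sub>m ?m" .
    have "transpose_mat (x * y) * ?J * (x * y) =
        transpose_mat y * (transpose_mat x * ?J * x) * y"
      using c J by (simp add: transpose_mult[of _ ?m ?m] assoc)
    then have 2: "transpose_mat (x * y) * ?J * (x * y) = ?J" using s by simp
    show "x \<otimes>\<^bsub>symplectic_group n\<^esub> y \<in> carrier (symplectic_group n)"
      using c 1 2 by (simp add: symplectic_group_def)
  next
    show "\<one>\<^bsub>symplectic_group n\<^esub> \<in> carrier (symplectic_group n)"
    proof -
      have "mat_adjoint (1\<^sub>m ?m :: complex mat) = 1\<^sub>m ?m"
        unfolding mat_adjoint_conv by (rule eq_matI) auto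
      then show ?thesis using J by (auto simp: symplectic_group_def)
    qed
  next
    fix x assume "x \<in> carrier (symplectic_group n)"
    then have c: "x \<in> carrier_mat ?m ?m"
      and u: "mat_adjoint x * x = 1\<^sub>m ?m" and s: "transpose_mat x * ?J * x = ?J"
      by (auto simp: symplectic_group_def)
    let ?y = "mat_adjoint x"
    have y: "?y \<in> carrier_mat ?m ?m" using mat_adjoint_carrier[OF c] .
    have xy: "x * ?y = 1\<^sub>m ?m" using mat_mult_left_right_inverse[OF y c u] .
    have yy: "mat_adjoint ?y = x"
      unfolding mat_adjoint_conv by (rule eq_matI) auto
    have "transpose_mat (x * ?y) * ?J * (x * ?y) = transpose_mat ?y * (transpose_mat x * ?J * x) * ?y"
      using c y J by (simp add: transpose_mult[of _ ?m ?m] assoc)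
    then have "transpose_mat ?y * ?J * ?y = ?J" unfolding s xy using J by simp
    then show "\<exists>y\<in>carrier (symplectic_group n). y \<otimes>\<^bsub>symplectic_group n\<^esub> x = \<one>\<^bsub>symplectic_group n\<^esub>"
      using y u xy yy by (intro bexI[of _ ?y]) (auto simp: symplectic_group_def)
  }
qed (auto simp: symplectic_group_def assoc_mult_mat[of _ "2 * n" "2 * n" _ "2 * n" _ "2 * n"])

end

(*
  Differentiating along one-parameter subgroups, the invariance of the Haar measure yields
  loop (Schwinger-Dyson) equations: with N the size of the matrices and sigma = 1 for O and -1 for Sp,
  (N - sigma) E[tr(w) ...] is a fixed number of signed terms in which w is split at another occurrence
  of its first letter, or merged with one of the other words. The total length of the words never
  increases, and if w is cyclically reduced, splitting produces only nontrivial words. A trivial word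
  contributes a factor N, but then w itself has disappeared. Hence, for the maximum of |E| over all
  families of nontrivial words of total length at most K, the equation gives a bound independent of N
  by induction on K, and as N tends to infinity only the terms with a trivial word survive.

  For powers w = u^p of a primitive cyclically reduced u, a trivial word arises by merging only with the
  p rotations by multiples of |u| of another copy of u^p (a rotation of u is never u^-1), and by
  splitting only if p is even. So the limits obey a recursion in the exponents alone, and the first two
  moments recover d.
*)
theory Submission
  imports Defs
begin

section \<open>Words\<close>

text \<open>The loop equation comes from a word with two open indices: the entry (a, b) of
  \<open>w\<close>, times the traces of the other words, is varied in a direction X of the Lie
  algebra, and only afterwards are a, b contracted with X through the Casimir element. On both
  groups inversion is the adjoint J^{-1} A^T J of a bilinear form with J^T = \<sigma> J, so one
  computation serves both, and \<sigma> is the price of swapping the indices of J once.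

  The remaining terms may have the same total length as the original family, so induction on the
  length alone would be circular, and |tr| \<le> N is far too weak. A maximum closes the circle:
  there are at most K such occurrences, and for large N the coefficient N - \<sigma> absorbs them.

  Only the first-order behaviour of a curve in the group matters. Cayley transforms therefore stand
  in for the one-parameter subgroups: an algebraic identity gives their expansion with a quadratic
  remainder. For Sp the Lie algebra is only a real space, while the contraction needs complex
  directions; these are complex combinations of two real ones, and the integrated identity is linear
  in X.\<close>

definition inv_word :: "fg_word \<Rightarrow> fg_word" where
  "inv_word w = rev (map inv_letter w)"

definition red :: "fg_word \<Rightarrow> fg_word" where
  "red w = foldr cons_reduce w []"

definition cyc_reduced :: "fg_word \<Rightarrow> bool" where
  "cyc_reduced w \<longleftrightarrow> reduced_word w \<and> (w \<noteq> [] \<longrightarrow> last w \<noteq> inv_letter (hd w))"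

definition word_in :: "nat \<Rightarrow> fg_word \<Rightarrow> bool" where
  "word_in r w \<longleftrightarrow> fst ` set w \<subseteq> {1..r}"

lemma inv_letter_inject [simp]: "inv_letter a = inv_letter b \<longleftrightarrow> a = b"
  by (auto simp: inv_letter_def prod_eq_iff)

lemma inv_letter_neq [simp]: "inv_letter a \<noteq> a" "a \<noteq> inv_letter a"
  by (auto simp: inv_letter_def prod_eq_iff)

lemma inv_word_Nil [simp]: "inv_word [] = []"
  and inv_word_append [simp]: "inv_word (u @ v) = inv_word v @ inv_word u"
  and inv_word_Cons [simp]: "inv_word (a # v) = inv_word v @ [inv_letter a]"
  and length_inv_word [simp]: "length (inv_word w) = length w"
  and inv_word_inv_word [simp]: "inv_word (inv_word w) = w"
  and inv_word_eq_Nil [simp]: "inv_word w = [] \<longleftrightarrow> w = []"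
  by (simp_all add: inv_word_def rev_map o_def)

lemma word_in_simps [simp]:
  "word_in r []" "word_in r (a # w) \<longleftrightarrow> fst a \<in> {1..r} \<and> word_in r w"
  "word_in r (u @ v) \<longleftrightarrow> word_in r u \<and> word_in r v"
  "word_in r (inv_word w) \<longleftrightarrow> word_in r w"
  by (auto simp: word_in_def inv_word_def image_image)

lemma word_in_take: "word_in r w \<Longrightarrow> word_in r (take k w)"
  and word_in_drop: "word_in r w \<Longrightarrow> word_in r (drop k w)"
  by (auto simp: word_in_def dest: in_set_takeD in_set_dropD)

lemma word_in_nth: "word_in r w \<Longrightarrow> k < length w \<Longrightarrow> fst (w ! k) \<in> {1..r}"
  unfolding word_in_def by (meson image_eqI nth_mem subset_iff)

lemma reduced_append:
  "reduced_word (u @ v) \<longleftrightarrow> reduced_word u \<and> reduced_word v \<and>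
     (u \<noteq> [] \<longrightarrow> v \<noteq> [] \<longrightarrow> hd v \<noteq> inv_letter (last u))"
  by (auto simp: reduced_word_def successively_append_iff)

lemma reduced_take: "reduced_word w \<Longrightarrow> reduced_word (take k w)"
  and reduced_drop: "reduced_word w \<Longrightarrow> reduced_word (drop k w)"
  using reduced_append[of "take k w" "drop k w"] by auto

lemma reduced_inv_word [simp]: "reduced_word (inv_word w) \<longleftrightarrow> reduced_word w"
proof -
  have *: "reduced_word w \<Longrightarrow> reduced_word (inv_word w)" for w
  proof (induction w)
    case (Cons a w)
    have "w \<noteq> [] \<Longrightarrow> last (inv_word w) = inv_letter (hd w)"
      by (simp add: inv_word_def last_rev hd_map)
    with Cons show ?case by (auto simp: reduced_append reduced_Cons)
  qed auto
  show ?thesis using *[of w] *[of "inv_word w"] by auto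
qed

lemma hd_inv_word: "w \<noteq> [] \<Longrightarrow> hd (inv_word w) = inv_letter (last w)"
  and last_inv_word: "w \<noteq> [] \<Longrightarrow> last (inv_word w) = inv_letter (hd w)"
  by (simp_all add: inv_word_def hd_rev last_rev last_map hd_map)

lemma cyc_reduced_inv_word [simp]: "cyc_reduced (inv_word w) \<longleftrightarrow> cyc_reduced w"
proof (cases "w = []")
  case False
  then show ?thesis
    by (auto simp: cyc_reduced_def hd_inv_word last_inv_word)
qed simp

section \<open>Free reduction and the congruence it defines\<close>

lemma reduced_red [simp]: "reduced_word (red w)"
  by (simp add: red_def reduced_foldr)

lemma red_reduced: "reduced_word w \<Longrightarrow> red w = w"
  by (simp add: red_def foldr_cons_reduce_Nil)

lemma red_Nil [simp]: "red [] = []"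
  by (simp add: red_def)

lemma red_red [simp]: "red (red w) = red w"
  by (simp add: red_reduced)

lemma red_append: "red (u @ v) = foldr cons_reduce u (red v)"
  by (simp add: red_def)

lemma foldr_cons_reduce_red:
  "reduced_word v \<Longrightarrow> foldr cons_reduce (red u) v = foldr cons_reduce u v"
  using foldr_cons_reduce_assoc[of v u "[]"] by (simp add: red_def)

text \<open>Prepending the letters of \<open>u\<close> one by one acts on reduced words as left
  multiplication, and this action depends on \<open>u\<close> only through \<open>red u\<close>.
  Unreduced concatenations can thus be rewritten piecewise modulo \<open>red\<close>.\<close>

lemma red_append_cong: "red u = red u' \<Longrightarrow> red v = red v' \<Longrightarrow> red (u @ v) = red (u' @ v')"
  using foldr_cons_reduce_red[of "red v" u] foldr_cons_reduce_red[of "red v" u']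
  by (simp add: red_append)

lemma word_in_red: "word_in r w \<Longrightarrow> word_in r (red w)"
  using set_foldr_cons_reduce[of w "[]"] by (auto simp: word_in_def red_def)

lemma length_cons_reduce: "length (cons_reduce a w) \<le> Suc (length w)"
  by (cases w) auto

lemma length_red: "length (red w) \<le> length w"
proof (induction w)
  case (Cons a w)
  then show ?case using length_cons_reduce[of a "red w"] by (simp add: red_def)
qed simp

lemma foldr_inv_word:
  "reduced_word w \<Longrightarrow> foldr cons_reduce (inv_word u) (foldr cons_reduce u w) = w"
  by (simp add: inv_word_def foldr_cons_reduce_inverse)

lemma red_inv_append_iff: "red (inv_word u @ v) = [] \<longleftrightarrow> red u = red v"
proof
  assume "red (inv_word u @ v) = []"
  then have "foldr cons_reduce u (foldr cons_reduce (inv_word u) (red v)) = red u"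
    by (simp add: red_append red_def)
  then show "red u = red v"
    using foldr_inv_word[of "red v" "inv_word u"] by simp
next
  assume "red u = red v"
  then have "red (inv_word u @ v) = red (inv_word u @ u)"
    by (intro red_append_cong) auto
  also have "\<dots> = []" using foldr_inv_word[of "[]" u] by (simp add: red_append red_def)
  finally show "red (inv_word u @ v) = []" .
qed

lemma red_append_inv_iff: "red (u @ v) = [] \<longleftrightarrow> red (inv_word u) = red v"
  using red_inv_append_iff[of "inv_word u" v] by simp

lemma red_inv_self [simp]: "red (inv_word u @ u) = []" "red (u @ inv_word u) = []"
  by (simp_all add: red_inv_append_iff red_append_inv_iff)

lemma red_rotate: "red (u @ v) = [] \<Longrightarrow> red (v @ u) = []"
  using red_append_cong[of v "inv_word u" u u] red_inv_self(1)[of u]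
  unfolding red_append_inv_iff[of u v] by simp

text \<open>Triviality is invariant under cyclic rotation, which brings the two outer factors
  together.\<close>

lemma red_conj_Nil [simp]: "red (h @ v @ inv_word h) = [] \<longleftrightarrow> red v = []"
proof -
  have "red (h @ v @ inv_word h) = [] \<longleftrightarrow> red (v @ inv_word h @ h) = []"
    using red_rotate[of h "v @ inv_word h"] red_rotate[of "v @ inv_word h" h]
    unfolding append_assoc by blast
  also have "red (v @ inv_word h @ h) = red (v @ [])"
    by (intro red_append_cong) auto
  finally show ?thesis by simp
qed

lemma cyclic_reduction_reduced:
  "reduced_word w \<Longrightarrow> \<exists>h v. w = h @ v @ inv_word h \<and> cyc_reduced v"
proof (induction w rule: length_induct)
  case (1 w)
  show ?case
  proof (cases "cyc_reduced w")
    case True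
    then show ?thesis by (intro exI[of _ "[]"] exI[of _ w]) simp
  next
    case False
    then have w: "w \<noteq> []" "last w = inv_letter (hd w)" using 1 by (auto simp: cyc_reduced_def)
    then obtain a w' where aw: "w = a # w'" by (cases w) auto
    with w have "w' \<noteq> []" by auto
    then obtain w'' where "w' = w'' @ [inv_letter a]"
      using w aw by (metis append_butlast_last_id last_ConsR list.sel(1))
    then have w'': "w = a # w'' @ [inv_letter a]" using aw by simp
    then have "reduced_word w''" using 1(2) by (auto simp: reduced_Cons reduced_append)
    moreover have "length w'' < length w" using w'' by simp
    ultimately obtain h v where "w'' = h @ v @ inv_word h" "cyc_reduced v" using 1(1) by blast
    then show ?thesis using w'' by (intro exI[of _ "a # h"] exI[of _ v]) simp
  qed
qed

lemma cyclic_reduction: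
  obtains h v where "red w = h @ v @ inv_word h" "cyc_reduced v"
  using cyclic_reduction_reduced[of "red w"] by auto

text \<open>A word equal to its formal inverse ends in the inverse of its first letter, and the part
  in between is again self-inverse. Peeling off such pairs ends at two adjacent inverse letters,
  which a reduced word does not contain.\<close>

lemma self_inverse_reduced_word:
  "reduced_word w \<Longrightarrow> inv_word w = w \<Longrightarrow> w = []"
proof (induction w rule: length_induct)
  case (1 w)
  show ?case
  proof (rule ccontr)
    assume "w \<noteq> []"
    then obtain a w' where aw: "w = a # w'" by (cases w) auto
    with 1 have eq: "inv_word w' @ [inv_letter a] = a # w'" by simp
    then have "w' \<noteq> []" by auto
    with eq have "last w' = inv_letter a"
      by (metis last_ConsR last_snoc)
    with \<open>w' \<noteq> []\<close> obtain w'' where w'': "w' = w'' @ [inv_letter a]"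
      by (metis append_butlast_last_id)
    with eq have "inv_word w'' = w''" by simp
    moreover have "reduced_word w''" "length w'' < length w"
      using 1(2) unfolding aw w'' by (simp_all add: reduced_append reduced_Cons)
    ultimately have "w'' = []" using 1(1) by blast
    with w'' aw 1(2) show False by (simp add: reduced_Cons)
  qed
qed

text \<open>Rotation creates one new adjacency, last letter before first letter, and cyclic
  reducedness is the condition on exactly this pair.\<close>

lemma reduced_rotate:
  assumes v: "cyc_reduced v"
  shows "reduced_word (drop c v @ take c v)"
proof (cases "drop c v = [] \<or> take c v = []")
  case True
  then show ?thesis using v by (auto simp: cyc_reduced_def)
next
  case False
  then have "last (drop c v) = last v" "hd (take c v) = hd v" "v \<noteq> []"
    by (auto simp: last_drop hd_take)
  moreover from this v have "hd v \<noteq> inv_letter (last v)"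
    unfolding cyc_reduced_def by (metis inv_letter_inv_letter)
  ultimately show ?thesis using v reduced_take[of v c] reduced_drop[of v c]
    by (simp add: reduced_append cyc_reduced_def)
qed

text \<open>With v = ab the hypothesis reads ba = b^{-1} a^{-1}. Comparing lengths, a and b are both
  self-inverse words, hence empty.\<close>

lemma rotate_neq_inverse:
  assumes "reduced_word v" "drop c v @ take c v = inv_word v"
  shows "v = []"
proof -
  let ?a = "take c v" and ?b = "drop c v"
  have "?b @ ?a = inv_word ?b @ inv_word ?a"
    unfolding assms(2) inv_word_append[symmetric] by simp
  then have b: "inv_word ?b = ?b" and a: "inv_word ?a = ?a"
    by (metis append_eq_append_conv length_inv_word)+
  have "?a = []" using a assms(1) by (intro self_inverse_reduced_word reduced_take)
  moreover have "?b = []" using b assms(1) by (intro self_inverse_reduced_word reduced_drop)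
  ultimately show ?thesis by auto
qed

section \<open>Primitive words and their rotations\<close>

definition prim_word :: "'a list \<Rightarrow> bool" where
  "prim_word u \<longleftrightarrow> u \<noteq> [] \<and> (\<forall>n zs. n > 1 \<longrightarrow> concat (replicate n zs) \<noteq> u)"

abbreviation word_pow :: "'a list \<Rightarrow> nat \<Rightarrow> 'a list" where
  "word_pow u p \<equiv> concat (replicate p u)"

lemma length_word_pow [simp]: "length (word_pow u p) = p * length u"
  by (induction p) auto

lemma word_pow_add: "word_pow u (p + q) = word_pow u p @ word_pow u q"
  by (simp add: replicate_add)

lemma nth_word_pow: "t < p * length u \<Longrightarrow> word_pow u p ! t = u ! (t mod length u)"
proof (induction p arbitrary: t)
  case (Suc p)
  show ?case
  proof (cases "t < length u")
    case False
    then have "t - length u < p * length u" using Suc.prems by auto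
    then show ?thesis using Suc.IH[of "t - length u"] False
      by (simp add: nth_append le_mod_geq)
  qed (simp add: nth_append)
qed simp

text \<open>A rotation of the power acts on the first period as the rotation of \<open>u\<close> by
  c mod |u|. If this is nontrivial, the two pieces into which it cuts \<open>u\<close> commute, so
  they are powers of a common word and \<open>u\<close> is not primitive.\<close>

lemma prim_word_rotate:
  assumes "prim_word u" "p \<ge> 1" "c \<le> p * length u"
    and eq: "drop c (word_pow u p) @ take c (word_pow u p) = word_pow u p"
  shows "length u dvd c"
proof (rule ccontr)
  let ?m = "length u" and ?k = "c mod length u"
  assume "\<not> ?m dvd c"
  then have k: "?k \<noteq> 0" by (simp add: mod_eq_0_iff_dvd)
  have m: "?m > 0" using assms(1) by (auto simp: prim_word_def)
  have rot: "rotate c (word_pow u p) = word_pow u p"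
  proof (cases "c = p * ?m")
    case False
    then show ?thesis using eq assms(3) by (simp add: rotate_drop_take)
  qed (use rotate_length01 in \<open>simp add: rotate_drop_take\<close>)
  have "rotate ?k u = u"
  proof (rule nth_equalityI)
    fix t assume "t < length (rotate ?k u)"
    then have t: "t < ?m" by simp
    have tp: "t < p * ?m" using t assms(2) by (metis less_le_trans mult_le_mono1 nat_mult_1)
    have "u ! t = word_pow u p ! t" using nth_word_pow[OF tp] t by simp
    also have "\<dots> = rotate c (word_pow u p) ! t" using rot by simp
    also have "\<dots> = word_pow u p ! ((c + t) mod (p * ?m))" using tp by (simp add: nth_rotate add.commute)
    also have "\<dots> = u ! ((c + t) mod (p * ?m) mod ?m)"
      using tp by (intro nth_word_pow mod_less_divisor) linarith
    also have "(c + t) mod (p * ?m) mod ?m = (c + t) mod ?m"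
      by (simp add: mod_mod_cancel)
    also have "u ! ((c + t) mod ?m) = rotate ?k u ! t"
      using t by (simp add: nth_rotate mod_add_left_eq)
    finally show "rotate ?k u ! t = u ! t" by simp
  qed simp
  then have "drop ?k u @ take ?k u = take ?k u @ drop ?k u"
    by (simp add: rotate_drop_take)
  moreover have "drop ?k u \<noteq> []" "take ?k u \<noteq> []"
    using k m mod_less_divisor[OF m, of c] by (simp_all del: mod_less_divisor)
  ultimately have "\<exists>n zs. 1 < n \<and> word_pow zs n = take ?k u @ drop ?k u"
    by (intro comm_append_is_replicate) auto
  then show False using assms(1) unfolding prim_word_def append_take_drop_id by blast
qed

lemma take_word_pow: "q \<le> p \<Longrightarrow> take (q * length u) (word_pow u p) = word_pow u q"
  and drop_word_pow: "q \<le> p \<Longrightarrow> drop (q * length u) (word_pow u p) = word_pow u (p - q)"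
proof -
  assume "q \<le> p"
  then have *: "word_pow u p = word_pow u q @ word_pow u (p - q)"
    by (metis word_pow_add le_add_diff_inverse)
  show "take (q * length u) (word_pow u p) = word_pow u q"
    "drop (q * length u) (word_pow u p) = word_pow u (p - q)"
    unfolding * by simp_all
qed

lemma hd_word_pow: "p \<ge> 1 \<Longrightarrow> u \<noteq> [] \<Longrightarrow> hd (word_pow u p) = hd u"
  by (cases p) auto

lemma last_word_pow: "p \<ge> 1 \<Longrightarrow> u \<noteq> [] \<Longrightarrow> last (word_pow u p) = last u"
proof (induction p)
  case (Suc p)
  then show ?case by (cases "p = 0") auto
qed simp

lemma cyc_reduced_word_pow:
  assumes "cyc_reduced u" shows "cyc_reduced (word_pow u p)"
proof (cases "u = [] \<or> p = 0")
  case True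
  then have "word_pow u p = []" by auto
  then show ?thesis unfolding \<open>word_pow u p = []\<close> by (simp add: cyc_reduced_def)
next
  case False
  have hl: "hd u \<noteq> inv_letter (last u)"
    using assms False unfolding cyc_reduced_def by (metis inv_letter_inv_letter)
  have "reduced_word (word_pow u p)" for p
  proof (induction p)
    case (Suc p)
    then show ?case using assms hl hd_word_pow[of p u] False
      by (cases "p = 0") (simp_all add: reduced_append cyc_reduced_def)
  qed simp
  then show ?thesis using assms False hd_word_pow[of p u] last_word_pow[of p u]
    by (simp add: cyc_reduced_def)
qed

lemma word_in_word_pow: "word_in r u \<Longrightarrow> word_in r (word_pow u p)"
  by (induction p) auto

section \<open>Loop equations\<close>

definition letter_positions :: "nat \<Rightarrow> fg_word \<Rightarrow> nat set" where
  "letter_positions i w = {k. k < length w \<and> fst (w ! k) = i}"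

text \<open>Under a variation \<open>g \<mapsto> R g\<close> of a generator, the inserted factor stands in front of an occurrence of
  the generator and behind an occurrence of its inverse.\<close>

definition cut_pos :: "fg_word \<Rightarrow> nat \<Rightarrow> nat" where
  "cut_pos w k = (if snd (w ! k) then k else Suc k)"

text \<open>An inverse letter varies as g^{-1} R^{-1}, and the first-order term of R^{-1} is
  -X.\<close>

definition letter_sign :: "fg_word \<Rightarrow> nat \<Rightarrow> 'a::ring_1" where
  "letter_sign w k = (if snd (w ! k) then 1 else - 1)"

definition cyc_shift :: "nat \<Rightarrow> 'a list \<Rightarrow> 'a list" where
  "cyc_shift c w = drop c w @ take c w"

definition remove_nth :: "nat \<Rightarrow> 'a list \<Rightarrow> 'a list" where
  "remove_nth j ws = take j ws @ drop (Suc j) ws"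

lemma finite_letter_positions [simp]: "finite (letter_positions i w)"
  by (simp add: letter_positions_def)

lemma length_cyc_shift [simp]: "length (cyc_shift c w) = length w"
  by (simp add: cyc_shift_def)

lemma length_remove_nth [simp]: "j < length ws \<Longrightarrow> length (remove_nth j ws) = length ws - 1"
  by (simp add: remove_nth_def)

lemma set_remove_nth: "set (remove_nth j ws) \<subseteq> set ws"
  by (auto simp: remove_nth_def dest: in_set_takeD in_set_dropD)

lemma remove_nth_map: "remove_nth j (map f ws) = map f (remove_nth j ws)"
  by (simp add: remove_nth_def take_map drop_map)

lemma mset_remove_nth: "j < length ws \<Longrightarrow> mset ws = mset (ws ! j # remove_nth j ws)"
  by (subst id_take_nth_drop[of j ws]) (auto simp: remove_nth_def)

lemma sum_list_remove_nth:
  fixes f :: "'b \<Rightarrow> nat"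
  assumes "j < length ws"
  shows "sum_list (map f ws) = f (ws ! j) + sum_list (map f (remove_nth j ws))"
  using arg_cong[OF mset_remove_nth[OF assms], of "\<lambda>m. sum_mset (image_mset f m)"]
  by (simp flip: sum_mset_sum_list)

lemma word_in_cyc_shift [simp]: "word_in r w \<Longrightarrow> word_in r (cyc_shift c w)"
  by (simp add: cyc_shift_def word_in_take word_in_drop)

lemma cyc_reduced_snoc:
  assumes "cyc_reduced (a # w)" shows "cyc_reduced (w @ [a])"
proof (cases "w = []")
  case False
  then show ?thesis using assms
    by (auto simp: cyc_reduced_def reduced_append reduced_Cons)
qed (use assms in simp)

text \<open>The loop equation isolates E(w) only if the first letter of w is a generator, since the
  cut then lies in front of the whole word. If v starts with an inverse letter, rotating this letter
  to the end and inverting the word repairs this; neither operation changes the trace.\<close>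

lemma positive_start:
  assumes "cyc_reduced v" "v \<noteq> []"
  obtains u i where "cyc_reduced u" "hd u = (i, True)" "length u = length v"
    "\<And>r. word_in r u \<longleftrightarrow> word_in r v"
    "u = v \<or> u = inv_word (tl v @ [hd v])"
proof (cases v)
  case (Cons a w)
  show ?thesis
  proof (cases "snd a")
    case True
    then show ?thesis using that[of v "fst a"] assms Cons by (simp add: prod_eq_iff)
  next
    case False
    have "cyc_reduced (inv_word (w @ [a]))"
      unfolding cyc_reduced_inv_word using cyc_reduced_snoc[of a w] assms Cons by simp
    with False show ?thesis
      using that[of "inv_word (w @ [a])" "fst a"] Cons by (auto simp: inv_letter_def)
  qed
qed (use assms in simp)

text \<open>\<open>E\<close> abstracts the expected product of the traces of a family of words in
  matrices of size N. The asymptotic analysis uses only these properties. In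
  \<open>loop_equation\<close> the first sum splits \<open>w\<close> at an occurrence of the
  generator i or reverses the part in front of the cut; the second merges \<open>w\<close> with
  another word in either orientation. The field is left open because O lives over the reals and Sp
  over the complex numbers.\<close>

locale loop_system =
  fixes r N :: nat and \<sigma> :: "'a::real_normed_field" and E :: "fg_word list \<Rightarrow> 'a"
  assumes sign: "\<sigma> = 1 \<or> \<sigma> = - 1"
    and E_Nil: "E [] = 1"
    and E_Nil_Cons: "list_all (word_in r) ws \<Longrightarrow> E ([] # ws) = of_nat N * E ws"
    and E_red: "list_all (word_in r) (w # ws) \<Longrightarrow> E (red w # ws) = E (w # ws)"
    and E_rotate: "list_all (word_in r) ((u @ v) # ws) \<Longrightarrow> E ((v @ u) # ws) = E ((u @ v) # ws)"
    and E_inv: "list_all (word_in r) (w # ws) \<Longrightarrow> E (inv_word w # ws) = E (w # ws)"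
    and loop_equation: "i \<in> {1..r} \<Longrightarrow> list_all (word_in r) (w # ws) \<Longrightarrow>
      (\<Sum>k\<in>letter_positions i w. letter_sign w k *
         (E (take (cut_pos w k) w # drop (cut_pos w k) w # ws) -
          \<sigma> * E ((inv_word (take (cut_pos w k) w) @ drop (cut_pos w k) w) # ws))) +
      (\<Sum>j<length ws. \<Sum>k\<in>letter_positions i (ws ! j). letter_sign (ws ! j) k *
         (E ((w @ cyc_shift (cut_pos (ws ! j) k) (ws ! j)) # remove_nth j ws) -
          E ((inv_word (cyc_shift (cut_pos (ws ! j) k) (ws ! j)) @ w) # remove_nth j ws))) = 0"
begin

definition words :: "nat \<Rightarrow> fg_word list set" where
  "words K = {ws. (\<forall>w\<in>set ws. word_in r w \<and> red w \<noteq> []) \<and> sum_list (map length ws) \<le> K}"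

lemma wordsD: "ws \<in> words K \<Longrightarrow> list_all (word_in r) ws"
  by (auto simp: words_def list_all_iff)

lemma words_Cons: "w # ws \<in> words K \<longleftrightarrow>
    word_in r w \<and> red w \<noteq> [] \<and> length w \<le> K \<and> ws \<in> words (K - length w)"
  by (auto simp: words_def)

lemma words_mono: "K \<le> K' \<Longrightarrow> ws \<in> words K \<Longrightarrow> ws \<in> words K'"
  by (auto simp: words_def)

lemma words_remove_nth:
  assumes "ws \<in> words K" "j < length ws"
  shows "word_in r (ws ! j)" "red (ws ! j) \<noteq> []" "length (ws ! j) \<le> K"
    "remove_nth j ws \<in> words (K - length (ws ! j))"
  using assms set_remove_nth[of j ws] sum_list_remove_nth[of j ws length]
  by (auto simp: words_def)

text \<open>Nontrivial words are nonempty, so the bound on the total length also bounds the number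
  of words. Finiteness makes the maximum of the norm of \<open>E\<close> over \<open>words K\<close>
  available.\<close>

lemma finite_words: "finite (words K)"
proof (rule finite_subset)
  let ?A = "{w :: fg_word. set w \<subseteq> {1..r} \<times> UNIV \<and> length w \<le> K}"
  show "words K \<subseteq> {ws. set ws \<subseteq> ?A \<and> length ws \<le> K}"
  proof
    fix ws assume ws: "ws \<in> words K"
    have "set ws \<subseteq> ?A"
    proof
      fix w assume w: "w \<in> set ws"
      then have "length w \<le> sum_list (map length ws)" by (intro member_le_sum_list) auto
      with ws w show "w \<in> ?A" unfolding words_def word_in_def by fastforce
    qed
    moreover have "length ws \<le> sum_list (map length ws)"
    proof -
      have "\<forall>w\<in>set ws. 1 \<le> length w" using ws by (fastforce simp: words_def Suc_le_eq)
      then show ?thesis by (induction ws) auto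
    qed
    ultimately show "ws \<in> {ws. set ws \<subseteq> ?A \<and> length ws \<le> K}" using ws by (auto simp: words_def)
  qed
  have "finite ?A" by (intro finite_lists_length_le) auto
  then show "finite {ws. set ws \<subseteq> ?A \<and> length ws \<le> K}" by (rule finite_lists_length_le)
qed

lemma E_red_Nil: "list_all (word_in r) (w # ws) \<Longrightarrow> red w = [] \<Longrightarrow> E (w # ws) = of_nat N * E ws"
  using E_red[of w ws] E_Nil_Cons[of ws] by simp

lemma E_cyclic_reduction:
  assumes "list_all (word_in r) (w # ws)"
  obtains v where "cyc_reduced v" "word_in r v" "length v \<le> length w" "E (v # ws) = E (w # ws)"
    "red v = [] \<longleftrightarrow> red w = []"
proof -
  obtain h v where hv: "red w = h @ v @ inv_word h" "cyc_reduced v" by (rule cyclic_reduction)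
  have w': "word_in r (red w)" using word_in_red[of r w] assms by simp
  with hv have r: "word_in r h" "word_in r v" by auto
  have "E (w # ws) = E ((h @ v @ inv_word h) # ws)" using E_red[OF assms] hv by simp
  also have "\<dots> = E ((v @ inv_word h @ h) # ws)"
    using E_rotate[of h "v @ inv_word h" ws] r assms by simp
  also have "\<dots> = E (red (v @ inv_word h @ h) # ws)"
    using E_red[of "v @ inv_word h @ h" ws] r assms by simp
  also have "red (v @ inv_word h @ h) = red (v @ [])" by (rule red_append_cong) auto
  also have "E (red (v @ []) # ws) = E (v # ws)"
    using E_red[of v ws] r assms by simp
  finally have "E (v # ws) = E (w # ws)" by simp
  moreover have "length v \<le> length w" using length_red[of w] hv by simp
  moreover have "red v = [] \<longleftrightarrow> red w = []"
    using red_conj_Nil[of h v] unfolding hv(1)[symmetric] by simp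
  ultimately show ?thesis using that hv r by blast
qed

lemma norm_sign: "norm \<sigma> = 1"
  using sign by auto

text \<open>The occurrence at position 0 is cut in front of the first letter. Splitting there
  produces the empty word, hence N E(w), and the reversed term is w itself with coefficient
  -\<sigma>; together they give N - \<sigma>.\<close>

lemma loop_equation_first:
  assumes w: "list_all (word_in r) (w # ws)" "w \<noteq> []" "hd w = (i, True)"
  shows "(of_nat N - \<sigma>) * E (w # ws) =
      - (\<Sum>k\<in>letter_positions i w - {0}. letter_sign w k *
         (E (take (cut_pos w k) w # drop (cut_pos w k) w # ws) -
          \<sigma> * E ((inv_word (take (cut_pos w k) w) @ drop (cut_pos w k) w) # ws))) -
      (\<Sum>j<length ws. \<Sum>k\<in>letter_positions i (ws ! j). letter_sign (ws ! j) k *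
         (E ((w @ cyc_shift (cut_pos (ws ! j) k) (ws ! j)) # remove_nth j ws) -
          E ((inv_word (cyc_shift (cut_pos (ws ! j) k) (ws ! j)) @ w) # remove_nth j ws)))"
proof -
  have hd: "w ! 0 = (i, True)" using w by (simp add: hd_conv_nth)
  then have i: "i \<in> {1..r}" using word_in_nth[of r w 0] w by auto
  have 0: "0 \<in> letter_positions i w" using hd w by (simp add: letter_positions_def)
  show ?thesis
    using loop_equation[OF i w(1)] E_Nil_Cons[of "w # ws"] w
    unfolding sum.remove[OF finite_letter_positions 0]
    by (simp add: hd cut_pos_def letter_sign_def algebra_simps)
qed

end

text \<open>A cut at the very end would lie behind a final letter inverse to the first one, against
  cyclic reducedness. So both pieces are nonempty, and as subwords of a reduced word they are
  nontrivial.\<close>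

lemma cut_bounds:
  assumes w: "cyc_reduced w" "hd w = (i, True)" and k: "k \<in> letter_positions i w - {0}"
  shows "0 < cut_pos w k" "cut_pos w k < length w"
proof -
  show "0 < cut_pos w k" using k by (auto simp: cut_pos_def)
  show "cut_pos w k < length w"
  proof (rule ccontr)
    assume "\<not> cut_pos w k < length w"
    with k have k': "Suc k = length w" "\<not> snd (w ! k)" and "w \<noteq> []"
      by (auto simp: letter_positions_def cut_pos_def split: if_splits)
    then have "last w = w ! k" by (simp add: last_conv_nth flip: k'(1))
    moreover have "fst (w ! k) = i" using k by (simp add: letter_positions_def)
    ultimately have "last w = inv_letter (hd w)"
      using k'(2) w(2) by (simp add: inv_letter_def prod_eq_iff)
    with w(1) \<open>w \<noteq> []\<close> show False by (simp add: cyc_reduced_def)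
  qed
qed

lemma norm_letter_sign [simp]: "norm (letter_sign w k :: 'a::real_normed_field) = 1"
  by (simp add: letter_sign_def)

section \<open>A bound uniform in the matrix size\<close>

context loop_system
begin

text \<open>4^K K! is the product of the factors 4 k for k \<le> K, one lost in each induction step.
  The loop equation is applied at a family attaining the maximum M over
  \<open>words (Suc K)\<close>; the threshold on N makes the occurrences of M on the other side
  absorbable.\<close>

lemma norm_E_le:
  assumes "real N \<ge> 4 * real K + 2" "ws \<in> words K"
  shows "norm (E ws) \<le> 4 ^ K * fact K"
  using assms
proof (induction K arbitrary: ws)
  case 0
  have "ws = []"
  proof (cases ws)
    case (Cons w ws')
    with 0 show ?thesis by (cases "w = []") (auto simp: words_Cons)
  qed
  then show ?case by (simp add: E_Nil)
next
  case (Suc K)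
  let ?C = "4 ^ K * fact K :: real"
  define M where "M = Max ((\<lambda>ws. norm (E ws)) ` words (Suc K))"
  have ne: "[] \<in> words (Suc K)" by (simp add: words_def)
  have M: "norm (E ws) \<le> M" if "ws \<in> words (Suc K)" for ws
    unfolding M_def using that finite_words by (intro Max_ge) auto
  have "M \<in> (\<lambda>ws. norm (E ws)) ` words (Suc K)"
    unfolding M_def using ne finite_words by (intro Max_in) auto
  then obtain vs where vs: "vs \<in> words (Suc K)" "M = norm (E vs)" by auto

  have C: "norm (E ws) \<le> ?C" if "ws \<in> words K" for ws
    using that Suc.prems(1) by (intro Suc.IH) auto
  have M0: "M \<ge> 0" using vs by simp
  \<comment> \<open>A nontrivial \<open>w\<close> leaves the family in \<open>words (Suc K)\<close>,
    bounded by M. A trivial one costs a factor N, but then only \<open>ws\<close> remains, which is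
    covered by the induction hypothesis. The sum bounds both cases without deciding which one
    occurs.\<close>
  have term_le: "norm (E (w # ws)) \<le> M + N * ?C"
    if "word_in r w" "ws \<in> words K" "length w + sum_list (map length ws) \<le> Suc K" for w ws
  proof (cases "red w = []")
    case True
    then have "norm (E (w # ws)) = N * norm (E ws)"
      using E_red_Nil[of w ws] that wordsD[of ws] by (simp add: norm_mult)
    also have "\<dots> \<le> N * ?C" using C[OF that(2)] by (intro mult_left_mono) auto
    finally show ?thesis using M0 by simp
  next
    case False
    then have "w # ws \<in> words (Suc K)" using that by (auto simp: words_def)
    then show ?thesis using M[of "w # ws"] by (simp add: add_increasing2)
  qed
  have "M \<le> 4 ^ Suc K * fact (Suc K)"
  proof (cases vs)
    case Nil
    have "(1::real) * 1 \<le> 4 ^ Suc K * fact (Suc K)"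
      by (intro mult_mono one_le_power fact_ge_1) auto
    then show ?thesis using vs Nil by (simp add: E_Nil del: power_Suc fact_Suc)
  next
    case (Cons w0 ws)
    have w0: "list_all (word_in r) (w0 # ws)" "red w0 \<noteq> []" "length w0 \<le> Suc K"
        "ws \<in> words (Suc K - length w0)"
      using vs(1) wordsD[OF vs(1)] unfolding Cons by (auto simp: words_Cons)
    \<comment> \<open>The first word of the maximising family may be made cyclically reduced and
      positive at the start without changing the value of \<open>E\<close> or leaving the length
      bound.\<close>
    obtain w1 where w1: "cyc_reduced w1" "word_in r w1" "length w1 \<le> length w0"
        "E (w1 # ws) = E (w0 # ws)" "red w1 = [] \<longleftrightarrow> red w0 = []"
      by (rule E_cyclic_reduction[OF w0(1)])
    then have w1n: "w1 \<noteq> []" using w0 by auto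
    obtain w i where w: "cyc_reduced w" "hd w = (i, True)" "length w = length w1"
        "word_in r w \<longleftrightarrow> word_in r w1" "w = w1 \<or> w = inv_word (tl w1 @ [hd w1])"
      using positive_start[OF w1(1) w1n] by metis
    have wr: "word_in r w" using w w1 by simp
    have wl: "1 \<le> length w" "length w \<le> length w0" using w w1 w1n by (auto simp: Suc_le_eq)
    have wn: "w \<noteq> []" using wl by auto
    have all: "list_all (word_in r) (w # ws)" using wr w0 by simp
    have Ew: "E (w # ws) = E (w0 # ws)"
    proof -
      have "E ((tl w1 @ [hd w1]) # ws) = E (w1 # ws)"
        using E_rotate[of "[hd w1]" "tl w1" ws] w1 w1n w0(1)
        by (cases w1) auto
      moreover have "E (inv_word (tl w1 @ [hd w1]) # ws) = E ((tl w1 @ [hd w1]) # ws)"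
        using w1 w1n w0(1) by (intro E_inv) (cases w1, auto)
      ultimately show ?thesis using w(5) w1(4) by auto
    qed
    have wsK: "ws \<in> words K" "ws \<in> words (Suc K - length w)"
      using w0(4) wl words_mono[of "Suc K - length w0" _ ws] w0(3) by auto
    have rw: "red w \<noteq> []" using w(1) wn by (simp add: cyc_reduced_def red_reduced)
    let ?S1 = "\<Sum>k\<in>letter_positions i w - {0}. letter_sign w k *
         (E (take (cut_pos w k) w # drop (cut_pos w k) w # ws) -
          \<sigma> * E ((inv_word (take (cut_pos w k) w) @ drop (cut_pos w k) w) # ws))"
    let ?S2 = "\<Sum>j<length ws. \<Sum>k\<in>letter_positions i (ws ! j). letter_sign (ws ! j) k *
         (E ((w @ cyc_shift (cut_pos (ws ! j) k) (ws ! j)) # remove_nth j ws) -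
          E ((inv_word (cyc_shift (cut_pos (ws ! j) k) (ws ! j)) @ w) # remove_nth j ws))"
    let ?T = "2 * M + 2 * (N * ?C)"
    have T0: "?T \<ge> 0" using M0 by simp
    have card: "card (letter_positions i v) \<le> length v" for v
      using card_mono[of "{..<length v}" "letter_positions i v"] by (auto simp: letter_positions_def)
    have "norm ?S1 \<le> (\<Sum>k\<in>letter_positions i w - {0}. ?T)"
    proof (rule sum_norm_le)
      fix k assume k: "k \<in> letter_positions i w - {0}"
      let ?t = "take (cut_pos w k) w" and ?d = "drop (cut_pos w k) w"
      note c = cut_bounds[OF w(1,2) k]
      \<comment> \<open>The two pieces together have the length of \<open>w\<close>, so the total is
        unchanged and only M is available as a bound. Were a piece trivial, its factor N could not
        be compensated by the induction hypothesis.\<close>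
      have "reduced_word ?t" "reduced_word ?d" "?t \<noteq> []" "?d \<noteq> []"
        using w(1) c by (auto simp: cyc_reduced_def reduced_take reduced_drop)
      then have "?t # ?d # ws \<in> words (Suc K)"
        using c wsK wr wl w0(3) by (simp add: words_Cons red_reduced word_in_take word_in_drop min_def)
      then have "norm (E (?t # ?d # ws)) \<le> M" by (rule M)
      moreover have "norm (E ((inv_word ?t @ ?d) # ws)) \<le> M + N * ?C"
      proof (rule term_le)
        show "length (inv_word ?t @ ?d) + sum_list (map length ws) \<le> Suc K"
          using c wsK(2) wl w0(3) by (auto simp: words_def)
      qed (use wsK wr in \<open>simp_all add: word_in_take word_in_drop\<close>)
      moreover have "norm (letter_sign w k * (E (?t # ?d # ws) - \<sigma> * E ((inv_word ?t @ ?d) # ws)))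
          \<le> norm (E (?t # ?d # ws)) + norm (E ((inv_word ?t @ ?d) # ws))"
        using norm_triangle_ineq4[of "E (?t # ?d # ws)" "\<sigma> * E ((inv_word ?t @ ?d) # ws)"]
        by (simp add: norm_mult norm_sign)
      moreover have "N * ?C \<ge> 0" by simp
      ultimately show "norm (letter_sign w k * (E (?t # ?d # ws) - \<sigma> * E ((inv_word ?t @ ?d) # ws))) \<le> ?T"
        by linarith
    qed
    also have "\<dots> \<le> length w * ?T"
      using card[of w] T0 card_mono[of "letter_positions i w" "letter_positions i w - {0}"]
      by (simp del: sum_constant add: sum_constant) (intro mult_right_mono; simp)
    finally have S1: "norm ?S1 \<le> length w * ?T" .
    have "norm ?S2 \<le> (\<Sum>j<length ws. length (ws ! j) * ?T)"
    proof (rule sum_norm_le)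
      fix j assume "j \<in> {..<length ws}"
      then have j: "j < length ws" by simp
      let ?v = "ws ! j" and ?rs = "remove_nth j ws"
      note rj = words_remove_nth[OF wsK(2) j]
      have rsK: "?rs \<in> words K"
        using rj(4) wl words_mono[of "Suc K - length w - length (ws ! j)" K] by simp
      have len: "length w + length ?v + sum_list (map length ?rs) \<le> Suc K"
        using rj(3,4) wl w0(3) by (auto simp: words_def)
      have "norm (\<Sum>k\<in>letter_positions i ?v. letter_sign ?v k *
         (E ((w @ cyc_shift (cut_pos ?v k) ?v) # ?rs) -
          E ((inv_word (cyc_shift (cut_pos ?v k) ?v) @ w) # ?rs))) \<le> (\<Sum>k\<in>letter_positions i ?v. ?T)"
      proof (rule sum_norm_le)
        fix k
        let ?c = "cyc_shift (cut_pos ?v k) ?v"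
        have "norm (E ((w @ ?c) # ?rs)) \<le> M + N * ?C"
          using len rsK rj wr by (intro term_le) auto
        moreover have "norm (E ((inv_word ?c @ w) # ?rs)) \<le> M + N * ?C"
          using len rsK rj wr by (intro term_le) auto
        ultimately show "norm (letter_sign ?v k * (E ((w @ ?c) # ?rs) - E ((inv_word ?c @ w) # ?rs))) \<le> ?T"
          using norm_triangle_ineq4[of "E ((w @ ?c) # ?rs)" "E ((inv_word ?c @ w) # ?rs)"]
          by (simp add: norm_mult)
      qed
      also have "\<dots> \<le> length ?v * ?T"
        using card[of ?v] T0 by (simp del: sum_constant add: sum_constant) (intro mult_right_mono; simp)
      finally show "norm (\<Sum>k\<in>letter_positions i ?v. letter_sign ?v k *
         (E ((w @ cyc_shift (cut_pos ?v k) ?v) # ?rs) -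
          E ((inv_word (cyc_shift (cut_pos ?v k) ?v) @ w) # ?rs))) \<le> length ?v * ?T" .
    qed
    also have "\<dots> = sum_list (map length ws) * ?T"
      by (simp add: sum_distrib_right sum_list_sum_nth atLeast0LessThan)
    finally have S2: "norm ?S2 \<le> sum_list (map length ws) * ?T" .
    have "(real N - 1) * M \<le> norm (of_nat N - \<sigma>) * M"
      using norm_triangle_ineq2[of "of_nat N :: 'a" \<sigma>] M0 by (intro mult_right_mono) (simp_all add: norm_sign)
    also have "\<dots> = norm ((of_nat N - \<sigma>) * E (w # ws))"
      using vs Ew Cons by (simp add: norm_mult)
    also have "\<dots> = norm (- ?S1 - ?S2)"
      unfolding loop_equation_first[OF all wn w(2)] ..
    also have "\<dots> \<le> norm ?S1 + norm ?S2"
      using norm_triangle_ineq4[of "- ?S1" ?S2] by simp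
    also have "\<dots> \<le> (length w + sum_list (map length ws)) * ?T"
      using S1 S2 by (simp add: distrib_right)
    also have "\<dots> \<le> real (Suc K) * ?T"
      using wsK(2) wl w0(3) T0 by (intro mult_right_mono of_nat_mono) (auto simp: words_def)
    finally have main: "(real N - 1) * M \<le> real (Suc K) * (2 * M + 2 * (N * ?C))" .
    \<comment> \<open>N \<ge> 4 (K + 1) + 2 says exactly that N \<le> 2 (N - 1 - 2 (K + 1)). By
      \<open>main\<close> the right side is at most twice 2 (K + 1) N \<open>?C\<close>, and N
      cancels.\<close>
    have "real N * M \<le> 2 * (real N - 1 - 2 * real (Suc K)) * M"
      using Suc.prems(1) M0 by (intro mult_right_mono) auto
    also have "\<dots> \<le> real N * (4 * real (Suc K) * ?C)"
      using main by (simp add: algebra_simps)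
    finally have "M \<le> 4 * real (Suc K) * ?C"
      using Suc.prems(1) by (simp add: mult_le_cancel_left_pos)
    then show ?thesis by (simp add: algebra_simps)
  qed
  with M[OF Suc.prems(2)] show ?case by simp
qed

end

text \<open>These are the joint moments of \<open>sqrt p * Z p + (if even p then \<sigma> else 0)\<close> for independent standard
  Gaussian variables \<open>Z p\<close>, in the form of the Gaussian integration by parts recursion.\<close>

fun loop_limit :: "'a::field \<Rightarrow> nat list \<Rightarrow> 'a" where
  "loop_limit \<sigma> [] = 1"
| "loop_limit \<sigma> (p # ps) = (if even p then \<sigma> * loop_limit \<sigma> ps else 0) +
     (\<Sum>j<length ps. if ps ! j = p then of_nat p * loop_limit \<sigma> (remove_nth j ps) else 0)"

lemma cyc_shift_word_pow_eq_iff: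
  assumes u: "prim_word u" and "p \<ge> 1" "c \<le> q * length u"
  shows "cyc_shift c (word_pow u q) = word_pow u p \<longleftrightarrow> q = p \<and> length u dvd c"
proof
  assume eq: "cyc_shift c (word_pow u q) = word_pow u p"
  have "u \<noteq> []" using u by (simp add: prim_word_def)
  moreover have "q * length u = p * length u"
    using arg_cong[OF eq, of length] by simp
  ultimately have "q = p" by simp
  then show "q = p \<and> length u dvd c"
    using prim_word_rotate[OF u assms(2), of c] eq assms(3) by (simp add: cyc_shift_def)
next
  assume *: "q = p \<and> length u dvd c"
  then obtain a where c: "c = a * length u" by (metis dvd_div_mult_self)
  have "u \<noteq> []" using u by (simp add: prim_word_def)
  then have "a \<le> p" using * c assms(3) by simp
  then show "cyc_shift c (word_pow u q) = word_pow u p"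
    using * unfolding c cyc_shift_def
    by (simp add: take_word_pow drop_word_pow flip: word_pow_add)
qed

section \<open>Trivial words arising from powers of a primitive word\<close>

context
  fixes u :: fg_word and i :: nat
  assumes u: "prim_word u" "cyc_reduced u" "hd u = (i, True)"
begin

lemma prim_word_not_Nil: "u \<noteq> []"
  using u by (simp add: prim_word_def)

lemma word_pow_reduced: "cyc_reduced (word_pow u p)" "reduced_word (word_pow u p)"
  using cyc_reduced_word_pow[OF u(2), of p] by (auto simp: cyc_reduced_def)

lemma word_pow_not_Nil: "p \<ge> 1 \<Longrightarrow> word_pow u p \<noteq> []"
  using prim_word_not_Nil by (metis length_word_pow length_0_conv mult_eq_0_iff not_one_le_zero)

lemma nth_word_pow_multiple: "a < p \<Longrightarrow> word_pow u p ! (a * length u) = (i, True)"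
  using prim_word_not_Nil u(3) by (subst nth_word_pow) (auto simp: hd_conv_nth)

lemma letter_positions_multiple: "a < p \<Longrightarrow> a * length u \<in> letter_positions i (word_pow u p)"
  using prim_word_not_Nil nth_word_pow_multiple by (auto simp: letter_positions_def)

text \<open>A cut behind an inverse letter makes this letter the last one of the rotation. As the
  powers of \<open>u\<close> begin with the generator i, the rotation would not be cyclically
  reduced. So only positive occurrences contribute, with sign +1.\<close>

lemma cut_eq_shift:
  assumes p: "p \<ge> 1" and k: "k \<in> letter_positions i (word_pow u q)"
    and eq: "cyc_shift (cut_pos (word_pow u q) k) (word_pow u q) = word_pow u p"
  shows "cut_pos (word_pow u q) k = k \<and> letter_sign (word_pow u q) k = (1::'a::ring_1)"
proof -
  let ?v = "word_pow u q"
  have "snd (?v ! k)"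
  proof (rule ccontr)
    assume n: "\<not> snd (?v ! k)"
    then have c: "cut_pos ?v k = Suc k" by (simp add: cut_pos_def)
    have k': "k < length ?v" "fst (?v ! k) = i" using k by (auto simp: letter_positions_def)
    then have "take (Suc k) ?v = take k ?v @ [?v ! k]" by (simp add: take_Suc_conv_app_nth)
    then have "last (word_pow u p) = ?v ! k" unfolding eq[symmetric] c cyc_shift_def by simp
    also have "\<dots> = inv_letter (hd (word_pow u p))"
      using n k' hd_word_pow[OF p prim_word_not_Nil] u(3) by (simp add: inv_letter_def prod_eq_iff)
    finally show False using word_pow_reduced(1)[of p] word_pow_not_Nil[OF p] by (simp add: cyc_reduced_def)
  qed
  then show ?thesis by (simp add: cut_pos_def letter_sign_def)
qed

text \<open>The contributing cuts are the starting points of the p copies of \<open>u\<close>. Each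
  of them carries the letter \<open>(i, True)\<close>, so all signs are +1 and nothing
  cancels.\<close>

lemma sum_cyc_shift_pow:
  assumes p: "p \<ge> 1"
  shows "(\<Sum>k\<in>letter_positions i (word_pow u q). letter_sign (word_pow u q) k *
      (if cyc_shift (cut_pos (word_pow u q) k) (word_pow u q) = word_pow u p then x else 0)) =
    (if q = p then of_nat p * x else (0::'a::{comm_ring_1}))"
proof -
  let ?v = "word_pow u q"
  have "(\<Sum>k\<in>letter_positions i ?v. letter_sign ?v k *
      (if cyc_shift (cut_pos ?v k) ?v = word_pow u p then x else 0)) =
    (\<Sum>k\<in>letter_positions i ?v. if q = p \<and> length u dvd k then x else 0)"
  proof (rule sum.cong)
    fix k assume k: "k \<in> letter_positions i ?v"
    then have kl: "k < q * length u" by (simp add: letter_positions_def)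
    show "letter_sign ?v k * (if cyc_shift (cut_pos ?v k) ?v = word_pow u p then x else 0) =
      (if q = p \<and> length u dvd k then x else 0)"
    proof (cases "q = p \<and> length u dvd k")
      case True
      then obtain a where a: "k = a * length u" by (metis dvd_div_mult_self)
      with kl have "a < q" by simp
      then have "snd (?v ! k)" using a nth_word_pow_multiple[of a q] by simp
      then have "cut_pos ?v k = k" "letter_sign ?v k = (1::'a)" by (simp_all add: cut_pos_def letter_sign_def)
      then show ?thesis using cyc_shift_word_pow_eq_iff[OF u(1) p, of k q] kl True by simp
    next
      case False
      have "cyc_shift (cut_pos ?v k) ?v \<noteq> word_pow u p"
      proof
        assume eq: "cyc_shift (cut_pos ?v k) ?v = word_pow u p"
        then have "cut_pos ?v k = k" using cut_eq_shift[OF p k eq] by blast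
        then show False using eq cyc_shift_word_pow_eq_iff[OF u(1) p, of k q] kl False by auto
      qed
      then show ?thesis unfolding if_not_P[OF False] by simp
    qed
  qed simp
  also have "\<dots> = (if q = p then of_nat p * x else 0)"
  proof (cases "q = p")
    case True
    have "{k \<in> letter_positions i (word_pow u p). length u dvd k} = (\<lambda>a. a * length u) ` {..<p}"
    proof (intro equalityI subsetI)
      fix k assume "k \<in> {k \<in> letter_positions i (word_pow u p). length u dvd k}"
      then show "k \<in> (\<lambda>a. a * length u) ` {..<p}"
        by (auto simp: letter_positions_def elim!: dvdE)
    qed (use letter_positions_multiple in auto)
    moreover have "card ((\<lambda>a. a * length u) ` {..<p}) = p"
      using prim_word_not_Nil by (subst card_image) (auto simp: inj_on_def)
    ultimately show ?thesis using True
      by (simp add: sum.If_cases Int_def)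
  qed simp
  finally show ?thesis .
qed

text \<open>Equal halves mean that rotation by half the length fixes the power, so |u| divides half
  the length and p is even. The only surviving cut is then the one after p div 2 copies; it is not
  the excluded position 0.\<close>

lemma sum_square_pow:
  assumes p: "p \<ge> 1"
  defines "w \<equiv> word_pow u p"
  shows "(\<Sum>k\<in>letter_positions i w - {0}. letter_sign w k *
      (if take (cut_pos w k) w = drop (cut_pos w k) w then x else 0)) =
    (if even p then x else (0::'a::{comm_ring_1}))"
proof -
  let ?h = "p div 2 * length u"
  have len: "length w = p * length u" by (simp add: w_def)
  have "letter_sign w k * (if take (cut_pos w k) w = drop (cut_pos w k) w then x else 0) =
      (if k = ?h then (if even p then x else 0) else 0)" (is "?l = ?r")
    if k: "k \<in> letter_positions i w - {0}" for k
  proof (cases "take (cut_pos w k) w = drop (cut_pos w k) w")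
    case True
    have c: "0 < cut_pos w k" "cut_pos w k < length w"
      using cut_bounds[of w i k] k word_pow_reduced(1)[of p] hd_word_pow[OF p prim_word_not_Nil] u(3)
      by (auto simp: w_def)
    then have c2: "2 * cut_pos w k = length w" using arg_cong[OF True, of length] by simp
    have "cyc_shift (cut_pos w k) w = w"
      unfolding cyc_shift_def using True by (metis append_take_drop_id)
    then have *: "cut_pos w k = k" "letter_sign w k = (1::'a)"
      using cut_eq_shift[OF p, of k p, where 'a='a] k by (auto simp: w_def)
    have "length u dvd k"
      using cyc_shift_word_pow_eq_iff[OF u(1) p, of k p] \<open>cyc_shift (cut_pos w k) w = w\<close> * c
      by (simp add: w_def)
    then obtain a where a: "k = a * length u" by (metis dvd_div_mult_self)
    then have "2 * a * length u = p * length u" using c2 * len by auto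
    then have "p = 2 * a" using prim_word_not_Nil by auto
    then show ?thesis using True * a by simp
  next
    case False
    have "odd p \<or> k \<noteq> ?h"
    proof (rule ccontr)
      assume "\<not> (odd p \<or> k \<noteq> ?h)"
      then obtain a where a: "p = 2 * a" "k = a * length u" by auto
      then have "snd (w ! k)" using nth_word_pow_multiple[of a p] p by (simp add: w_def)
      then have "cut_pos w k = k" by (simp add: cut_pos_def)
      then have "take (cut_pos w k) w = drop (cut_pos w k) w"
        using a by (simp add: w_def take_word_pow drop_word_pow)
      with False show False by blast
    qed
    then show ?thesis using False by auto
  qed
  then have "(\<Sum>k\<in>letter_positions i w - {0}. letter_sign w k *
      (if take (cut_pos w k) w = drop (cut_pos w k) w then x else 0)) =
      (\<Sum>k\<in>letter_positions i w - {0}. if k = ?h then (if even p then x else 0) else 0)"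
    by (intro sum.cong) auto
  also have "\<dots> = (if ?h \<in> letter_positions i w - {0} then (if even p then x else 0) else 0)"
    by (simp add: sum.delta)
  also have "\<dots> = (if even p then x else 0)"
  proof (cases "even p")
    case True
    then have "p div 2 < p" "p div 2 > 0" using p by auto
    then have "?h \<in> letter_positions i w - {0}"
      using letter_positions_multiple[of "p div 2" p] prim_word_not_Nil by (auto simp: w_def)
    then show ?thesis by simp
  qed simp
  finally show ?thesis .
qed

text \<open>Both factors are reduced, so triviality of the product would make a rotation of a power
  of \<open>u\<close> the inverse of a power, which \<open>rotate_neq_inverse\<close> excludes.
  Hence merging in equal orientation leaves no trace in the limit.\<close>

lemma word_pow_not_inverse:
  assumes "p \<ge> 1"
  shows "red (word_pow u p @ cyc_shift c (word_pow u q)) \<noteq> []"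
proof
  assume *: "red (word_pow u p @ cyc_shift c (word_pow u q)) = []"
  have "inv_word (word_pow u p) = cyc_shift c (word_pow u q)"
    using * reduced_rotate[OF word_pow_reduced(1), of c q] word_pow_reduced(2)[of p]
    unfolding red_append_inv_iff cyc_shift_def by (simp add: red_reduced)
  moreover from this have "p * length u = q * length u"
    by (metis length_cyc_shift length_inv_word length_word_pow)
  then have "p = q" using prim_word_not_Nil by simp
  ultimately show False
    using rotate_neq_inverse[of "word_pow u p" c] word_pow_reduced(2)[of p] word_pow_not_Nil[OF assms]
    by (auto simp: cyc_shift_def)
qed

end

section \<open>Passage to the limit of large matrices\<close>

locale loop_system_sequence =
  fixes r :: nat and N :: "nat \<Rightarrow> nat" and \<sigma> :: "'a::real_normed_field"
    and E :: "nat \<Rightarrow> fg_word list \<Rightarrow> 'a"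
  assumes loop: "\<forall>\<^sub>F n in sequentially. loop_system r (N n) \<sigma> (E n)"
    and N: "filterlim N at_top sequentially"
begin

abbreviation nontrivial :: "fg_word list \<Rightarrow> bool" where
  "nontrivial ws \<equiv> (\<forall>w\<in>set ws. word_in r w \<and> red w \<noteq> [])"

text \<open>For trivial \<open>w\<close> the quotient is eventually equal to \<open>E n ws\<close>,
  because the factor N cancels. Otherwise the numerator stays bounded by
  \<open>norm_E_le\<close>.\<close>

lemma tendsto_over_N:
  assumes "word_in r w" "nontrivial ws" "red w = [] \<Longrightarrow> (\<lambda>n. E n ws) \<longlonglongrightarrow> l"
  shows "(\<lambda>n. E n (w # ws) / of_nat (N n)) \<longlonglongrightarrow> (if red w = [] then l else 0)"
proof (cases "red w = []")
  case True
  have "\<forall>\<^sub>F n in sequentially. E n ws = E n (w # ws) / of_nat (N n)"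
    using loop N[unfolded filterlim_at_top, rule_format, of 1]
  proof eventually_elim
    case (elim n)
    then interpret loop_system r "N n" \<sigma> "E n" by simp
    show ?case using elim True assms E_red_Nil[of w ws] by (simp add: list_all_iff)
  qed
  with assms(3)[OF True] show ?thesis using True by (auto intro: Lim_transform_eventually)
next
  case False
  define K where "K = sum_list (map length (w # ws))"
  let ?C = "4 ^ K * fact K :: real"
  have lim: "filterlim (\<lambda>n. real (N n)) at_top sequentially"
    using N filterlim_real_sequentially by (rule filterlim_compose[rotated])
  have "(\<lambda>n. E n (w # ws) / of_nat (N n)) \<longlonglongrightarrow> 0"
  proof (rule Lim_null_comparison)
    show "(\<lambda>n. ?C / real (N n)) \<longlonglongrightarrow> 0"
      by (intro real_tendsto_divide_at_top[OF tendsto_const lim])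
    show "\<forall>\<^sub>F n in sequentially. norm (E n (w # ws) / of_nat (N n)) \<le> ?C / real (N n)"
      using loop lim[unfolded filterlim_at_top, rule_format, of "4 * real K + 2"]
    proof eventually_elim
      case (elim n)
      then interpret loop_system r "N n" \<sigma> "E n" by simp
      have "w # ws \<in> words K" using assms False by (auto simp: words_def K_def)
      then have "norm (E n (w # ws)) \<le> ?C" using elim by (intro norm_E_le) auto
      then show ?case by (simp add: norm_divide divide_right_mono)
    qed
  qed
  then show ?thesis using False by simp
qed

text \<open>Divided by N, the loop equation for the first word turns in the limit into the recursion
  of \<open>loop_limit\<close>. The surviving terms lack the first word, or the first and one more,
  so induction on the number of exponents applies to them.\<close>

theorem tendsto_loop_limit:
  assumes u: "prim_word u" "cyc_reduced u" "hd u = (i, True)" "word_in r u"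
    and ps: "\<forall>p\<in>set ps. p \<ge> 1"
  shows "(\<lambda>n. E n (map (word_pow u) ps)) \<longlonglongrightarrow> loop_limit \<sigma> ps"
  using ps
proof (induction ps rule: length_induct)
  case (1 qs)
  show ?case
  proof (cases qs)
    case Nil
    have "\<forall>\<^sub>F n in sequentially. 1 = E n (map (word_pow u) qs)"
      using loop by eventually_elim (simp add: Nil loop_system.E_Nil)
    then show ?thesis by (auto simp: Nil intro: Lim_transform_eventually)
  next
    case (Cons p ps)
    have p: "p \<ge> 1" and ps1: "\<And>q. q \<in> set ps \<Longrightarrow> q \<ge> 1" using 1(2) Cons by auto
    define w where "w = word_pow u p"
    define ws where "ws = map (word_pow u) ps"
    define v where "v j = word_pow u (ps ! j)" for j
    note u' = u(1-3)
    have IH: "(\<lambda>n. E n ws) \<longlonglongrightarrow> loop_limit \<sigma> ps"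
      unfolding ws_def using 1 Cons by auto
    have IHj: "(\<lambda>n. E n (remove_nth j ws)) \<longlonglongrightarrow> loop_limit \<sigma> (remove_nth j ps)"
      if "j < length ps" for j
      unfolding ws_def remove_nth_map using 1 Cons that set_remove_nth[of j ps]
      by (intro 1(1)[rule_format]) auto
    have wr: "word_in r (word_pow u q)" for q using word_in_word_pow u by auto
    have red_pow: "red (word_pow u q) \<noteq> []" if "q \<ge> 1" for q
      using red_reduced[OF word_pow_reduced(2)[OF u']] word_pow_not_Nil[OF u' that] by metis
    have nt: "nontrivial ws" using wr red_pow ps1 by (auto simp: ws_def)
    have ntj: "nontrivial (remove_nth j ws)" for j using nt set_remove_nth[of j ws] by blast
    have w: "cyc_reduced w" "reduced_word w" "w \<noteq> []" "hd w = (i, True)" "word_in r w"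
      using word_pow_reduced[OF u'] word_pow_not_Nil[OF u' p] hd_word_pow[OF p prim_word_not_Nil[OF u']] u wr by (auto simp: w_def)
    have lws: "length ws = length ps" and wsj: "\<And>j. j < length ps \<Longrightarrow> ws ! j = v j"
      by (auto simp: ws_def v_def)
    let ?T = "\<lambda>k. take (cut_pos w k) w" and ?D = "\<lambda>k. drop (cut_pos w k) w"
    let ?V = "\<lambda>j k. cyc_shift (cut_pos (v j) k) (v j)"
    let ?S1 = "\<lambda>n. \<Sum>k\<in>letter_positions i w - {0}. letter_sign w k *
        (E n (?T k # ?D k # ws) / of_nat (N n) - \<sigma> * (E n ((inv_word (?T k) @ ?D k) # ws) / of_nat (N n)))"
    let ?S2 = "\<lambda>n. \<Sum>j<length ps. \<Sum>k\<in>letter_positions i (v j). letter_sign (v j) k *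
        (E n ((w @ ?V j k) # remove_nth j ws) / of_nat (N n) -
         E n ((inv_word (?V j k) @ w) # remove_nth j ws) / of_nat (N n))"
    have "?S1 \<longlonglongrightarrow> (\<Sum>k\<in>letter_positions i w - {0}. letter_sign w k *
        (0 - \<sigma> * (if ?T k = ?D k then loop_limit \<sigma> ps else 0)))"
    proof (intro tendsto_sum tendsto_mult tendsto_const tendsto_diff)
      fix k assume k: "k \<in> letter_positions i w - {0}"
      note c = cut_bounds[OF w(1,4) k]
      have T: "reduced_word (?T k)" "reduced_word (?D k)" "?T k \<noteq> []" "?D k \<noteq> []"
          "word_in r (?T k)" "word_in r (?D k)"
        using c w by (auto simp: reduced_take reduced_drop word_in_take word_in_drop)
      \<comment> \<open>Splitting alone never contributes, since both pieces are nontrivial. The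
        reversed term below contributes if and only if the two reduced pieces coincide.\<close>
      show "(\<lambda>n. E n (?T k # ?D k # ws) / of_nat (N n)) \<longlonglongrightarrow> 0"
        using tendsto_over_N[of "?T k" "?D k # ws" 0] T nt by (simp add: red_reduced)
      show "(\<lambda>n. E n ((inv_word (?T k) @ ?D k) # ws) / of_nat (N n)) \<longlonglongrightarrow>
          (if ?T k = ?D k then loop_limit \<sigma> ps else 0)"
        using tendsto_over_N[of "inv_word (?T k) @ ?D k" ws, OF _ nt IH] T
        by (simp add: red_inv_append_iff red_reduced)
    qed
    also have "(\<Sum>k\<in>letter_positions i w - {0}. letter_sign w k *
        (0 - \<sigma> * (if ?T k = ?D k then loop_limit \<sigma> ps else 0))) =
        - \<sigma> * (\<Sum>k\<in>letter_positions i w - {0}. letter_sign w k *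
        (if ?T k = ?D k then loop_limit \<sigma> ps else 0))"
      by (simp add: sum_distrib_left mult.left_commute sum_negf)
    also have "\<dots> = - (if even p then \<sigma> * loop_limit \<sigma> ps else 0)"
      unfolding w_def sum_square_pow[OF u' p] by simp
    finally have S1: "?S1 \<longlonglongrightarrow> - (if even p then \<sigma> * loop_limit \<sigma> ps else 0)" .
    have "?S2 \<longlonglongrightarrow> (\<Sum>j<length ps. \<Sum>k\<in>letter_positions i (v j). letter_sign (v j) k *
        (0 - (if ?V j k = w then loop_limit \<sigma> (remove_nth j ps) else 0)))"
    proof (intro tendsto_sum tendsto_mult tendsto_const tendsto_diff)
      fix j k assume "j \<in> {..<length ps}"
      then have j: "j < length ps" by simp
      have V: "reduced_word (?V j k)" "word_in r (?V j k)"
        using reduced_rotate[OF word_pow_reduced(1)[OF u']] wr by (auto simp: v_def cyc_shift_def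
            word_in_take word_in_drop)
      \<comment> \<open>Of the two ways to merge, only the one with \<open>inv_word\<close> can
        cancel; its minus sign in the loop equation becomes a plus once E(w) is isolated.\<close>
      have "red (w @ ?V j k) \<noteq> []"
        unfolding w_def v_def by (rule word_pow_not_inverse[OF u' p])
      then show "(\<lambda>n. E n ((w @ ?V j k) # remove_nth j ws) / of_nat (N n)) \<longlonglongrightarrow> 0"
        using tendsto_over_N[of "w @ ?V j k" "remove_nth j ws" 0] w V ntj by simp
      show "(\<lambda>n. E n ((inv_word (?V j k) @ w) # remove_nth j ws) / of_nat (N n)) \<longlonglongrightarrow>
          (if ?V j k = w then loop_limit \<sigma> (remove_nth j ps) else 0)"
        using tendsto_over_N[of "inv_word (?V j k) @ w" "remove_nth j ws", OF _ ntj IHj[OF j]] V w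
        by (simp add: red_inv_append_iff red_reduced)
    qed
    also have "(\<Sum>j<length ps. \<Sum>k\<in>letter_positions i (v j). letter_sign (v j) k *
        (0 - (if ?V j k = w then loop_limit \<sigma> (remove_nth j ps) else 0))) =
        - (\<Sum>j<length ps. \<Sum>k\<in>letter_positions i (v j). letter_sign (v j) k *
        (if ?V j k = w then loop_limit \<sigma> (remove_nth j ps) else 0))"
      by (simp add: sum_negf)
    also have "\<dots> = - (\<Sum>j<length ps. if ps ! j = p then of_nat p * loop_limit \<sigma> (remove_nth j ps) else 0)"
      unfolding w_def v_def sum_cyc_shift_pow[OF u' p] ..
    finally have S2: "?S2 \<longlonglongrightarrow>
        - (\<Sum>j<length ps. if ps ! j = p then of_nat p * loop_limit \<sigma> (remove_nth j ps) else 0)" .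
    have S: "(\<lambda>n. - ?S1 n - ?S2 n) \<longlonglongrightarrow> loop_limit \<sigma> qs"
      using tendsto_diff[OF tendsto_minus[OF S1] S2] by (simp add: Cons)
    have "filterlim (\<lambda>n. real (N n)) at_top sequentially"
      using N filterlim_real_sequentially by (rule filterlim_compose[rotated])
    then have "(\<lambda>n. of_real (1 / real (N n)) :: 'a) \<longlonglongrightarrow> of_real 0"
      by (intro tendsto_of_real real_tendsto_divide_at_top[OF tendsto_const])
    \<comment> \<open>This is the coefficient N - \<sigma> of the isolated term after division by
      N.\<close>
    then have "(\<lambda>n. 1 - \<sigma> / of_nat (N n)) \<longlonglongrightarrow> 1"
      using tendsto_diff[OF tendsto_const tendsto_mult[OF tendsto_const]]
      by (force simp: of_real_divide)
    then have lim: "(\<lambda>n. (- ?S1 n - ?S2 n) / (1 - \<sigma> / of_nat (N n))) \<longlonglongrightarrow> loop_limit \<sigma> qs"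
      using tendsto_divide[OF S] by fastforce
    have "\<forall>\<^sub>F n in sequentially. (- ?S1 n - ?S2 n) / (1 - \<sigma> / of_nat (N n)) = E n (w # ws)"
      using loop N[unfolded filterlim_at_top, rule_format, of 2]
    proof eventually_elim
      case (elim n)
      then interpret loop_system r "N n" \<sigma> "E n" by simp
      have Nn: "of_nat (N n) \<noteq> (0 :: 'a)" using elim by simp
      have "of_nat (N n) \<noteq> \<sigma>"
        using elim norm_sign by (metis norm_of_nat of_nat_1 of_nat_eq_iff numeral_le_one_iff
            semiring_norm(69))
      then have N\<sigma>: "1 - \<sigma> / of_nat (N n) \<noteq> 0" using Nn by (simp add: field_simps)
      have all: "list_all (word_in r) (w # ws)" using w nt by (auto simp: list_all_iff)
      have "(1 - \<sigma> / of_nat (N n)) * E n (w # ws) = ((of_nat (N n) - \<sigma>) * E n (w # ws)) / of_nat (N n)"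
        using Nn by (simp add: field_simps)
      also have "\<dots> = - ?S1 n - ?S2 n"
        unfolding loop_equation_first[OF all w(3,4)] diff_divide_distrib minus_divide_left[symmetric]
          sum_divide_distrib lws
        by (intro arg_cong2[of _ _ _ _ "(-)"] arg_cong[of _ _ uminus] sum.cong refl)
          (simp_all add: wsj diff_divide_distrib right_diff_distrib)
      finally show ?case using N\<sigma> by (simp add: field_simps)
    qed
    from Lim_transform_eventually[OF lim this] show ?thesis by (simp add: Cons w_def ws_def)
  qed
qed

end

section \<open>Differentiation under the integral\<close>

text \<open>The remainder is required to be quadratic uniformly on \<open>\<Omega>\<close>, so that one may differentiate
  under an integral without a domination argument.\<close>

definition uderiv :: "'b set \<Rightarrow> (real \<Rightarrow> 'b \<Rightarrow> 'a::real_normed_field) \<Rightarrow> ('b \<Rightarrow> 'a) \<Rightarrow> bool" where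
  "uderiv \<Omega> f f' \<longleftrightarrow> (\<exists>B. \<forall>t\<in>{-1..1}. \<forall>x\<in>\<Omega>.
     norm (f t x) \<le> B \<and> norm (f' x) \<le> B \<and> norm (f t x - f 0 x - of_real t * f' x) \<le> B * t\<^sup>2)"

lemma uderivE:
  assumes "uderiv \<Omega> f f'"
  obtains B where "B \<ge> 0" "\<And>t x. \<bar>t\<bar> \<le> 1 \<Longrightarrow> x \<in> \<Omega> \<Longrightarrow> norm (f t x) \<le> B"
    "\<And>x. x \<in> \<Omega> \<Longrightarrow> norm (f' x) \<le> B"
    "\<And>t x. \<bar>t\<bar> \<le> 1 \<Longrightarrow> x \<in> \<Omega> \<Longrightarrow> norm (f t x - f 0 x - of_real t * f' x) \<le> B * t\<^sup>2"
proof -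
  obtain B where B: "\<And>t x. \<bar>t\<bar> \<le> 1 \<Longrightarrow> x \<in> \<Omega> \<Longrightarrow> norm (f t x) \<le> B \<and> norm (f' x) \<le> B \<and>
      norm (f t x - f 0 x - of_real t * f' x) \<le> B * t\<^sup>2"
    using assms unfolding uderiv_def by (metis abs_le_iff atLeastAtMost_iff minus_le_iff)
  show ?thesis
  proof (rule that[of "max B 0"])
    show "norm (f t x - f 0 x - of_real t * f' x) \<le> max B 0 * t\<^sup>2" if "\<bar>t\<bar> \<le> 1" "x \<in> \<Omega>" for t x
      using B[OF that] mult_right_mono[of B "max B 0" "t\<^sup>2"] by simp
    show "norm (f' x) \<le> max B 0" if "x \<in> \<Omega>" for x
      using B[of 0 x] that by auto
  qed (use B in \<open>auto simp: le_max_iff_disj\<close>)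
qed

lemma uderivI:
  assumes "\<And>t x. \<bar>t\<bar> \<le> 1 \<Longrightarrow> x \<in> \<Omega> \<Longrightarrow> norm (f t x) \<le> B1"
    "\<And>x. x \<in> \<Omega> \<Longrightarrow> norm (f' x) \<le> B2"
    "\<And>t x. \<bar>t\<bar> \<le> 1 \<Longrightarrow> x \<in> \<Omega> \<Longrightarrow> norm (f t x - f 0 x - of_real t * f' x) \<le> B3 * t\<^sup>2"
  shows "uderiv \<Omega> f f'"
  unfolding uderiv_def
proof (intro exI[of _ "max B1 (max B2 B3)"] ballI conjI)
  fix t :: real and x assume t: "t \<in> {-1..1}" and x: "x \<in> \<Omega>"
  have "norm (f t x - f 0 x - of_real t * f' x) \<le> B3 * t\<^sup>2" using assms(3) t x by auto
  also have "\<dots> \<le> max B1 (max B2 B3) * t\<^sup>2" by (intro mult_right_mono) auto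
  finally show "norm (f t x - f 0 x - of_real t * f' x) \<le> max B1 (max B2 B3) * t\<^sup>2" .
qed (use assms in \<open>auto simp: le_max_iff_disj\<close>)

lemma uderiv_cong:
  assumes "\<And>t x. \<bar>t\<bar> \<le> 1 \<Longrightarrow> x \<in> \<Omega> \<Longrightarrow> f t x = g t x" "\<And>x. x \<in> \<Omega> \<Longrightarrow> f' x = g' x"
  shows "uderiv \<Omega> f f' \<longleftrightarrow> uderiv \<Omega> g g'"
  unfolding uderiv_def using assms by (intro ex_cong1 ball_cong) auto

lemma uderiv_eqI:
  assumes "uderiv \<Omega> f f'"
    and "\<And>t x. \<bar>t\<bar> \<le> 1 \<Longrightarrow> x \<in> \<Omega> \<Longrightarrow> f t x = g t x" "\<And>x. x \<in> \<Omega> \<Longrightarrow> f' x = g' x"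
  shows "uderiv \<Omega> g g'"
  using assms uderiv_cong[of \<Omega> f g f' g'] by blast

lemma uderiv_const: "(\<And>x. x \<in> \<Omega> \<Longrightarrow> norm (c x) \<le> B) \<Longrightarrow> uderiv \<Omega> (\<lambda>t. c) (\<lambda>_. 0)"
  by (rule uderivI[of _ _ B _ 0 0]) auto

lemma uderiv_add:
  assumes "uderiv \<Omega> f f'" "uderiv \<Omega> g g'"
  shows "uderiv \<Omega> (\<lambda>t x. f t x + g t x) (\<lambda>x. f' x + g' x)"
proof -
  obtain B where B: "B \<ge> 0" "\<And>t x. \<bar>t\<bar> \<le> 1 \<Longrightarrow> x \<in> \<Omega> \<Longrightarrow> norm (f t x) \<le> B"
    "\<And>x. x \<in> \<Omega> \<Longrightarrow> norm (f' x) \<le> B"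
    "\<And>t x. \<bar>t\<bar> \<le> 1 \<Longrightarrow> x \<in> \<Omega> \<Longrightarrow> norm (f t x - f 0 x - of_real t * f' x) \<le> B * t\<^sup>2"
    using uderivE[OF assms(1)] by blast
  obtain C where C: "C \<ge> 0" "\<And>t x. \<bar>t\<bar> \<le> 1 \<Longrightarrow> x \<in> \<Omega> \<Longrightarrow> norm (g t x) \<le> C"
    "\<And>x. x \<in> \<Omega> \<Longrightarrow> norm (g' x) \<le> C"
    "\<And>t x. \<bar>t\<bar> \<le> 1 \<Longrightarrow> x \<in> \<Omega> \<Longrightarrow> norm (g t x - g 0 x - of_real t * g' x) \<le> C * t\<^sup>2"
    using uderivE[OF assms(2)] by blast
  show ?thesis
  proof (rule uderivI)
    fix t :: real and x assume t: "\<bar>t\<bar> \<le> 1" and x: "x \<in> \<Omega>"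
    show "norm (f t x + g t x) \<le> B + C" by (intro norm_triangle_mono B C t x)
    have "f t x + g t x - (f 0 x + g 0 x) - of_real t * (f' x + g' x) =
      (f t x - f 0 x - of_real t * f' x) + (g t x - g 0 x - of_real t * g' x)"
      by (simp add: algebra_simps)
    also have "norm \<dots> \<le> B * t\<^sup>2 + C * t\<^sup>2" by (intro norm_triangle_mono B C t x)
    finally show "norm (f t x + g t x - (f 0 x + g 0 x) - of_real t * (f' x + g' x)) \<le> (B + C) * t\<^sup>2"
      by (simp add: distrib_right)
  next
    fix x assume x: "x \<in> \<Omega>"
    show "norm (f' x + g' x) \<le> B + C" by (intro norm_triangle_mono B C x)
  qed
qed

text \<open>The remainder of a product consists of each remainder times a bounded factor and of t f'
  (g_t - g_0). In the last term g_t - g_0 is O(|t|), because t^2 \<le> |t| on the interval, so the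
  whole is again quadratic.\<close>

lemma uderiv_mult:
  assumes "uderiv \<Omega> f f'" "uderiv \<Omega> g g'"
  shows "uderiv \<Omega> (\<lambda>t x. f t x * g t x) (\<lambda>x. f' x * g 0 x + f 0 x * g' x)"
proof -
  obtain B where B: "B \<ge> 0" "\<And>t x. \<bar>t\<bar> \<le> 1 \<Longrightarrow> x \<in> \<Omega> \<Longrightarrow> norm (f t x) \<le> B"
    "\<And>x. x \<in> \<Omega> \<Longrightarrow> norm (f' x) \<le> B"
    "\<And>t x. \<bar>t\<bar> \<le> 1 \<Longrightarrow> x \<in> \<Omega> \<Longrightarrow> norm (f t x - f 0 x - of_real t * f' x) \<le> B * t\<^sup>2"
    using uderivE[OF assms(1)] by blast
  obtain C where C: "C \<ge> 0" "\<And>t x. \<bar>t\<bar> \<le> 1 \<Longrightarrow> x \<in> \<Omega> \<Longrightarrow> norm (g t x) \<le> C"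
    "\<And>x. x \<in> \<Omega> \<Longrightarrow> norm (g' x) \<le> C"
    "\<And>t x. \<bar>t\<bar> \<le> 1 \<Longrightarrow> x \<in> \<Omega> \<Longrightarrow> norm (g t x - g 0 x - of_real t * g' x) \<le> C * t\<^sup>2"
    using uderivE[OF assms(2)] by blast
  show ?thesis
  proof (rule uderivI)
    fix t :: real and x assume t: "\<bar>t\<bar> \<le> 1" and x: "x \<in> \<Omega>"
    show "norm (f t x * g t x) \<le> B * C" unfolding norm_mult by (intro mult_mono B C t x norm_ge_zero)
    have t2: "t\<^sup>2 \<le> \<bar>t\<bar>" using t mult_left_le[of "\<bar>t\<bar>" "\<bar>t\<bar>"] by (simp add: power2_eq_square)
    have "norm (g t x - g 0 x) = norm ((g t x - g 0 x - of_real t * g' x) + of_real t * g' x)" by simp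
    also have "\<dots> \<le> C * t\<^sup>2 + \<bar>t\<bar> * C"
      by (intro norm_triangle_mono C t x) (auto simp: norm_mult intro!: mult_left_mono C x)
    also have "\<dots> \<le> 2 * C * \<bar>t\<bar>" using mult_left_mono[OF t2 C(1)] by simp
    finally have g: "norm (g t x - g 0 x) \<le> 2 * C * \<bar>t\<bar>" .
    have "f t x * g t x - f 0 x * g 0 x - of_real t * (f' x * g 0 x + f 0 x * g' x) =
      ((f t x - f 0 x - of_real t * f' x) * g t x + f 0 x * (g t x - g 0 x - of_real t * g' x)) +
        (of_real t * f' x) * (g t x - g 0 x)"
      by (simp add: algebra_simps)
    also have "norm \<dots> \<le> ((B * t\<^sup>2) * C + B * (C * t\<^sup>2)) + (\<bar>t\<bar> * B) * (2 * C * \<bar>t\<bar>)"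
    proof (intro norm_triangle_mono)
      show "norm ((f t x - f 0 x - of_real t * f' x) * g t x) \<le> (B * t\<^sup>2) * C"
        unfolding norm_mult by (intro mult_mono B C t x) (use B in auto)
      show "norm (f 0 x * (g t x - g 0 x - of_real t * g' x)) \<le> B * (C * t\<^sup>2)"
        unfolding norm_mult by (intro mult_mono B C t x) (use B in auto)
      show "norm ((of_real t * f' x) * (g t x - g 0 x)) \<le> (\<bar>t\<bar> * B) * (2 * C * \<bar>t\<bar>)"
        unfolding norm_mult norm_of_real by (intro mult_mono B C t x g order_refl) (use B in auto)
    qed
    also have "\<dots> = 4 * B * C * t\<^sup>2"
      by (simp add: power2_eq_square algebra_simps)
    finally show "norm (f t x * g t x - f 0 x * g 0 x - of_real t * (f' x * g 0 x + f 0 x * g' x))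
      \<le> 4 * B * C * t\<^sup>2" .
  next
    fix x assume x: "x \<in> \<Omega>"
    show "norm (f' x * g 0 x + f 0 x * g' x) \<le> B * C + B * C"
      by (intro norm_triangle_mono; unfold norm_mult; intro mult_mono B C x norm_ge_zero) auto
  qed
qed

lemma uderiv_sum:
  assumes "finite A" "\<And>a. a \<in> A \<Longrightarrow> uderiv \<Omega> (f a) (f' a)"
  shows "uderiv \<Omega> (\<lambda>t x. \<Sum>a\<in>A. f a t x) (\<lambda>x. \<Sum>a\<in>A. f' a x)"
  using assms
proof (induction rule: finite_induct)
  case empty
  then show ?case using uderiv_const[of \<Omega> "\<lambda>_. 0" 0] by simp
next
  case (insert a A)
  then show ?case by (simp add: uderiv_add)
qed

lemma uderiv_cmult:
  assumes "uderiv \<Omega> f f'"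
  shows "uderiv \<Omega> (\<lambda>t x. c * f t x) (\<lambda>x. c * f' x)"
  using uderiv_mult[OF uderiv_const[of \<Omega> "\<lambda>_. c" "norm c"] assms] by simp

text \<open>Since the integral of f_t is constant in t, t times the integral of f' is, up to sign,
  the integral of the remainder, hence at most B t^2 in norm. Divide by t and let t tend to 0 from
  the right.\<close>

lemma (in prob_space) uderiv_integral_eq_0:
  fixes f' :: "'a \<Rightarrow> 'b::{real_normed_field, banach, second_countable_topology}"
  assumes d: "uderiv (space M) f f'"
    and meas: "f' \<in> borel_measurable M" "\<And>t. \<bar>t\<bar> \<le> 1 \<Longrightarrow> f t \<in> borel_measurable M"
    and const: "\<And>t. \<bar>t\<bar> \<le> 1 \<Longrightarrow> (\<integral>x. f t x \<partial>M) = (\<integral>x. f 0 x \<partial>M)"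
  shows "(\<integral>x. f' x \<partial>M) = 0"
proof -
  obtain B where B: "B \<ge> 0" "\<And>t x. \<bar>t\<bar> \<le> 1 \<Longrightarrow> x \<in> space M \<Longrightarrow> norm (f t x) \<le> B"
    "\<And>x. x \<in> space M \<Longrightarrow> norm (f' x) \<le> B"
    "\<And>t x. \<bar>t\<bar> \<le> 1 \<Longrightarrow> x \<in> space M \<Longrightarrow> norm (f t x - f 0 x - of_real t * f' x) \<le> B * t\<^sup>2"
    using uderivE[OF d] by blast
  have int: "integrable M (f t)" if "\<bar>t\<bar> \<le> 1" for t
    using meas(2)[OF that] B(2)[OF that] by (intro integrable_const_bound[of _ B]) auto
  have int': "integrable M f'" using meas B(3) by (intro integrable_const_bound[of _ B]) auto
  let ?I = "\<integral>x. f' x \<partial>M"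
  have bound: "norm ?I \<le> B * t" if t: "0 < t" "t \<le> 1" for t
  proof -
    have t1: "\<bar>t\<bar> \<le> 1" using t by simp
    have "(\<integral>x. f t x - f 0 x - of_real t * f' x \<partial>M) = - of_real t * ?I"
      using int[OF t1] int[of 0] int' const[OF t1] by simp
    then have "t * norm ?I = norm (\<integral>x. f t x - f 0 x - of_real t * f' x \<partial>M)"
      using t by (simp add: norm_mult)
    also have "\<dots> \<le> (\<integral>x. norm (f t x - f 0 x - of_real t * f' x) \<partial>M)"
      by (rule integral_norm_bound)
    also have "\<dots> \<le> (\<integral>x. B * t\<^sup>2 \<partial>M)"
      using int[OF t1] int[of 0] int' B(4)[OF t1] by (intro integral_mono) auto
    also have "\<dots> = t * (B * t)" by (simp add: prob_space power2_eq_square)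
    finally show ?thesis using t by simp
  qed
  have "((\<lambda>t. B * t) \<longlongrightarrow> B * 0) (at_right 0)"
    by (intro tendsto_intros)
  moreover have "\<forall>\<^sub>F t in at_right (0::real). norm ?I \<le> B * t"
    using bound by (auto simp: eventually_at_right_field intro!: exI[of _ 1])
  ultimately have "norm ?I \<le> B * 0"
    by (intro tendsto_lowerbound[of "\<lambda>t. B * t"]) auto
  then show ?thesis by simp
qed

lemma mat_mult_index:
  assumes "A \<in> carrier_mat n m" "B \<in> carrier_mat m k" "i < n" "j < k"
  shows "(A * B) $$ (i, j) = (\<Sum>l<m. A $$ (i, l) * B $$ (l, j))"
  using assms by (simp add: scalar_prod_def atLeast0LessThan)

lemma mat_trace_mult:
  assumes "A \<in> carrier_mat n m" "B \<in> carrier_mat m n"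
  shows "mat_trace (A * B) = (\<Sum>i<n. \<Sum>j<m. A $$ (i, j) * B $$ (j, i))"
  using assms by (simp add: mat_trace_def scalar_prod_def atLeast0LessThan)

lemma mat_trace_comm:
  fixes A :: "'a::comm_semiring_0 mat"
  assumes "A \<in> carrier_mat n m" "B \<in> carrier_mat m n"
  shows "mat_trace (A * B) = mat_trace (B * A)"
  unfolding mat_trace_mult[OF assms] mat_trace_mult[OF assms(2,1)]
  by (subst sum.swap) (simp add: mult.commute)

section \<open>Haar measure\<close>

text \<open>For orthogonal J this is the adjoint of A with respect to the bilinear form x^T J y. It
  is transposition for J = 1.\<close>

definition sharp :: "'a::comm_ring_1 mat \<Rightarrow> 'a mat \<Rightarrow> 'a mat" where
  "sharp J A = J\<^sup>T * A\<^sup>T * J"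

text \<open>N is the size of the matrices: n for O, with J = 1 and \<sigma> = 1, and 2 n for Sp,
  with J the symplectic form and \<sigma> = -1. The bound on the entries makes all functions
  integrated below bounded, so that integrability reduces to measurability.\<close>

locale matrix_model = group G
  for G :: "'a::{real_normed_field, banach, second_countable_topology} mat monoid" +
  fixes N :: nat and J :: "'a mat" and \<sigma> :: 'a and \<mu> :: "'a mat measure"
  assumes carrier_subset: "carrier G \<subseteq> carrier_mat N N"
    and mult_G: "monoid.mult G = (*)"
    and one_G: "one G = 1\<^sub>m N"
    and sign: "\<sigma> = 1 \<or> \<sigma> = - 1"
    and J: "J \<in> carrier_mat N N" "J\<^sup>T * J = 1\<^sub>m N" "\<And>i j. i < N \<Longrightarrow> j < N \<Longrightarrow> J $$ (j, i) = \<sigma> * J $$ (i, j)"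
    and sharp_inverse: "A \<in> carrier G \<Longrightarrow> sharp J A * A = 1\<^sub>m N"
    and entry_bound: "A \<in> carrier G \<Longrightarrow> i < N \<Longrightarrow> j < N \<Longrightarrow> norm (A $$ (i, j)) \<le> 1"
    and haar: "haar_probability G \<mu>"
begin

lemma carrier_G_mat: "A \<in> carrier G \<Longrightarrow> A \<in> carrier_mat N N"
  using carrier_subset by blast

lemma sharp_carrier [simp]: "A \<in> carrier_mat N N \<Longrightarrow> sharp J A \<in> carrier_mat N N"
  using J(1) by (simp add: sharp_def)

lemmas mat_assoc = assoc_mult_mat[of _ N N _ N _ N]

lemma J_right: "J * J\<^sup>T = 1\<^sub>m N"
  using mat_mult_left_right_inverse[OF _ J(1,2)] J(1) by simp

lemma sharp_mult:
  assumes "A \<in> carrier_mat N N" "B \<in> carrier_mat N N"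
  shows "sharp J (A * B) = sharp J B * sharp J A"
proof -
  have "sharp J B * sharp J A = J\<^sup>T * B\<^sup>T * (J * J\<^sup>T) * A\<^sup>T * J"
    using assms J(1) by (simp add: sharp_def mat_assoc)
  then show ?thesis using assms J(1) by (simp add: J_right sharp_def transpose_mult[of _ N N] mat_assoc)
qed

lemma sharp_index:
  assumes "A \<in> carrier_mat N N" "i < N" "j < N"
  shows "sharp J A $$ (i, j) = (\<Sum>l<N. \<Sum>k<N. J $$ (k, i) * A $$ (l, k) * J $$ (l, j))"
proof -
  have "(J\<^sup>T * A\<^sup>T) $$ (i, l) = (\<Sum>k<N. J $$ (k, i) * A $$ (l, k))" if "l < N" for l
    using assms J(1) that by (subst mat_mult_index[of _ N N _ N]) auto
  moreover have "sharp J A $$ (i, j) = (\<Sum>l<N. (J\<^sup>T * A\<^sup>T) $$ (i, l) * J $$ (l, j))"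
    unfolding sharp_def using assms J(1) by (intro mat_mult_index[of _ N N _ N]) auto
  ultimately show ?thesis by (simp add: sum_distrib_right del: index_mult_mat(1))
qed

lemma inv_eq_sharp: "A \<in> carrier G \<Longrightarrow> inv\<^bsub>G\<^esub> A = sharp J A"
proof -
  assume A: "A \<in> carrier G"
  then have i: "inv\<^bsub>G\<^esub> A \<in> carrier_mat N N" using carrier_G_mat by simp
  have "A * inv\<^bsub>G\<^esub> A = 1\<^sub>m N" using r_inv[OF A] by (simp add: mult_G one_G)
  then have "sharp J A = sharp J A * A * inv\<^bsub>G\<^esub> A"
    using carrier_G_mat[OF A] i by (simp add: mat_assoc right_mult_one_mat[of _ N N])
  then show ?thesis using sharp_inverse[OF A] i left_mult_one_mat[OF i] by simp
qed

lemma mat_trace_sharp: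
  assumes "A \<in> carrier_mat N N"
  shows "mat_trace (sharp J A) = mat_trace A"
proof -
  have "mat_trace (sharp J A) = mat_trace (J * (J\<^sup>T * A\<^sup>T))"
    unfolding sharp_def using assms J(1) by (intro mat_trace_comm[of _ N N]) auto
  also have "J * (J\<^sup>T * A\<^sup>T) = A\<^sup>T"
    using assms J(1) J_right by (simp flip: mat_assoc)
  finally show ?thesis using assms by (simp add: mat_trace_def)
qed

text \<open>Inversion is \<open>sharp J\<close>, a transposition followed by conjugation with J.
  This is why the exponents enter the limits only through their absolute values.\<close>

lemma mat_trace_inv: "A \<in> carrier G \<Longrightarrow> mat_trace (inv\<^bsub>G\<^esub> A) = mat_trace A"
  using inv_eq_sharp mat_trace_sharp carrier_G_mat by simp

sublocale prob_space \<mu>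
  using haar by (simp add: haar_probability_def)

lemma space_haar [simp]: "space \<mu> = carrier G"
  using haar by (simp add: haar_probability_def)

lemma sets_haar: "sets \<mu> = sets (vimage_algebra (carrier G) mat_entries borel)"
  using haar by (simp add: haar_probability_def)

lemma entry_measurable [measurable]:
  assumes "a < N" "b < N"
  shows "(\<lambda>A. A $$ (a, b)) \<in> borel_measurable \<mu>"
proof -
  have "mat_entries \<in> \<mu> \<rightarrow>\<^sub>M borel"
    unfolding measurable_cong_sets[OF sets_haar refl] by (intro measurable_vimage_algebra1) auto
  moreover have "(\<lambda>f. f (a, b)) \<in> borel_measurable (borel :: (nat \<times> nat \<Rightarrow> 'a) measure)"
    by (intro borel_measurable_continuous_onI continuous_on_product_coordinates)
  ultimately have "(\<lambda>A. mat_entries A (a, b)) \<in> borel_measurable \<mu>"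
    by (rule measurable_compose)
  then show ?thesis
    by (rule subst[OF measurable_cong, rotated])
      (use carrier_G_mat assms in \<open>auto simp: mat_entries_def\<close>)
qed

lemma left_mult_measurable:
  assumes x: "x \<in> carrier G"
  shows "(\<lambda>A. x * A) \<in> \<mu> \<rightarrow>\<^sub>M \<mu>"
proof -
  have "(\<lambda>A. mat_entries (x * A)) \<in> \<mu> \<rightarrow>\<^sub>M borel"
  proof (rule measurable_coordinatewise_then_product)
    fix p :: "nat \<times> nat"
    obtain a b where p: "p = (a, b)" by (cases p)
    have "(\<lambda>A. mat_entries (x * A) p) \<in> borel_measurable \<mu> \<longleftrightarrow>
      (\<lambda>A. if a < N \<and> b < N then \<Sum>l<N. x $$ (a, l) * A $$ (l, b) else 0) \<in> borel_measurable \<mu>"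
      using carrier_G_mat x
      by (intro measurable_cong) (auto simp: p mat_entries_def mat_mult_index[of _ N N _ N] simp del: index_mult_mat(1))
    also have "\<dots>" by (cases "a < N \<and> b < N") auto
    finally show "(\<lambda>A. mat_entries (x * A) p) \<in> borel_measurable \<mu>" .
  qed
  moreover have "(\<lambda>A. x * A) \<in> space \<mu> \<rightarrow> carrier G"
    using x m_closed by (auto simp: mult_G)
  ultimately show ?thesis
    unfolding measurable_cong_sets[OF refl sets_haar] by (intro measurable_vimage_algebra2)
qed

text \<open>The preimage of X under left multiplication by x is the left coset of X by the inverse
  of x, which translates the invariance in \<open>haar_probability\<close> into invariance under a
  map.\<close>

lemma left_mult_distr:
  assumes x: "x \<in> carrier G"
  shows "distr \<mu> \<mu> (\<lambda>A. x * A) = \<mu>"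
proof (rule measure_eqI)
  fix X assume "X \<in> sets (distr \<mu> \<mu> (\<lambda>A. x * A))"
  then have X: "X \<in> sets \<mu>" by simp
  have XG: "X \<subseteq> carrier G" using sets.sets_into_space[OF X] by simp
  have "(\<lambda>A. x * A) -` X \<inter> space \<mu> = inv\<^bsub>G\<^esub> x <#\<^bsub>G\<^esub> X"
  proof (intro equalityI subsetI)
    fix A assume A: "A \<in> (\<lambda>A. x * A) -` X \<inter> space \<mu>"
    then have "A = inv\<^bsub>G\<^esub> x \<otimes>\<^bsub>G\<^esub> (x \<otimes>\<^bsub>G\<^esub> A)" using x by (simp add: inv_solve_left)
    with A show "A \<in> inv\<^bsub>G\<^esub> x <#\<^bsub>G\<^esub> X" by (auto simp: l_coset_def mult_G)
  next
    fix A assume "A \<in> inv\<^bsub>G\<^esub> x <#\<^bsub>G\<^esub> X"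
    then obtain B where B: "B \<in> X" "A = inv\<^bsub>G\<^esub> x \<otimes>\<^bsub>G\<^esub> B" by (auto simp: l_coset_def)
    then have "x \<otimes>\<^bsub>G\<^esub> A = B" "A \<in> carrier G" using x XG by (auto simp: m_assoc[symmetric])
    with B show "A \<in> (\<lambda>A. x * A) -` X \<inter> space \<mu>" by (simp add: mult_G)
  qed
  then show "emeasure (distr \<mu> \<mu> (\<lambda>A. x * A)) X = emeasure \<mu> X"
    using X x haar emeasure_distr[OF left_mult_measurable[OF x] X]
    by (simp add: haar_probability_def)
qed simp

definition prod_haar :: "nat \<Rightarrow> (nat \<Rightarrow> 'a mat) measure" where
  "prod_haar r = Pi\<^sub>M {1..r} (\<lambda>_. \<mu>)"

lemma prob_space_prod_haar: "prob_space (prod_haar r)"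
  unfolding prod_haar_def by (intro prob_space_PiM prob_space_axioms)

lemma space_prod_haar: "space (prod_haar r) = {1..r} \<rightarrow>\<^sub>E carrier G"
  by (simp add: prod_haar_def space_PiM)

lemma prod_haarD: "g \<in> space (prod_haar r) \<Longrightarrow> i \<in> {1..r} \<Longrightarrow> g i \<in> carrier G"
  by (auto simp: space_prod_haar)

definition shift :: "nat \<Rightarrow> 'a mat \<Rightarrow> (nat \<Rightarrow> 'a mat) \<Rightarrow> nat \<Rightarrow> 'a mat" where
  "shift i x g = g(i := x * g i)"

lemma shift_space: "g \<in> space (prod_haar r) \<Longrightarrow> i \<in> {1..r} \<Longrightarrow> x \<in> carrier G \<Longrightarrow>
    shift i x g \<in> space (prod_haar r)"
  using m_closed by (auto simp: space_prod_haar shift_def PiE_iff extensional_def mult_G)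

lemma shift_measurable:
  assumes i: "i \<in> {1..r}" and x: "x \<in> carrier G"
  shows "shift i x \<in> prod_haar r \<rightarrow>\<^sub>M prod_haar r"
proof -
  have "(\<lambda>g. \<lambda>k\<in>{1..r}. if k = i then x * g k else g k) \<in> prod_haar r \<rightarrow>\<^sub>M prod_haar r"
    unfolding prod_haar_def
  proof (rule measurable_restrict)
    fix k assume k: "k \<in> {1..r}"
    show "(\<lambda>g. if k = i then x * g k else g k) \<in> Pi\<^sub>M {1..r} (\<lambda>_. \<mu>) \<rightarrow>\<^sub>M \<mu>"
      using measurable_compose[OF measurable_component_singleton[OF k] left_mult_measurable[OF x]]
        measurable_component_singleton[OF k] by (cases "k = i") auto
  qed
  moreover have "(\<lambda>k\<in>{1..r}. if k = i then x * g k else g k) = shift i x g"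
    if "g \<in> space (prod_haar r)" for g
    using that i by (auto simp: space_prod_haar shift_def fun_eq_iff PiE_iff extensional_def)
  ultimately show ?thesis by (subst (asm) measurable_cong) auto
qed

text \<open>A product measure is determined by its values on boxes, and the preimage of a box is a
  box in which only side i has been translated.\<close>

lemma shift_distr:
  assumes i: "i \<in> {1..r}" and x: "x \<in> carrier G"
  shows "distr (prod_haar r) (prod_haar r) (shift i x) = prod_haar r"
proof -
  interpret P: product_sigma_finite "\<lambda>_. \<mu>"
    by (rule product_sigma_finite.intro) unfold_locales
  have "distr (prod_haar r) (prod_haar r) (shift i x) = Pi\<^sub>M {1..r} (\<lambda>_. \<mu>)"
  proof (rule P.PiM_eqI)
    fix A :: "nat \<Rightarrow> 'a mat set" assume A: "\<And>k. k \<in> {1..r} \<Longrightarrow> A k \<in> sets \<mu>"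
    define A' where "A' k = (if k = i then (\<lambda>a. x * a) -` A k \<inter> space \<mu> else A k)" for k
    have A': "A' k \<in> sets \<mu>" if "k \<in> {1..r}" for k
      using A[OF that] measurable_sets[OF left_mult_measurable[OF x], of "A k"] by (auto simp: A'_def)
    have "shift i x -` Pi\<^sub>E {1..r} A \<inter> space (prod_haar r) = Pi\<^sub>E {1..r} A'"
    proof (intro equalityI subsetI)
      fix g assume g: "g \<in> shift i x -` Pi\<^sub>E {1..r} A \<inter> space (prod_haar r)"
      have "g k \<in> A' k" if "k \<in> {1..r}" for k
        using g that PiE_mem[of "shift i x g" "{1..r}" A k] prod_haarD[of g r k]
        by (auto simp: shift_def A'_def split: if_splits)
      then show "g \<in> Pi\<^sub>E {1..r} A'" using g by (auto simp: space_prod_haar PiE_iff)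
    next
      fix g assume g: "g \<in> Pi\<^sub>E {1..r} A'"
      have "g k \<in> carrier G" if "k \<in> {1..r}" for k
        using PiE_mem[OF g that] sets.sets_into_space[OF A'[OF that]] by auto
      moreover have "shift i x g k \<in> A k" if "k \<in> {1..r}" for k
        using PiE_mem[OF g that] by (auto simp: shift_def A'_def split: if_splits)
      moreover have "shift i x g \<in> extensional {1..r}"
        using g i by (auto simp: shift_def PiE_iff extensional_def)
      ultimately show "g \<in> shift i x -` Pi\<^sub>E {1..r} A \<inter> space (prod_haar r)"
        using g by (auto simp: space_prod_haar PiE_iff)
    qed
    then have "emeasure (distr (prod_haar r) (prod_haar r) (shift i x)) (Pi\<^sub>E {1..r} A) =
        emeasure (prod_haar r) (Pi\<^sub>E {1..r} A')"
      using A by (subst emeasure_distr[OF shift_measurable[OF i x]]) (auto simp: prod_haar_def)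
    also have "\<dots> = (\<Prod>k\<in>{1..r}. emeasure \<mu> (A' k))"
      unfolding prod_haar_def using A' by (intro P.emeasure_PiM) auto
    also have "\<dots> = (\<Prod>k\<in>{1..r}. emeasure \<mu> (A k))"
    proof (rule prod.cong)
      fix k assume k: "k \<in> {1..r}"
      show "emeasure \<mu> (A' k) = emeasure \<mu> (A k)"
        using emeasure_distr[OF left_mult_measurable[OF x] A[OF k]] left_mult_distr[OF x]
        by (simp add: A'_def)
    qed simp
    finally show "emeasure (distr (prod_haar r) (prod_haar r) (shift i x)) (Pi\<^sub>E {1..r} A) =
        (\<Prod>k\<in>{1..r}. emeasure \<mu> (A k))" .
  qed (simp_all add: prod_haar_def)
  then show ?thesis by (simp add: prod_haar_def)
qed

lemma integral_shift:
  fixes f :: "(nat \<Rightarrow> 'a mat) \<Rightarrow> 'a"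
  assumes "i \<in> {1..r}" "x \<in> carrier G" "f \<in> borel_measurable (prod_haar r)"
  shows "(\<integral>g. f (shift i x g) \<partial>prod_haar r) = (\<integral>g. f g \<partial>prod_haar r)"
  using integral_distr[OF shift_measurable[OF assms(1,2)] assms(3)]
  by (simp add: shift_distr[OF assms(1,2)])

section \<open>Words evaluated in the group\<close>

abbreviation wv :: "(nat \<Rightarrow> 'a mat) \<Rightarrow> fg_word \<Rightarrow> 'a mat" where
  "wv \<equiv> word_subst G"

text \<open>Writing the inverse as \<open>sharp J\<close> makes its entries linear in the entries of
  the generator, so measurability and derivatives of words reduce to sums and products.\<close>

definition letter_val :: "(nat \<Rightarrow> 'a mat) \<Rightarrow> nat \<times> bool \<Rightarrow> 'a mat" where
  "letter_val g a = (if snd a then g (fst a) else sharp J (g (fst a)))"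

lemma wv_Nil [simp]: "wv g [] = 1\<^sub>m N"
  by (simp add: word_subst_def one_G)

context
  fixes r :: nat and g :: "nat \<Rightarrow> 'a mat"
  assumes g: "g \<in> space (prod_haar r)"
begin

lemma letter_val_closed: "fst a \<in> {1..r} \<Longrightarrow> letter_val g a \<in> carrier G"
  using prod_haarD[OF g, of "fst a"] inv_closed[of "g (fst a)"] inv_eq_sharp
  by (auto simp: letter_val_def)

lemma wv_Cons: "fst a \<in> {1..r} \<Longrightarrow> wv g (a # w) = letter_val g a * wv g w"
  using prod_haarD[OF g, of "fst a"] inv_eq_sharp
  by (auto simp: letter_val_def word_subst_def mult_G split: prod.splits)

lemma wv_closed: "word_in r w \<Longrightarrow> wv g w \<in> carrier G"
proof (induction w)
  case Nil
  then show ?case using one_closed by (simp add: one_G)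
next
  case (Cons a w)
  then show ?case using m_closed[OF letter_val_closed, of a "wv g w"] wv_Cons[of a w]
    by (simp add: mult_G)
qed

lemmas wv_mat [simp] = carrier_G_mat[OF wv_closed]

lemma wv_append: "word_in r u \<Longrightarrow> word_in r v \<Longrightarrow> wv g (u @ v) = wv g u * wv g v"
proof (induction u)
  case (Cons a u)
  then show ?case
    using carrier_G_mat[OF letter_val_closed[of a]] by (simp add: wv_Cons mat_assoc)
qed (simp add: left_mult_one_mat[of _ N N])

lemma letter_val_inv: "fst a \<in> {1..r} \<Longrightarrow> letter_val g (inv_letter a) = inv\<^bsub>G\<^esub> (letter_val g a)"
  using prod_haarD[OF g, of "fst a"] inv_eq_sharp inv_inv
  by (auto simp: letter_val_def inv_letter_def)

lemma wv_inv: "word_in r w \<Longrightarrow> wv g (inv_word w) = inv\<^bsub>G\<^esub> (wv g w)"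
proof (induction w)
  case Nil
  then show ?case using inv_one by (simp add: one_G)
next
  case (Cons a w)
  then have a: "fst a \<in> {1..r}" and w: "word_in r w" by auto
  have "wv g (inv_word (a # w)) = wv g (inv_word w) * wv g [inv_letter a]"
    using a w by (simp add: wv_append)
  also have "wv g [inv_letter a] = inv\<^bsub>G\<^esub> (letter_val g a)"
    using wv_Cons[of "inv_letter a" "[]"] a letter_val_inv[OF a] letter_val_closed[OF a] carrier_G_mat[of "inv\<^bsub>G\<^esub> (letter_val g a)"]
    by simp
  also have "wv g (inv_word w) * inv\<^bsub>G\<^esub> (letter_val g a) = inv\<^bsub>G\<^esub> (letter_val g a \<otimes>\<^bsub>G\<^esub> wv g w)"
    using Cons.IH[OF w] inv_mult_group[OF letter_val_closed[OF a] wv_closed[OF w]] by (simp add: mult_G)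
  finally show ?case using wv_Cons[OF a] by (simp add: mult_G)
qed

lemma wv_cons_reduce:
  assumes "fst a \<in> {1..r}" "word_in r w"
  shows "wv g (cons_reduce a w) = letter_val g a * wv g w"
proof (cases "\<exists>w'. w = inv_letter a # w'")
  case True
  then obtain w' where w: "w = inv_letter a # w'" by blast
  with assms have w': "word_in r w'" by simp
  have "letter_val g a \<otimes>\<^bsub>G\<^esub> (inv\<^bsub>G\<^esub> (letter_val g a) \<otimes>\<^bsub>G\<^esub> wv g w') = wv g w'"
    using letter_val_closed[OF assms(1)] wv_closed[OF w'] by (simp flip: m_assoc)
  then show ?thesis using wv_Cons[of "inv_letter a" w'] letter_val_inv[OF assms(1)] assms
    by (simp add: w mult_G)
next
  case False
  then have "cons_reduce a w = a # w" by (cases w) auto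
  then show ?thesis using wv_Cons assms by simp
qed

lemma wv_red: "word_in r w \<Longrightarrow> wv g (red w) = wv g w"
proof (induction w)
  case (Cons a w)
  then show ?case using wv_cons_reduce[of a "red w"] word_in_red[of r w]
    by (simp add: red_def wv_Cons)
qed simp

end

end

lemma sum_letter_positions_Cons:
  "(\<Sum>k\<in>letter_positions i (c # w). f k) =
     (if fst c = i then f 0 else 0) + (\<Sum>k\<in>letter_positions i w. f (Suc k))"
proof -
  have eq: "letter_positions i (c # w) = (if fst c = i then {0} else {}) \<union> Suc ` letter_positions i w"
    (is "?L = ?A \<union> ?B")
  proof (rule Set.set_eqI)
    fix k show "k \<in> ?L \<longleftrightarrow> k \<in> ?A \<union> ?B"
      by (cases k) (auto simp: letter_positions_def)
  qed
  have "sum f ?L = sum f ?A + sum f ?B"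
    unfolding eq by (intro sum.union_disjoint) auto
  also have "sum f ?B = (\<Sum>k\<in>letter_positions i w. f (Suc k))"
    by (subst sum.reindex) auto
  finally show ?thesis by simp
qed

lemma cut_Cons [simp]: "cut_pos (c # w) (Suc k) = Suc (cut_pos w k)"
  and letter_sign_Cons [simp]: "letter_sign (c # w) (Suc k) = letter_sign w k"
  by (simp_all add: cut_pos_def letter_sign_def)

lemma remove_nth_Cons [simp]: "remove_nth 0 (w # ws) = ws"
  "remove_nth (Suc j) (w # ws) = w # remove_nth j ws"
  by (simp_all add: remove_nth_def)

lemma mat_triple_index:
  fixes A :: "'a::comm_semiring_0 mat"
  assumes "A \<in> carrier_mat n n" "B \<in> carrier_mat n n" "C \<in> carrier_mat n n" "a < n" "b < n"
  shows "(A * B * C) $$ (a, b) = (\<Sum>p<n. \<Sum>q<n. B $$ (p, q) * (A $$ (a, p) * C $$ (q, b)))"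
proof -
  have "(A * B * C) $$ (a, b) = (\<Sum>q<n. (A * B) $$ (a, q) * C $$ (q, b))"
    using assms by (intro mat_mult_index[of _ n n _ n]) auto
  also have "\<dots> = (\<Sum>q<n. (\<Sum>p<n. A $$ (a, p) * B $$ (p, q)) * C $$ (q, b))"
    using assms by (intro sum.cong refl) (simp add: mat_mult_index[of A n n B n] del: index_mult_mat(1))
  also have "\<dots> = (\<Sum>q<n. \<Sum>p<n. B $$ (p, q) * (A $$ (a, p) * C $$ (q, b)))"
    by (simp only: sum_distrib_right) (simp only: ac_simps)
  also have "\<dots> = (\<Sum>p<n. \<Sum>q<n. B $$ (p, q) * (A $$ (a, p) * C $$ (q, b)))"
    by (rule sum.swap)
  finally show ?thesis .
qed

section \<open>Derivatives of words and traces along a curve\<close>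

context matrix_model
begin

definition bounded_rv :: "nat \<Rightarrow> ((nat \<Rightarrow> 'a mat) \<Rightarrow> 'a) \<Rightarrow> bool" where
  "bounded_rv r f \<longleftrightarrow> f \<in> borel_measurable (prod_haar r) \<and>
     (\<exists>B. \<forall>g\<in>space (prod_haar r). norm (f g) \<le> B)"

lemma bounded_rv_const: "bounded_rv r (\<lambda>_. c)"
  by (auto simp: bounded_rv_def)

lemma bounded_rv_add: "bounded_rv r f \<Longrightarrow> bounded_rv r h \<Longrightarrow> bounded_rv r (\<lambda>g. f g + h g)"
  unfolding bounded_rv_def by (blast intro: borel_measurable_add norm_triangle_mono)

lemma bounded_rv_mult:
  assumes "bounded_rv r f" "bounded_rv r h"
  shows "bounded_rv r (\<lambda>g. f g * h g)"
proof -
  obtain B C where B: "\<And>g. g \<in> space (prod_haar r) \<Longrightarrow> norm (f g) \<le> B"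
    and C: "\<And>g. g \<in> space (prod_haar r) \<Longrightarrow> norm (h g) \<le> C"
    using assms unfolding bounded_rv_def by blast
  have "norm (f g * h g) \<le> \<bar>B\<bar> * \<bar>C\<bar>" if "g \<in> space (prod_haar r)" for g
    unfolding norm_mult using B[OF that] C[OF that] by (intro mult_mono) auto
  then show ?thesis using assms unfolding bounded_rv_def by auto
qed

lemma bounded_rv_sum: "(\<And>a. a \<in> A \<Longrightarrow> bounded_rv r (f a)) \<Longrightarrow> bounded_rv r (\<lambda>g. \<Sum>a\<in>A. f a g)"
proof (induction A rule: infinite_finite_induct)
  case (insert a A)
  then show ?case by (simp add: bounded_rv_add)
qed (simp_all add: bounded_rv_const)

lemma bounded_rv_cong:
  "(\<And>g. g \<in> space (prod_haar r) \<Longrightarrow> f g = h g) \<Longrightarrow> bounded_rv r f \<longleftrightarrow> bounded_rv r h"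
  unfolding bounded_rv_def by (intro conj_cong measurable_cong ex_cong1 ball_cong) auto

lemma integrable_bounded_rv: "bounded_rv r f \<Longrightarrow> integrable (prod_haar r) f"
proof -
  interpret P: prob_space "prod_haar r" by (rule prob_space_prod_haar)
  assume "bounded_rv r f"
  then show ?thesis unfolding bounded_rv_def
    by (auto intro: P.integrable_const_bound)
qed

lemma bounded_rv_generator:
  assumes "l \<in> {1..r}" "a < N" "b < N"
  shows "bounded_rv r (\<lambda>g. g l $$ (a, b))"
proof -
  have "(\<lambda>g. g l $$ (a, b)) \<in> borel_measurable (prod_haar r)"
    unfolding prod_haar_def
    by (rule measurable_compose[OF measurable_component_singleton[OF assms(1)] entry_measurable[OF assms(2,3)]])
  moreover have "norm (g l $$ (a, b)) \<le> 1" if "g \<in> space (prod_haar r)" for g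
    using entry_bound[OF prod_haarD[OF that assms(1)] assms(2,3)] .
  ultimately show ?thesis unfolding bounded_rv_def by blast
qed

lemma bounded_rv_letter:
  assumes "fst c \<in> {1..r}" "a < N" "b < N"
  shows "bounded_rv r (\<lambda>g. letter_val g c $$ (a, b))"
proof (cases "snd c")
  case True
  then show ?thesis using bounded_rv_generator[OF assms] by (simp add: letter_val_def)
next
  case False
  have "bounded_rv r (\<lambda>g. letter_val g c $$ (a, b)) \<longleftrightarrow>
      bounded_rv r (\<lambda>g. \<Sum>l<N. \<Sum>k<N. J $$ (k, a) * g (fst c) $$ (l, k) * J $$ (l, b))"
    using False assms carrier_G_mat[OF prod_haarD[OF _ assms(1)]]
    by (intro bounded_rv_cong) (simp add: letter_val_def sharp_index)
  also have "\<dots>" using assms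
    by (intro bounded_rv_sum bounded_rv_mult bounded_rv_const bounded_rv_generator) auto
  finally show ?thesis .
qed

lemma bounded_rv_word:
  assumes "word_in r w" "a < N" "b < N"
  shows "bounded_rv r (\<lambda>g. wv g w $$ (a, b))"
  using assms
proof (induction w arbitrary: a)
  case Nil
  then show ?case by (simp add: bounded_rv_const)
next
  case (Cons c w)
  have "bounded_rv r (\<lambda>g. wv g (c # w) $$ (a, b)) \<longleftrightarrow>
      bounded_rv r (\<lambda>g. \<Sum>l<N. letter_val g c $$ (a, l) * wv g w $$ (l, b))"
    using Cons.prems carrier_G_mat[OF letter_val_closed]
    by (intro bounded_rv_cong) (simp add: wv_Cons mat_mult_index[of _ N N _ N] del: index_mult_mat(1))
  also have "\<dots>" using Cons
    by (intro bounded_rv_sum bounded_rv_mult bounded_rv_letter) auto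
  finally show ?case .
qed

definition trace_prod :: "fg_word list \<Rightarrow> (nat \<Rightarrow> 'a mat) \<Rightarrow> 'a" where
  "trace_prod ws g = (\<Prod>w\<leftarrow>ws. mat_trace (wv g w))"

lemma trace_prod_simps [simp]: "trace_prod [] g = 1"
  "trace_prod (w # ws) g = mat_trace (wv g w) * trace_prod ws g"
  by (simp_all add: trace_prod_def)

lemma mat_trace_word:
  "g \<in> space (prod_haar r) \<Longrightarrow> word_in r w \<Longrightarrow> mat_trace (wv g w) = (\<Sum>a<N. wv g w $$ (a, a))"
  using wv_mat[of g r w] unfolding mat_trace_def by (metis carrier_matD(1))

lemma bounded_rv_trace: "word_in r w \<Longrightarrow> bounded_rv r (\<lambda>g. mat_trace (wv g w))"
  by (subst bounded_rv_cong[OF mat_trace_word]) (auto intro!: bounded_rv_sum bounded_rv_word)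

lemma bounded_rv_trace_prod: "list_all (word_in r) ws \<Longrightarrow> bounded_rv r (trace_prod ws)"
proof (induction ws)
  case Nil
  then show ?case using bounded_rv_const[of r 1] by (simp add: trace_prod_def[abs_def])
next
  case (Cons w ws)
  then have "bounded_rv r (\<lambda>g. mat_trace (wv g w) * trace_prod ws g)"
    by (intro bounded_rv_mult bounded_rv_trace) auto
  then show ?case by (subst bounded_rv_cong) auto
qed

text \<open>R is a curve in the group through the identity with velocity X. The constant of the
  quadratic remainder may depend on the entry but not on t, as \<open>uderiv\<close> requires. The
  condition \<open>sharp J X = - X\<close> is tangency.\<close>

definition path_along :: "'a mat \<Rightarrow> (real \<Rightarrow> 'a mat) \<Rightarrow> bool" where
  "path_along X R \<longleftrightarrow> X \<in> carrier_mat N N \<and> sharp J X = - X \<and> R 0 = 1\<^sub>m N \<and>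
     (\<forall>t. \<bar>t\<bar> \<le> 1 \<longrightarrow> R t \<in> carrier G) \<and>
     (\<forall>i<N. \<forall>j<N. \<exists>B. \<forall>t. \<bar>t\<bar> \<le> 1 \<longrightarrow>
        norm (R t $$ (i, j) - 1\<^sub>m N $$ (i, j) - of_real t * X $$ (i, j)) \<le> B * t\<^sup>2)"

context
  fixes r i :: nat and X :: "'a mat" and R :: "real \<Rightarrow> 'a mat"
  assumes i: "i \<in> {1..r}" and R: "path_along X R"
begin

abbreviation move :: "real \<Rightarrow> (nat \<Rightarrow> 'a mat) \<Rightarrow> nat \<Rightarrow> 'a mat" where
  "move t \<equiv> shift i (R t)"

lemma velocity_carrier: "X \<in> carrier_mat N N" and velocity_skew: "sharp J X = - X"
  and path_0: "R 0 = 1\<^sub>m N" and path_closed: "\<bar>t\<bar> \<le> 1 \<Longrightarrow> R t \<in> carrier G"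
  using R by (auto simp: path_along_def)

lemma move_space: "\<bar>t\<bar> \<le> 1 \<Longrightarrow> g \<in> space (prod_haar r) \<Longrightarrow> move t g \<in> space (prod_haar r)"
  using shift_space[OF _ i path_closed] by blast

lemma move_0: "g \<in> space (prod_haar r) \<Longrightarrow> move 0 g = g"
  using left_mult_one_mat[OF carrier_G_mat[OF prod_haarD[OF _ i]]] by (simp add: shift_def path_0)

lemma uderiv_path:
  assumes "a < N" "b < N"
  shows "uderiv (space (prod_haar r)) (\<lambda>t g. R t $$ (a, b)) (\<lambda>_. X $$ (a, b))"
proof -
  obtain B where B: "\<And>t. \<bar>t\<bar> \<le> 1 \<Longrightarrow>
      norm (R t $$ (a, b) - 1\<^sub>m N $$ (a, b) - of_real t * X $$ (a, b)) \<le> B * t\<^sup>2"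
    using R assms unfolding path_along_def by blast
  show ?thesis
    by (rule uderivI[of _ _ 1 _ "norm (X $$ (a, b))" B])
      (use B path_0 path_closed entry_bound assms in auto)
qed

lemma uderiv_generator:
  assumes l: "l \<in> {1..r}" and ab: "a < N" "b < N"
  shows "uderiv (space (prod_haar r)) (\<lambda>t g. move t g l $$ (a, b))
    (\<lambda>g. if l = i then (X * g i) $$ (a, b) else 0)"
proof (cases "l = i")
  case False
  then show ?thesis
    using uderiv_const[of "space (prod_haar r)" "\<lambda>g. g l $$ (a, b)" 1]
      entry_bound[OF prod_haarD[OF _ l] ab] by (simp add: shift_def)
next
  case True
  have "uderiv (space (prod_haar r)) (\<lambda>t g. \<Sum>c<N. R t $$ (a, c) * g i $$ (c, b))
     (\<lambda>g. \<Sum>c<N. X $$ (a, c) * g i $$ (c, b) + R 0 $$ (a, c) * 0)"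
    using entry_bound[OF prod_haarD[OF _ i]] ab
    by (intro uderiv_sum uderiv_mult uderiv_path uderiv_const[of _ _ 1]) auto
  then show ?thesis
    using True ab carrier_G_mat[OF prod_haarD[OF _ i]] carrier_G_mat[OF path_closed] velocity_carrier
    by (subst uderiv_cong) (auto simp: shift_def mat_mult_index[of _ N N _ N] simp del: index_mult_mat(1))
qed

text \<open>For an inverse letter, sharp(X g) = sharp(g) sharp(X) = - sharp(g) X: the velocity moves
  behind the letter and changes sign, in agreement with \<open>cut_pos\<close> and
  \<open>letter_sign\<close>.\<close>

lemma uderiv_letter:
  assumes c: "fst c \<in> {1..r}" and ab: "a < N" "b < N"
  shows "uderiv (space (prod_haar r)) (\<lambda>t g. letter_val (move t g) c $$ (a, b))
    (\<lambda>g. if fst c = i then if snd c then (X * letter_val g c) $$ (a, b)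
        else - (letter_val g c * X) $$ (a, b) else 0)"
proof (cases "snd c")
  case True
  then show ?thesis using uderiv_generator[OF c ab]
    by (subst uderiv_cong) (auto simp: letter_val_def)
next
  case False
  have "uderiv (space (prod_haar r))
      (\<lambda>t g. \<Sum>l<N. \<Sum>k<N. (J $$ (k, a) * J $$ (l, b)) * move t g (fst c) $$ (l, k))
      (\<lambda>g. \<Sum>l<N. \<Sum>k<N. (J $$ (k, a) * J $$ (l, b)) * (if fst c = i then (X * g i) $$ (l, k) else 0))"
    by (intro uderiv_sum uderiv_cmult uderiv_generator c) auto
  then show ?thesis
  proof (rule uderiv_eqI)
    fix t :: real and g assume "\<bar>t\<bar> \<le> 1" and g: "g \<in> space (prod_haar r)"
    then have "move t g (fst c) \<in> carrier_mat N N"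
      using carrier_G_mat[OF prod_haarD[OF move_space c]] by blast
    then show "(\<Sum>l<N. \<Sum>k<N. (J $$ (k, a) * J $$ (l, b)) * move t g (fst c) $$ (l, k)) =
        letter_val (move t g) c $$ (a, b)"
      using False ab by (simp add: letter_val_def sharp_index ac_simps)
  next
    fix g assume g: "g \<in> space (prod_haar r)"
    have gi: "g i \<in> carrier_mat N N" using carrier_G_mat[OF prod_haarD[OF g i]] .
    show "(\<Sum>l<N. \<Sum>k<N. (J $$ (k, a) * J $$ (l, b)) * (if fst c = i then (X * g i) $$ (l, k) else 0)) =
      (if fst c = i then if snd c then (X * letter_val g c) $$ (a, b)
        else - (letter_val g c * X) $$ (a, b) else 0)"
    proof (cases "fst c = i")
      case True
      have "(\<Sum>l<N. \<Sum>k<N. (J $$ (k, a) * J $$ (l, b)) * (X * g i) $$ (l, k)) = sharp J (X * g i) $$ (a, b)"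
        using ab gi velocity_carrier by (subst sharp_index) (auto simp: ac_simps simp del: index_mult_mat(1))
      also have "sharp J (X * g i) = - (sharp J (g i) * X)"
        using gi velocity_carrier sharp_carrier[OF gi]
        by (simp add: sharp_mult velocity_skew uminus_mult_right_mat carrier_matD[of "sharp J (g i)" N N])
      also have "(- (sharp J (g i) * X)) $$ (a, b) = - (sharp J (g i) * X) $$ (a, b)"
        using gi velocity_carrier ab carrier_matD(1)[OF sharp_carrier[OF gi]] by (intro index_uminus_mat) auto
      finally show ?thesis using True False by (simp add: letter_val_def)
    qed simp
  qed
qed

text \<open>Leibniz rule by induction on the word: the head letter yields the occurrence 0, and the
  tail yields the later occurrences shifted by one, as in
  \<open>sum_letter_positions_Cons\<close>.\<close>

lemma uderiv_word:
  assumes "word_in r w" "a < N" "b < N"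
  shows "uderiv (space (prod_haar r)) (\<lambda>t g. wv (move t g) w $$ (a, b))
    (\<lambda>g. \<Sum>k\<in>letter_positions i w. letter_sign w k *
       (wv g (take (cut_pos w k) w) * X * wv g (drop (cut_pos w k) w)) $$ (a, b))"
  using assms
proof (induction w arbitrary: a)
  case Nil
  have "uderiv (space (prod_haar r)) (\<lambda>t g. 1\<^sub>m N $$ (a, b)) (\<lambda>_. 0 :: 'a)"
    by (rule uderiv_const[of _ _ "norm (1\<^sub>m N $$ (a, b) :: 'a)"]) simp
  then show ?case by (simp add: letter_positions_def del: index_one_mat(1))
next
  case (Cons c w)
  then have c: "fst c \<in> {1..r}" and w: "word_in r w" and ab: "a < N" "b < N" by auto
  let ?\<Omega> = "space (prod_haar r)"
  let ?d = "\<lambda>g a b. \<Sum>k\<in>letter_positions i w. letter_sign w k *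
       (wv g (take (cut_pos w k) w) * X * wv g (drop (cut_pos w k) w)) $$ (a, b)"
  let ?l = "\<lambda>g a b. if fst c = i then if snd c then (X * letter_val g c) $$ (a, b)
        else - (letter_val g c * X) $$ (a, b) else 0"
  have "uderiv ?\<Omega> (\<lambda>t g. \<Sum>l<N. letter_val (move t g) c $$ (a, l) * wv (move t g) w $$ (l, b))
     (\<lambda>g. \<Sum>l<N. ?l g a l * wv (move 0 g) w $$ (l, b) + letter_val (move 0 g) c $$ (a, l) * ?d g l b)"
    using c w ab by (intro uderiv_sum uderiv_mult uderiv_letter Cons.IH) auto
  then show ?case
  proof (rule uderiv_eqI)
    fix t :: real and g assume "\<bar>t\<bar> \<le> 1" and g: "g \<in> ?\<Omega>"
    then have m: "move t g \<in> ?\<Omega>" using move_space by blast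
    show "(\<Sum>l<N. letter_val (move t g) c $$ (a, l) * wv (move t g) w $$ (l, b)) =
        wv (move t g) (c # w) $$ (a, b)"
      using carrier_G_mat[OF letter_val_closed[OF m c]] wv_mat[OF m w] ab
      by (simp add: wv_Cons[OF m c] mat_mult_index[of _ N N _ N] del: index_mult_mat(1))
  next
    fix g assume g: "g \<in> ?\<Omega>"
    note L = carrier_G_mat[OF letter_val_closed[OF g c]] and W = wv_mat[OF g w]
    have tw: "wv g (take n w) \<in> carrier_mat N N" "wv g (drop n w) \<in> carrier_mat N N" for n
      using w wv_mat[OF g] by (auto simp: word_in_take word_in_drop)
    have 1: "(\<Sum>l<N. ?l g a l * wv g w $$ (l, b)) =
      (if fst c = i then letter_sign (c # w) 0 * (wv g (take (cut_pos (c # w) 0) (c # w)) * X *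
         wv g (drop (cut_pos (c # w) 0) (c # w))) $$ (a, b) else 0)"
    proof (cases "fst c = i")
      case True
      have c1: "wv g [c] = letter_val g c" using wv_Cons[OF g c, of "[]"] L by simp
      have m1: "(X * letter_val g c * wv g w) $$ (a, b) =
          (\<Sum>l<N. (X * letter_val g c) $$ (a, l) * wv g w $$ (l, b))"
        using L W velocity_carrier ab by (intro mat_mult_index[of _ N N _ N]) auto
      have m2: "(letter_val g c * X * wv g w) $$ (a, b) =
          (\<Sum>l<N. (letter_val g c * X) $$ (a, l) * wv g w $$ (l, b))"
        using L W velocity_carrier ab by (intro mat_mult_index[of _ N N _ N]) auto
      have m3: "1\<^sub>m N * X * wv g (c # w) = X * letter_val g c * wv g w"
        using L W velocity_carrier by (simp add: wv_Cons[OF g c] mat_assoc left_mult_one_mat[of _ N N])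
      show ?thesis
        by (cases "snd c") (simp_all add: True cut_pos_def letter_sign_def m1 m2 m3 c1 sum_negf
            del: index_mult_mat(1))
    qed simp
    have 2: "(\<Sum>l<N. letter_val g c $$ (a, l) * ?d g l b) =
       (\<Sum>k\<in>letter_positions i w. letter_sign (c # w) (Suc k) *
         (wv g (take (cut_pos (c # w) (Suc k)) (c # w)) * X * wv g (drop (cut_pos (c # w) (Suc k)) (c # w))) $$ (a, b))"
    proof -
      have "(\<Sum>l<N. letter_val g c $$ (a, l) * ?d g l b) =
        (\<Sum>k\<in>letter_positions i w. letter_sign w k * (\<Sum>l<N. letter_val g c $$ (a, l) *
          (wv g (take (cut_pos w k) w) * X * wv g (drop (cut_pos w k) w)) $$ (l, b)))"
        by (simp add: sum_distrib_left sum.swap[of _ "{..<N}"] ac_simps del: index_mult_mat(1))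
      also have "\<dots> = (\<Sum>k\<in>letter_positions i w. letter_sign w k *
          (letter_val g c * (wv g (take (cut_pos w k) w) * X * wv g (drop (cut_pos w k) w))) $$ (a, b))"
      proof -
        have "(letter_val g c * (wv g (take n w) * X * wv g (drop n w))) $$ (a, b) =
          (\<Sum>l<N. letter_val g c $$ (a, l) * (wv g (take n w) * X * wv g (drop n w)) $$ (l, b))" for n
          using L velocity_carrier ab tw by (intro mat_mult_index[of _ N N _ N] mult_carrier_mat) auto
        then show ?thesis by simp
      qed
      also have "\<dots> = (\<Sum>k\<in>letter_positions i w. letter_sign (c # w) (Suc k) *
         (wv g (take (cut_pos (c # w) (Suc k)) (c # w)) * X * wv g (drop (cut_pos (c # w) (Suc k)) (c # w))) $$ (a, b))"
      proof -
        have "letter_val g c * (wv g (take n w) * X * wv g (drop n w)) =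
            letter_val g c * wv g (take n w) * X * wv g (drop n w)" for n
          using L velocity_carrier tw assoc_mult_mat[of "letter_val g c" N N "wv g (take n w) * X" N "wv g (drop n w)" N]
            assoc_mult_mat[of "letter_val g c" N N "wv g (take n w)" N X N]
            mult_carrier_mat[of "wv g (take n w)" N N X N] by simp
        then show ?thesis by (simp add: wv_Cons[OF g c])
      qed
      finally show ?thesis .
    qed
    show "(\<Sum>l<N. ?l g a l * wv (move 0 g) w $$ (l, b) + letter_val (move 0 g) c $$ (a, l) * ?d g l b) =
      (\<Sum>k\<in>letter_positions i (c # w). letter_sign (c # w) k *
       (wv g (take (cut_pos (c # w) k) (c # w)) * X * wv g (drop (cut_pos (c # w) k) (c # w))) $$ (a, b))"
      unfolding move_0[OF g] sum.distrib 1 2 sum_letter_positions_Cons ..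
  qed
qed

text \<open>The trace of T X D is that of X D T, and D T is the value of the word rotated to the
  cut; hence its (q, p) entry is the coefficient of the (p, q) entry of X.\<close>

definition trace_deriv :: "fg_word \<Rightarrow> (nat \<Rightarrow> 'a mat) \<Rightarrow> 'a" where
  "trace_deriv w g = (\<Sum>p<N. \<Sum>q<N. X $$ (p, q) *
     (\<Sum>k\<in>letter_positions i w. letter_sign w k * wv g (cyc_shift (cut_pos w k) w) $$ (q, p)))"

lemma uderiv_word_entries:
  assumes "word_in r w" "a < N" "b < N"
  shows "uderiv (space (prod_haar r)) (\<lambda>t g. wv (move t g) w $$ (a, b))
    (\<lambda>g. \<Sum>p<N. \<Sum>q<N. X $$ (p, q) * (\<Sum>k\<in>letter_positions i w. letter_sign w k *
       (wv g (take (cut_pos w k) w) $$ (a, p) * wv g (drop (cut_pos w k) w) $$ (q, b))))"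
proof (rule uderiv_eqI[OF uderiv_word[OF assms]])
  fix g assume g: "g \<in> space (prod_haar r)"
  let ?F = "\<lambda>k p q. X $$ (p, q) * (letter_sign w k *
       (wv g (take (cut_pos w k) w) $$ (a, p) * wv g (drop (cut_pos w k) w) $$ (q, b)))"
  have "(\<Sum>k\<in>letter_positions i w. letter_sign w k *
       (wv g (take (cut_pos w k) w) * X * wv g (drop (cut_pos w k) w)) $$ (a, b)) =
    (\<Sum>k\<in>letter_positions i w. \<Sum>p<N. \<Sum>q<N. ?F k p q)"
    using assms wv_mat[OF g] velocity_carrier
    by (simp add: mat_triple_index[of _ N] word_in_take word_in_drop sum_distrib_left mult.left_commute
        del: index_mult_mat(1))
  also have "\<dots> = (\<Sum>p<N. \<Sum>k\<in>letter_positions i w. \<Sum>q<N. ?F k p q)"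
    by (rule sum.swap)
  also have "\<dots> = (\<Sum>p<N. \<Sum>q<N. \<Sum>k\<in>letter_positions i w. ?F k p q)"
    by (rule sum.cong[OF refl], rule sum.swap)
  finally show "(\<Sum>k\<in>letter_positions i w. letter_sign w k *
       (wv g (take (cut_pos w k) w) * X * wv g (drop (cut_pos w k) w)) $$ (a, b)) =
    (\<Sum>p<N. \<Sum>q<N. X $$ (p, q) * (\<Sum>k\<in>letter_positions i w. letter_sign w k *
       (wv g (take (cut_pos w k) w) $$ (a, p) * wv g (drop (cut_pos w k) w) $$ (q, b))))"
    by (simp only: sum_distrib_left)
qed simp

lemma uderiv_trace:
  assumes w: "word_in r w"
  shows "uderiv (space (prod_haar r)) (\<lambda>t g. mat_trace (wv (move t g) w)) (trace_deriv w)"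
proof (rule uderiv_eqI)
  show "uderiv (space (prod_haar r)) (\<lambda>t g. \<Sum>a<N. wv (move t g) w $$ (a, a))
    (\<lambda>g. \<Sum>a<N. \<Sum>p<N. \<Sum>q<N. X $$ (p, q) * (\<Sum>k\<in>letter_positions i w. letter_sign w k *
       (wv g (take (cut_pos w k) w) $$ (a, p) * wv g (drop (cut_pos w k) w) $$ (q, a))))"
    using w by (intro uderiv_sum uderiv_word_entries) auto
next
  fix t :: real and g assume "\<bar>t\<bar> \<le> 1" "g \<in> space (prod_haar r)"
  then show "(\<Sum>a<N. wv (move t g) w $$ (a, a)) = mat_trace (wv (move t g) w)"
    using mat_trace_word[OF move_space w] by simp
next
  fix g assume g: "g \<in> space (prod_haar r)"
  let ?F = "\<lambda>a p q. X $$ (p, q) * (\<Sum>k\<in>letter_positions i w. letter_sign w k *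
     (wv g (take (cut_pos w k) w) $$ (a, p) * wv g (drop (cut_pos w k) w) $$ (q, a)))"
  have "trace_deriv w g = (\<Sum>p<N. \<Sum>q<N. X $$ (p, q) * (\<Sum>k\<in>letter_positions i w. letter_sign w k *
     (\<Sum>a<N. wv g (take (cut_pos w k) w) $$ (a, p) * wv g (drop (cut_pos w k) w) $$ (q, a))))"
    unfolding trace_deriv_def
  proof (intro sum.cong refl arg_cong2[of _ _ _ _ "(*)"])
    fix p q k assume pq: "p \<in> {..<N}" "q \<in> {..<N}"
    let ?t = "take (cut_pos w k) w" and ?d = "drop (cut_pos w k) w"
    have "wv g (cyc_shift (cut_pos w k) w) = wv g ?d * wv g ?t"
      unfolding cyc_shift_def using w by (intro wv_append[OF g] word_in_take word_in_drop)
    also have "(wv g ?d * wv g ?t) $$ (q, p) = (\<Sum>a<N. wv g ?d $$ (q, a) * wv g ?t $$ (a, p))"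
      using pq w wv_mat[OF g] by (intro mat_mult_index[of _ N N _ N]) (auto simp: word_in_take word_in_drop)
    finally show "wv g (cyc_shift (cut_pos w k) w) $$ (q, p) = (\<Sum>a<N. wv g ?t $$ (a, p) * wv g ?d $$ (q, a))"
      by (simp only: mult.commute)
  qed
  also have "\<dots> = (\<Sum>p<N. \<Sum>q<N. \<Sum>a<N. ?F a p q)"
    unfolding sum_distrib_left by (rule sum.cong[OF refl], rule sum.cong[OF refl], rule sum.swap)
  also have "\<dots> = (\<Sum>p<N. \<Sum>a<N. \<Sum>q<N. ?F a p q)"
    by (rule sum.cong[OF refl], rule sum.swap)
  also have "\<dots> = (\<Sum>a<N. \<Sum>p<N. \<Sum>q<N. ?F a p q)"
    by (rule sum.swap)
  finally show "(\<Sum>a<N. \<Sum>p<N. \<Sum>q<N. ?F a p q) = trace_deriv w g"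
    by simp
qed

lemma uderiv_trace_prod:
  assumes "list_all (word_in r) ws"
  shows "uderiv (space (prod_haar r)) (\<lambda>t g. trace_prod ws (move t g))
    (\<lambda>g. \<Sum>j<length ws. trace_deriv (ws ! j) g * trace_prod (remove_nth j ws) g)"
  using assms
proof (induction ws)
  case Nil
  show ?case using uderiv_const[of "space (prod_haar r)" "\<lambda>_. 1" 1] by simp
next
  case (Cons w ws)
  have "uderiv (space (prod_haar r)) (\<lambda>t g. mat_trace (wv (move t g) w) * trace_prod ws (move t g))
     (\<lambda>g. trace_deriv w g * trace_prod ws (move 0 g) + mat_trace (wv (move 0 g) w) *
        (\<Sum>j<length ws. trace_deriv (ws ! j) g * trace_prod (remove_nth j ws) g))"
    using Cons by (intro uderiv_mult uderiv_trace Cons.IH) auto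
  then show ?case
    by (rule uderiv_eqI)
      (simp_all add: move_0 sum.lessThan_Suc_shift sum_distrib_left ac_simps del: sum.lessThan_Suc)
qed

end

text \<open>The coefficient of \<open>X $$ (p, q)\<close> in the derivative, along \<open>X\<close> at the generator \<open>i\<close>, of the
  \<open>(a, b)\<close> entry of \<open>w\<close> times the product of the traces of \<open>ws\<close>.\<close>

definition deriv_coeff ::
  "nat \<Rightarrow> fg_word \<Rightarrow> fg_word list \<Rightarrow> nat \<Rightarrow> nat \<Rightarrow> nat \<Rightarrow> nat \<Rightarrow> (nat \<Rightarrow> 'a mat) \<Rightarrow> 'a" where
  "deriv_coeff i w ws a b p q g =
     (\<Sum>k\<in>letter_positions i w. letter_sign w k *
       (wv g (take (cut_pos w k) w) $$ (a, p) * wv g (drop (cut_pos w k) w) $$ (q, b))) * trace_prod ws g +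
     wv g w $$ (a, b) * (\<Sum>j<length ws.
       (\<Sum>k\<in>letter_positions i (ws ! j). letter_sign (ws ! j) k *
         wv g (cyc_shift (cut_pos (ws ! j) k) (ws ! j)) $$ (q, p)) * trace_prod (remove_nth j ws) g)"

lemma bounded_rv_deriv_coeff:
  assumes "word_in r w" "list_all (word_in r) ws" "a < N" "b < N" "p < N" "q < N"
  shows "bounded_rv r (deriv_coeff i w ws a b p q)"
  unfolding deriv_coeff_def[abs_def]
proof (intro bounded_rv_add bounded_rv_mult bounded_rv_sum bounded_rv_const bounded_rv_word
    bounded_rv_trace_prod assms word_in_take word_in_drop word_in_cyc_shift)
  fix j assume j: "j \<in> {..<length ws}"
  then show "word_in r (ws ! j)" using assms(2) by (simp add: list_all_length)
  show "list_all (word_in r) (remove_nth j ws)"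
    using assms(2) set_remove_nth[of j ws] by (auto simp: list_all_iff)
qed

text \<open>Translating generator i along the curve leaves the integral unchanged, so the integrated
  derivative vanishes. The word \<open>w\<close> enters through one entry instead of its trace, in
  order that a and b can later be tied to the direction X.\<close>

lemma integral_deriv_path:
  assumes i: "i \<in> {1..r}" and R: "path_along X R"
    and w: "word_in r w" "list_all (word_in r) ws" and ab: "a < N" "b < N"
  shows "(\<Sum>p<N. \<Sum>q<N. X $$ (p, q) * (\<integral>g. deriv_coeff i w ws a b p q g \<partial>prod_haar r)) = 0"
proof -
  interpret P: prob_space "prod_haar r" by (rule prob_space_prod_haar)
  let ?f = "\<lambda>g. wv g w $$ (a, b) * trace_prod ws g"
  let ?f' = "\<lambda>g. \<Sum>p<N. \<Sum>q<N. X $$ (p, q) * deriv_coeff i w ws a b p q g"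
  have f: "bounded_rv r ?f"
    using w ab by (intro bounded_rv_mult bounded_rv_word bounded_rv_trace_prod)
  have f': "bounded_rv r ?f'"
    using w ab by (intro bounded_rv_sum bounded_rv_mult bounded_rv_const bounded_rv_deriv_coeff) auto
  have "uderiv (space (prod_haar r)) (\<lambda>t g. ?f (shift i (R t) g))
     (\<lambda>g. (\<Sum>p<N. \<Sum>q<N. X $$ (p, q) * (\<Sum>k\<in>letter_positions i w. letter_sign w k *
       (wv g (take (cut_pos w k) w) $$ (a, p) * wv g (drop (cut_pos w k) w) $$ (q, b)))) *
        trace_prod ws (shift i (R 0) g) + wv (shift i (R 0) g) w $$ (a, b) *
       (\<Sum>j<length ws. trace_deriv i X (ws ! j) g * trace_prod (remove_nth j ws) g))"
    by (intro uderiv_mult uderiv_word_entries[OF i R] uderiv_trace_prod[OF i R] w ab)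
  then have "uderiv (space (prod_haar r)) (\<lambda>t g. ?f (shift i (R t) g)) ?f'"
  proof (rule uderiv_eqI)
    fix g assume g: "g \<in> space (prod_haar r)"
    let ?H = "\<lambda>j p q. X $$ (p, q) * ((\<Sum>k\<in>letter_positions i (ws ! j). letter_sign (ws ! j) k *
         wv g (cyc_shift (cut_pos (ws ! j) k) (ws ! j)) $$ (q, p)) * trace_prod (remove_nth j ws) g)"
    have "(\<Sum>j<length ws. trace_deriv i X (ws ! j) g * trace_prod (remove_nth j ws) g) =
      (\<Sum>j<length ws. \<Sum>p<N. \<Sum>q<N. ?H j p q)"
      unfolding trace_deriv_def[OF i R] by (simp only: sum_distrib_right mult.assoc)
    also have "\<dots> = (\<Sum>p<N. \<Sum>j<length ws. \<Sum>q<N. ?H j p q)"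
      by (rule sum.swap)
    also have "\<dots> = (\<Sum>p<N. \<Sum>q<N. \<Sum>j<length ws. ?H j p q)"
      by (rule sum.cong[OF refl], rule sum.swap)
    finally show "(\<Sum>p<N. \<Sum>q<N. X $$ (p, q) * (\<Sum>k\<in>letter_positions i w. letter_sign w k *
       (wv g (take (cut_pos w k) w) $$ (a, p) * wv g (drop (cut_pos w k) w) $$ (q, b)))) *
        trace_prod ws (shift i (R 0) g) + wv (shift i (R 0) g) w $$ (a, b) *
       (\<Sum>j<length ws. trace_deriv i X (ws ! j) g * trace_prod (remove_nth j ws) g) = ?f' g"
      unfolding move_0[OF i R g] deriv_coeff_def distrib_left sum.distrib
      by (simp add: sum_distrib_left sum_distrib_right mult.assoc mult.left_commute)
  qed simp
  then have "(\<integral>g. ?f' g \<partial>prod_haar r) = 0"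
  proof (rule P.uderiv_integral_eq_0)
    show "?f' \<in> borel_measurable (prod_haar r)" using f' by (simp add: bounded_rv_def)
    fix t :: real assume t: "\<bar>t\<bar> \<le> 1"
    have fm: "?f \<in> borel_measurable (prod_haar r)" using f by (simp add: bounded_rv_def)
    note Rt = path_closed[OF i R t] and R0 = path_closed[OF i R, of 0]
    show "(\<lambda>g. ?f (shift i (R t) g)) \<in> borel_measurable (prod_haar r)"
      using measurable_compose[OF shift_measurable[OF i Rt] fm] .
    show "(\<integral>g. ?f (shift i (R t) g) \<partial>prod_haar r) = (\<integral>g. ?f (shift i (R 0) g) \<partial>prod_haar r)"
      using integral_shift[OF i Rt fm] integral_shift[OF i R0 fm] by simp
  qed
  moreover have "(\<integral>g. ?f' g \<partial>prod_haar r) =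
     (\<Sum>p<N. \<Sum>q<N. X $$ (p, q) * (\<integral>g. deriv_coeff i w ws a b p q g \<partial>prod_haar r))"
  proof -
    have int: "integrable (prod_haar r) (\<lambda>g. X $$ (p, q) * deriv_coeff i w ws a b p q g)"
      if "p < N" "q < N" for p q
      using w ab that by (intro integrable_mult_right integrable_bounded_rv bounded_rv_deriv_coeff)
    have "(\<integral>g. ?f' g \<partial>prod_haar r) =
        (\<Sum>p<N. \<integral>g. (\<Sum>q<N. X $$ (p, q) * deriv_coeff i w ws a b p q g) \<partial>prod_haar r)"
      by (rule Bochner_Integration.integral_sum) (auto intro!: Bochner_Integration.integrable_sum int)
    also have "\<dots> = (\<Sum>p<N. \<Sum>q<N. \<integral>g. X $$ (p, q) * deriv_coeff i w ws a b p q g \<partial>prod_haar r)"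
      by (rule sum.cong[OF refl], rule Bochner_Integration.integral_sum) (auto intro!: int)
    finally show ?thesis by simp
  qed
  ultimately show ?thesis by simp
qed

end

text \<open>The integrated identity is linear in X over the whole field, so it suffices that Y -
  sharp Y is a combination of velocities. Two are allowed, because for Sp the velocities form a real
  space and a complex direction has two skew-Hermitian components.\<close>

locale tangent_matrix_model = matrix_model +
  assumes tangent: "Y \<in> carrier_mat N N \<Longrightarrow> \<exists>c1 X1 R1 c2 X2 R2. path_along X1 R1 \<and> path_along X2 R2 \<and>
    (\<forall>p<N. \<forall>q<N. Y $$ (p, q) - sharp J Y $$ (p, q) = c1 * X1 $$ (p, q) + c2 * X2 $$ (p, q))"

section \<open>Contraction with the Casimir element\<close>

context matrix_model
begin

text \<open>Pairing the two tensor slots of \<open>F\<close> with the Casimir element of the Lie algebra.\<close>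

definition casimir :: "(nat \<Rightarrow> nat \<Rightarrow> nat \<Rightarrow> nat \<Rightarrow> 'a) \<Rightarrow> 'a" where
  "casimir F = (\<Sum>a<N. \<Sum>b<N. F a b a b - (\<Sum>p<N. \<Sum>q<N. J $$ (b, p) * J $$ (a, q) * F a b p q))"

lemma casimir_add: "casimir (\<lambda>a b p q. F a b p q + H a b p q) = casimir F + casimir H"
  by (simp add: casimir_def sum.distrib sum_subtractf distrib_left algebra_simps)

lemma casimir_cmult: "casimir (\<lambda>a b p q. c * F a b p q) = c * casimir F"
  by (simp add: casimir_def sum_distrib_left right_diff_distrib mult.left_commute)

lemma casimir_sum: "casimir (\<lambda>a b p q. \<Sum>k\<in>A. F k a b p q) = (\<Sum>k\<in>A. casimir (F k))"
proof (induction A rule: infinite_finite_induct)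
  case (insert k A)
  then show ?case by (simp add: casimir_add)
qed (simp_all add: casimir_def)

lemma sign_square: "\<sigma> * \<sigma> = 1"
  using sign by auto

text \<open>The diagonal part of \<open>casimir\<close> sets p = a and q = b, which separates the
  traces. In the other part the indices of one factor J must be swapped to recognise
  \<open>sharp J P\<close>, which produces \<sigma>.\<close>

lemma casimir_split:
  assumes P: "P \<in> carrier_mat N N" and Q: "Q \<in> carrier_mat N N"
  shows "casimir (\<lambda>a b p q. P $$ (a, p) * Q $$ (q, b)) =
     mat_trace P * mat_trace Q - \<sigma> * mat_trace (sharp J P * Q)"
proof -
  let ?F = "\<lambda>a b p q. J $$ (b, p) * J $$ (a, q) * (P $$ (a, p) * Q $$ (q, b))"
  have "\<sigma> * mat_trace (sharp J P * Q) =
      (\<Sum>b<N. \<Sum>q<N. \<Sum>a<N. \<Sum>p<N. \<sigma> * J $$ (p, b) * J $$ (a, q) * (P $$ (a, p) * Q $$ (q, b)))"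
    using P Q by (simp add: mat_trace_mult[of _ N N] sharp_index sum_distrib_left sum_distrib_right ac_simps)
  also have "\<dots> = (\<Sum>b<N. \<Sum>q<N. \<Sum>a<N. \<Sum>p<N. ?F a b p q)"
    using J(3) by (intro sum.cong refl) (metis lessThan_iff)
  also have "\<dots> = (\<Sum>b<N. \<Sum>a<N. \<Sum>q<N. \<Sum>p<N. ?F a b p q)"
    by (rule sum.cong[OF refl], rule sum.swap)
  also have "\<dots> = (\<Sum>b<N. \<Sum>a<N. \<Sum>p<N. \<Sum>q<N. ?F a b p q)"
    by (rule sum.cong[OF refl], rule sum.cong[OF refl], rule sum.swap)
  also have "\<dots> = (\<Sum>a<N. \<Sum>b<N. \<Sum>p<N. \<Sum>q<N. ?F a b p q)"
    by (rule sum.swap)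
  finally have "\<sigma> * mat_trace (sharp J P * Q) = \<dots>" .
  moreover have "mat_trace P * mat_trace Q = (\<Sum>a<N. \<Sum>b<N. P $$ (a, a) * Q $$ (b, b))"
    using P Q by (simp add: mat_trace_def sum_product)
  ultimately show ?thesis by (simp add: casimir_def sum_subtractf)
qed

text \<open>Here both factors J have to be swapped, so the signs multiply to \<sigma>^2 = 1. This is
  why \<sigma> appears in the splitting terms of the loop equation but not in the merging
  terms.\<close>

lemma casimir_merge:
  assumes W: "W \<in> carrier_mat N N" and V: "V \<in> carrier_mat N N"
  shows "casimir (\<lambda>a b p q. W $$ (a, b) * V $$ (q, p)) = mat_trace (W * V) - mat_trace (sharp J V * W)"
proof -
  let ?F = "\<lambda>a b p q. J $$ (b, p) * J $$ (a, q) * (W $$ (a, b) * V $$ (q, p))"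
  have "mat_trace (sharp J V * W) =
      (\<Sum>b<N. \<Sum>a<N. \<Sum>q<N. \<Sum>p<N. J $$ (p, b) * J $$ (q, a) * (W $$ (a, b) * V $$ (q, p)))"
    using W V by (simp add: mat_trace_mult[of _ N N] sharp_index sum_distrib_left sum_distrib_right ac_simps)
  also have "\<dots> = (\<Sum>b<N. \<Sum>a<N. \<Sum>q<N. \<Sum>p<N. ?F a b p q)"
  proof (intro sum.cong refl)
    fix b a q p assume "b \<in> {..<N}" "a \<in> {..<N}" "q \<in> {..<N}" "p \<in> {..<N}"
    then have "J $$ (p, b) = \<sigma> * J $$ (b, p)" "J $$ (q, a) = \<sigma> * J $$ (a, q)"
      by (auto intro!: J(3))
    then have "J $$ (p, b) * J $$ (q, a) = (\<sigma> * \<sigma>) * (J $$ (b, p) * J $$ (a, q))" by simp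
    then show "J $$ (p, b) * J $$ (q, a) * (W $$ (a, b) * V $$ (q, p)) =
        ?F a b p q" by (simp add: sign_square)
  qed
  also have "\<dots> = (\<Sum>b<N. \<Sum>a<N. \<Sum>p<N. \<Sum>q<N. ?F a b p q)"
    by (rule sum.cong[OF refl], rule sum.cong[OF refl], rule sum.swap)
  also have "\<dots> = (\<Sum>a<N. \<Sum>b<N. \<Sum>p<N. \<Sum>q<N. ?F a b p q)"
    by (rule sum.swap)
  finally show ?thesis
    using W V by (simp add: casimir_def sum_subtractf mat_trace_mult[of _ N N])
qed

lemma casimir_integral:
  assumes "\<And>a b p q. a < N \<Longrightarrow> b < N \<Longrightarrow> p < N \<Longrightarrow> q < N \<Longrightarrow> integrable M (F a b p q)"
  shows "(\<integral>g. casimir (\<lambda>a b p q. F a b p q g) \<partial>M) = casimir (\<lambda>a b p q. \<integral>g. F a b p q g \<partial>M)"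
proof -
  let ?H = "\<lambda>a b p q g. J $$ (b, p) * J $$ (a, q) * F a b p q g"
  have 1: "integrable M (\<lambda>g. ?H a b p q g)"
    if "a < N" "b < N" "p < N" "q < N" for a b p q
    using assms that by (intro integrable_mult_right) auto
  have 2: "integrable M (\<lambda>g. \<Sum>q<N. ?H a b p q g)"
    if "a < N" "b < N" "p < N" for a b p
    by (rule Bochner_Integration.integrable_sum) (use 1 that in auto)
  have 3: "integrable M (\<lambda>g. \<Sum>p<N. \<Sum>q<N. ?H a b p q g)"
    if "a < N" "b < N" for a b
    by (rule Bochner_Integration.integrable_sum) (use 2 that in auto)
  have 4: "integrable M (\<lambda>g. F a b a b g - (\<Sum>p<N. \<Sum>q<N. ?H a b p q g))"
    if "a < N" "b < N" for a b
    using 3 that assms by (intro Bochner_Integration.integrable_diff) auto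
  have 5: "integrable M (\<lambda>g. \<Sum>b<N. F a b a b g - (\<Sum>p<N. \<Sum>q<N. ?H a b p q g))"
    if "a < N" for a
    by (rule Bochner_Integration.integrable_sum) (use 4 that in auto)
  have "(\<integral>g. casimir (\<lambda>a b p q. F a b p q g) \<partial>M) =
      (\<Sum>a<N. \<integral>g. (\<Sum>b<N. F a b a b g - (\<Sum>p<N. \<Sum>q<N. ?H a b p q g)) \<partial>M)"
    unfolding casimir_def by (rule Bochner_Integration.integral_sum) (use 5 in auto)
  also have "\<dots> = (\<Sum>a<N. \<Sum>b<N. \<integral>g. F a b a b g - (\<Sum>p<N. \<Sum>q<N. ?H a b p q g) \<partial>M)"
    by (rule sum.cong[OF refl], rule Bochner_Integration.integral_sum) (use 4 in auto)
  also have "\<dots> = (\<Sum>a<N. \<Sum>b<N. (\<integral>g. F a b a b g \<partial>M) -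
      (\<integral>g. (\<Sum>p<N. \<Sum>q<N. ?H a b p q g) \<partial>M))"
    using 3 assms by (intro sum.cong refl Bochner_Integration.integral_diff) auto
  also have "\<dots> = casimir (\<lambda>a b p q. \<integral>g. F a b p q g \<partial>M)"
    unfolding casimir_def
  proof (intro sum.cong refl arg_cong2[of _ _ _ _ "(-)"])
    fix a b assume ab: "a \<in> {..<N}" "b \<in> {..<N}"
    have "(\<integral>g. (\<Sum>p<N. \<Sum>q<N. ?H a b p q g) \<partial>M) =
       (\<Sum>p<N. \<integral>g. (\<Sum>q<N. ?H a b p q g) \<partial>M)"
      by (rule Bochner_Integration.integral_sum) (use 2 ab in auto)
    also have "\<dots> = (\<Sum>p<N. \<Sum>q<N. \<integral>g. ?H a b p q g \<partial>M)"
      by (rule sum.cong[OF refl], rule Bochner_Integration.integral_sum) (use 1 ab in auto)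
    finally show "(\<integral>g. (\<Sum>p<N. \<Sum>q<N. ?H a b p q g) \<partial>M) =
       (\<Sum>p<N. \<Sum>q<N. J $$ (b, p) * J $$ (a, q) * (\<integral>g. F a b p q g \<partial>M))" by simp
  qed
  finally show ?thesis .
qed

text \<open>An occurrence in \<open>w\<close> carries the pattern of \<open>casimir_split\<close>,
  an occurrence in another word that of \<open>casimir_merge\<close>. On values of words
  \<open>sharp J\<close> is formal inversion, so every term is again a product of traces of
  words.\<close>

lemma casimir_deriv_coeff:
  assumes g: "g \<in> space (prod_haar r)" and w: "word_in r w" and ws: "list_all (word_in r) ws"
  shows "casimir (\<lambda>a b p q. deriv_coeff i w ws a b p q g) =
    (\<Sum>k\<in>letter_positions i w. letter_sign w k *
       (trace_prod (take (cut_pos w k) w # drop (cut_pos w k) w # ws) g -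
        \<sigma> * trace_prod ((inv_word (take (cut_pos w k) w) @ drop (cut_pos w k) w) # ws) g)) +
    (\<Sum>j<length ws. \<Sum>k\<in>letter_positions i (ws ! j). letter_sign (ws ! j) k *
       (trace_prod ((w @ cyc_shift (cut_pos (ws ! j) k) (ws ! j)) # remove_nth j ws) g -
        trace_prod ((inv_word (cyc_shift (cut_pos (ws ! j) k) (ws ! j)) @ w) # remove_nth j ws) g))" (is "_ = ?rhs")
proof -
  have inv: "wv g (inv_word u) = sharp J (wv g u)" if "word_in r u" for u
    using wv_inv[OF g, of u] inv_eq_sharp[OF wv_closed[OF g]] that by simp
  have "deriv_coeff i w ws a b p q g =
     (\<Sum>k\<in>letter_positions i w. (letter_sign w k * trace_prod ws g) *
       (wv g (take (cut_pos w k) w) $$ (a, p) * wv g (drop (cut_pos w k) w) $$ (q, b))) +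
     (\<Sum>j<length ws. \<Sum>k\<in>letter_positions i (ws ! j). (letter_sign (ws ! j) k * trace_prod (remove_nth j ws) g) *
       (wv g w $$ (a, b) * wv g (cyc_shift (cut_pos (ws ! j) k) (ws ! j)) $$ (q, p)))" for a b p q
    unfolding deriv_coeff_def by (simp add: sum_distrib_left sum_distrib_right ac_simps)
  then have "casimir (\<lambda>a b p q. deriv_coeff i w ws a b p q g) =
     (\<Sum>k\<in>letter_positions i w. (letter_sign w k * trace_prod ws g) *
       (mat_trace (wv g (take (cut_pos w k) w)) * mat_trace (wv g (drop (cut_pos w k) w)) -
        \<sigma> * mat_trace (sharp J (wv g (take (cut_pos w k) w)) * wv g (drop (cut_pos w k) w)))) +
     (\<Sum>j<length ws. \<Sum>k\<in>letter_positions i (ws ! j). (letter_sign (ws ! j) k * trace_prod (remove_nth j ws) g) *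
       (mat_trace (wv g w * wv g (cyc_shift (cut_pos (ws ! j) k) (ws ! j))) -
        mat_trace (sharp J (wv g (cyc_shift (cut_pos (ws ! j) k) (ws ! j))) * wv g w)))"
    using w ws wv_mat[OF g]
    by (simp add: casimir_add casimir_sum casimir_cmult casimir_split casimir_merge
        word_in_take word_in_drop list_all_length)
  also have "\<dots> = ?rhs"
    using w ws
    by (intro arg_cong2[of _ _ _ _ "(+)"] sum.cong refl)
      (simp_all add: inv wv_append[OF g] word_in_take word_in_drop list_all_length algebra_simps)
  finally show ?thesis .
qed

lemma trace_integral_eq: "trace_integral G \<mu> r ws = (\<integral>g. trace_prod ws g \<partial>prod_haar r)"
  by (simp add: trace_integral_def prod_haar_def trace_prod_def)

end

context tangent_matrix_model
begin

text \<open>The direction is Y - sharp Y for the elementary matrix Y with its 1 at (a, b), that is,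
  twice the projection of Y to the skew matrices. The (p, q) entry of sharp Y is J_bp J_aq, the
  kernel in \<open>casimir\<close>.\<close>

lemma integral_deriv_tangent:
  assumes i: "i \<in> {1..r}" and w: "word_in r w" "list_all (word_in r) ws" and ab: "a < N" "b < N"
  shows "(\<integral>g. deriv_coeff i w ws a b a b g \<partial>prod_haar r) =
    (\<Sum>p<N. \<Sum>q<N. J $$ (b, p) * J $$ (a, q) * (\<integral>g. deriv_coeff i w ws a b p q g \<partial>prod_haar r))"
proof -
  let ?I = "\<lambda>p q. \<integral>g. deriv_coeff i w ws a b p q g \<partial>prod_haar r"
  define Y :: "'a mat" where "Y = mat N N (\<lambda>(p, q). if p = a \<and> q = b then 1 else 0)"
  have Y: "Y \<in> carrier_mat N N" by (simp add: Y_def)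
  obtain c1 X1 R1 c2 X2 R2 where X: "path_along X1 R1" "path_along X2 R2"
    and eq: "\<And>p q. p < N \<Longrightarrow> q < N \<Longrightarrow> Y $$ (p, q) - sharp J Y $$ (p, q) = c1 * X1 $$ (p, q) + c2 * X2 $$ (p, q)"
    using tangent[OF Y] by blast
  have "(\<Sum>p<N. \<Sum>q<N. (Y $$ (p, q) - sharp J Y $$ (p, q)) * ?I p q) =
     c1 * (\<Sum>p<N. \<Sum>q<N. X1 $$ (p, q) * ?I p q) + c2 * (\<Sum>p<N. \<Sum>q<N. X2 $$ (p, q) * ?I p q)"
    by (simp add: eq sum_distrib_left distrib_right sum.distrib mult.assoc)
  also have "\<dots> = 0" unfolding integral_deriv_path[OF i X(1) w ab] integral_deriv_path[OF i X(2) w ab] by simp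
  finally have 0: "(\<Sum>p<N. \<Sum>q<N. Y $$ (p, q) * ?I p q) = (\<Sum>p<N. \<Sum>q<N. sharp J Y $$ (p, q) * ?I p q)"
    by (simp add: left_diff_distrib sum_subtractf)
  have "(\<Sum>p<N. \<Sum>q<N. Y $$ (p, q) * ?I p q) = (\<Sum>p<N. \<Sum>q<N. if q = b then if p = a then ?I p q else 0 else 0)"
    by (intro sum.cong refl) (simp add: Y_def)
  also have "\<dots> = ?I a b" using ab by (simp add: sum.delta)
  finally have 1: "(\<Sum>p<N. \<Sum>q<N. Y $$ (p, q) * ?I p q) = ?I a b" .
  have 2: "sharp J Y $$ (p, q) = J $$ (b, p) * J $$ (a, q)" if "p < N" "q < N" for p q
  proof -
    have "sharp J Y $$ (p, q) = (\<Sum>l<N. \<Sum>k<N. if k = b then if l = a then J $$ (k, p) * J $$ (l, q) else 0 else 0)"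
      unfolding sharp_index[OF Y that] by (intro sum.cong refl) (simp add: Y_def)
    also have "\<dots> = J $$ (b, p) * J $$ (a, q)" using ab by (simp add: sum.delta)
    finally show ?thesis .
  qed
  show ?thesis using 0 unfolding 1 by (simp add: 2)
qed

theorem loop_system: "loop_system r N \<sigma> (trace_integral G \<mu> r)"
proof
  interpret P: prob_space "prod_haar r" by (rule prob_space_prod_haar)
  note ti = trace_integral_eq
  show "\<sigma> = 1 \<or> \<sigma> = - 1" by (rule sign)
  show "trace_integral G \<mu> r [] = 1" by (simp add: ti P.prob_space)
  show "trace_integral G \<mu> r ([] # ws) = of_nat N * trace_integral G \<mu> r ws" for ws
    by (simp add: ti mat_trace_def)
  show "trace_integral G \<mu> r (red w # ws) = trace_integral G \<mu> r (w # ws)"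
    if "list_all (word_in r) (w # ws)" for w ws
    unfolding ti using that by (intro Bochner_Integration.integral_cong) (auto simp: wv_red)
  show "trace_integral G \<mu> r ((v @ u) # ws) = trace_integral G \<mu> r ((u @ v) # ws)"
    if "list_all (word_in r) ((u @ v) # ws)" for u v ws
    unfolding ti
  proof (intro Bochner_Integration.integral_cong refl)
    fix g assume g: "g \<in> space (prod_haar r)"
    show "trace_prod ((v @ u) # ws) g = trace_prod ((u @ v) # ws) g"
      using that wv_mat[OF g] mat_trace_comm[of "wv g u" N N "wv g v"] by (simp add: wv_append[OF g])
  qed
  show "trace_integral G \<mu> r (inv_word w # ws) = trace_integral G \<mu> r (w # ws)"
    if "list_all (word_in r) (w # ws)" for w ws
    unfolding ti
  proof (intro Bochner_Integration.integral_cong refl)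
    fix g assume g: "g \<in> space (prod_haar r)"
    show "trace_prod (inv_word w # ws) g = trace_prod (w # ws) g"
      using that wv_inv[OF g, of w] mat_trace_inv[OF wv_closed[OF g], of w] by simp
  qed
  fix i w ws assume i: "i \<in> {1..r}" and all: "list_all (word_in r) (w # ws)"
  let ?T = "\<lambda>k. take (cut_pos w k) w" and ?D = "\<lambda>k. drop (cut_pos w k) w"
  let ?V = "\<lambda>j k. cyc_shift (cut_pos (ws ! j) k) (ws ! j)"
  have w: "word_in r w" and ws: "list_all (word_in r) ws" using all by auto
  have wsj: "word_in r (?V j k)" "list_all (word_in r) (remove_nth j ws)" if "j < length ws" for j k
    using that ws set_remove_nth[of j ws] by (auto simp: list_all_iff)
  have int: "integrable (prod_haar r) (trace_prod us)" if "list_all (word_in r) us" for us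
    using that by (intro integrable_bounded_rv bounded_rv_trace_prod)
  have "(\<integral>g. casimir (\<lambda>a b p q. deriv_coeff i w ws a b p q g) \<partial>prod_haar r) =
     casimir (\<lambda>a b p q. \<integral>g. deriv_coeff i w ws a b p q g \<partial>prod_haar r)"
    using w ws by (intro casimir_integral integrable_bounded_rv bounded_rv_deriv_coeff)
  \<comment> \<open>Every summand of \<open>casimir\<close>, for fixed a and b, vanishes separately
    by the identity in the direction of the elementary matrix at (a, b).\<close>
  also have "\<dots> = 0"
    unfolding casimir_def using integral_deriv_tangent[OF i w ws] by simp
  finally have "0 = (\<integral>g. casimir (\<lambda>a b p q. deriv_coeff i w ws a b p q g) \<partial>prod_haar r)" by simp
  also have "\<dots> = (\<integral>g. (\<Sum>k\<in>letter_positions i w. letter_sign w k *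
       (trace_prod (?T k # ?D k # ws) g - \<sigma> * trace_prod ((inv_word (?T k) @ ?D k) # ws) g)) +
    (\<Sum>j<length ws. \<Sum>k\<in>letter_positions i (ws ! j). letter_sign (ws ! j) k *
       (trace_prod ((w @ ?V j k) # remove_nth j ws) g -
        trace_prod ((inv_word (?V j k) @ w) # remove_nth j ws) g)) \<partial>prod_haar r)"
    using w ws by (intro Bochner_Integration.integral_cong casimir_deriv_coeff refl)
  also have "\<dots> = (\<Sum>k\<in>letter_positions i w. letter_sign w k *
         (trace_integral G \<mu> r (?T k # ?D k # ws) - \<sigma> * trace_integral G \<mu> r ((inv_word (?T k) @ ?D k) # ws))) +
      (\<Sum>j<length ws. \<Sum>k\<in>letter_positions i (ws ! j). letter_sign (ws ! j) k *
         (trace_integral G \<mu> r ((w @ ?V j k) # remove_nth j ws) -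
          trace_integral G \<mu> r ((inv_word (?V j k) @ w) # remove_nth j ws)))"
  proof -
    have 1: "has_bochner_integral (prod_haar r)
      (\<lambda>g. letter_sign w k * (trace_prod (?T k # ?D k # ws) g - \<sigma> * trace_prod ((inv_word (?T k) @ ?D k) # ws) g))
      (letter_sign w k * (trace_integral G \<mu> r (?T k # ?D k # ws) -
         \<sigma> * trace_integral G \<mu> r ((inv_word (?T k) @ ?D k) # ws)))" for k
      unfolding ti using w ws
      by (intro has_bochner_integral_mult_right has_bochner_integral_diff has_bochner_integral_integrable int)
        (simp_all add: word_in_take word_in_drop)
    have 2: "has_bochner_integral (prod_haar r)
      (\<lambda>g. letter_sign (ws ! j) k * (trace_prod ((w @ ?V j k) # remove_nth j ws) g -
        trace_prod ((inv_word (?V j k) @ w) # remove_nth j ws) g))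
      (letter_sign (ws ! j) k * (trace_integral G \<mu> r ((w @ ?V j k) # remove_nth j ws) -
          trace_integral G \<mu> r ((inv_word (?V j k) @ w) # remove_nth j ws)))" if "j < length ws" for j k
      unfolding ti using w wsj[OF that]
      by (intro has_bochner_integral_mult_right has_bochner_integral_diff has_bochner_integral_integrable int)
        simp_all
    show ?thesis
      by (intro has_bochner_integral_integral_eq has_bochner_integral_add has_bochner_integral_sum 1 2) simp
  qed
  finally show "(\<Sum>k\<in>letter_positions i w. letter_sign w k *
         (trace_integral G \<mu> r (?T k # ?D k # ws) - \<sigma> * trace_integral G \<mu> r ((inv_word (?T k) @ ?D k) # ws))) +
      (\<Sum>j<length ws. \<Sum>k\<in>letter_positions i (ws ! j). letter_sign (ws ! j) k *
         (trace_integral G \<mu> r ((w @ ?V j k) # remove_nth j ws) -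
          trace_integral G \<mu> r ((inv_word (?V j k) @ w) # remove_nth j ws))) = 0" by simp
qed

end

section \<open>The Cayley transform\<close>

lemma mat_adjoint_index [simp]:
  "i < dim_col A \<Longrightarrow> j < dim_row A \<Longrightarrow> mat_adjoint A $$ (i, j) = conjugate (A $$ (j, i))"
  "dim_row (mat_adjoint A) = dim_col A" "dim_col (mat_adjoint A) = dim_row A"
  by (auto simp: mat_adjoint_conv)

lemma mat_adjoint_mult:
  fixes A :: "'a::conjugatable_field mat"
  assumes "A \<in> carrier_mat n n" "B \<in> carrier_mat n n"
  shows "mat_adjoint (A * B) = mat_adjoint B * mat_adjoint A"
  using assms
  by (intro eq_matI) (auto simp: scalar_prod_def sum_conjugate conjugate_dist_mul mult.commute)

text \<open>With A = 1 - S, B = 1 + S and C the inverse of A, this serves at once for the adjoint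
  and for \<open>sharp\<close>: both are anti-automorphisms exchanging A and B. Then \<tau>(C)
  inverts B, C commutes with B, and \<tau>(C B) C B = A (\<tau>(C) B) C = A C = 1.\<close>

lemma cayley_isometry:
  fixes A B C :: "'a::field mat"
  assumes A: "A \<in> carrier_mat n n" and B: "B \<in> carrier_mat n n" and C: "C \<in> carrier_mat n n"
    and AC: "A * C = 1\<^sub>m n" and AB: "A * B = B * A"
    and \<tau>: "\<And>X Y. X \<in> carrier_mat n n \<Longrightarrow> Y \<in> carrier_mat n n \<Longrightarrow> \<tau> (X * Y) = \<tau> Y * \<tau> X"
      "\<And>X. X \<in> carrier_mat n n \<Longrightarrow> \<tau> X \<in> carrier_mat n n" "\<tau> (1\<^sub>m n) = 1\<^sub>m n" "\<tau> A = B" "\<tau> B = A"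
  shows "\<tau> (C * B) * (C * B) = 1\<^sub>m n"
proof -
  note assoc = assoc_mult_mat[of _ n n _ n _ n]
  have CA: "C * A = 1\<^sub>m n" using mat_mult_left_right_inverse[OF A C AC] .
  have "C * B = C * B * (A * C)" using B C by (simp add: AC right_mult_one_mat[of _ n n])
  also have "\<dots> = C * (A * B) * C" using A B C by (simp add: assoc AB)
  also have "\<dots> = C * A * B * C" using A B C by (simp add: assoc)
  also have "\<dots> = B * C" using B by (simp add: CA left_mult_one_mat[of _ n n])
  finally have CB: "C * B = B * C" .
  have "\<tau> C * B = 1\<^sub>m n" using \<tau>(1)[OF A C] by (simp add: AC \<tau>)
  then have "A * (\<tau> C * B) * C = 1\<^sub>m n" using A by (simp add: AC right_mult_one_mat[of _ n n])
  moreover have "\<tau> (C * B) * (C * B) = A * \<tau> C * (B * C)"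
    using \<tau>(1)[OF C B] by (simp add: \<tau> CB)
  moreover have "A * \<tau> C * (B * C) = A * (\<tau> C * B) * C"
    using A B C \<tau>(2)[OF C] by (simp add: assoc)
  ultimately show ?thesis by simp
qed

text \<open>A kernel vector v satisfies S v = v. Moving the skew-adjoint S across the Hermitian form
  shows that the square of the norm of v equals its own negative, so v = 0.\<close>

lemma skew_adjoint_invertible:
  fixes S :: "'a::{conjugatable_ordered_field, real_normed_field} mat"
  assumes S: "S \<in> carrier_mat n n" and skew: "mat_adjoint S = - S"
  obtains C where "C \<in> carrier_mat n n" "(1\<^sub>m n - S) * C = 1\<^sub>m n"
proof -
  let ?A = "1\<^sub>m n - S"
  have A: "?A \<in> carrier_mat n n" using S by auto
  have "Determinant.det ?A \<noteq> 0"
  proof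
    assume "Determinant.det ?A = 0"
    then obtain v where v: "v \<in> carrier_vec n" "v \<noteq> 0\<^sub>v n" "?A *\<^sub>v v = 0\<^sub>v n"
      using det_0_iff_vec_prod_zero[OF A] by blast
    have Sv: "(\<Sum>j<n. S $$ (i, j) * v $ j) = v $ i" if "i < n" for i
    proof -
      have "0 = (?A *\<^sub>v v) $ i" using v(3) that by simp
      also have "\<dots> = (\<Sum>j<n. ?A $$ (i, j) * v $ j)"
        using S v(1) that by (simp add: scalar_prod_def atLeast0LessThan)
      also have "\<dots> = (\<Sum>j<n. (if j = i then v $ j else 0) - S $$ (i, j) * v $ j)"
        using S that by (intro sum.cong) (auto simp: left_diff_distrib)
      also have "\<dots> = v $ i - (\<Sum>j<n. S $$ (i, j) * v $ j)"
        using that by (simp add: sum_subtractf)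
      finally show ?thesis by simp
    qed
    have Sc: "conjugate (S $$ (i, j)) = - S $$ (j, i)" if "i < n" "j < n" for i j
      using arg_cong[OF skew, of "\<lambda>M. M $$ (j, i)"] S that by simp
    define h where "h = (\<Sum>i<n. v $ i * conjugate (v $ i))"
    have "h = (\<Sum>i<n. v $ i * conjugate (\<Sum>j<n. S $$ (i, j) * v $ j))"
      using Sv by (simp add: h_def)
    also have "\<dots> = (\<Sum>i<n. \<Sum>j<n. - (v $ i * S $$ (j, i) * conjugate (v $ j)))"
      by (simp add: sum_conjugate conjugate_dist_mul sum_distrib_left Sc mult.assoc)
    also have "\<dots> = (\<Sum>j<n. \<Sum>i<n. - (v $ i * S $$ (j, i) * conjugate (v $ j)))"
      by (rule sum.swap)
    also have "\<dots> = - (\<Sum>j<n. (\<Sum>i<n. S $$ (j, i) * v $ i) * conjugate (v $ j))"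
      unfolding sum_distrib_right sum_negf by (simp add: ac_simps)
    also have "\<dots> = - h" using Sv by (simp add: h_def)
    finally have "2 * h = 0" by simp
    then have "h = 0" by simp
    moreover have "v \<bullet>c v = h"
      using v(1) by (simp add: h_def scalar_prod_def atLeast0LessThan)
    ultimately show False using conjugate_square_eq_0_vec[OF v(1)] v(2) by simp
  qed
  then have "?A \<in> Units (ring_mat TYPE('a) n ())" by (rule det_non_zero_imp_unit[OF A])
  then show ?thesis using that by (auto simp: Units_def ring_mat_def)
qed

text \<open>The Cayley transform needs skew-adjoint X, both for the invertibility of 1 - S and for
  unitarity. \<open>skew_decomposition\<close> reaches all other matrices with sharp X = -X from
  these.\<close>

locale unitary_matrix_model = matrix_model G N J \<sigma> \<mu>
  for G :: "'a::{real_normed_field, banach, second_countable_topology, conjugatable_ordered_field} mat monoid"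
    and N J \<sigma> \<mu> +
  assumes conj_of_real: "conjugate (of_real t :: 'a) = of_real t"
    and carrierI: "A \<in> carrier_mat N N \<Longrightarrow> mat_adjoint A * A = 1\<^sub>m N \<Longrightarrow> sharp J A * A = 1\<^sub>m N \<Longrightarrow> A \<in> carrier G"
    and skew_decomposition: "X \<in> carrier_mat N N \<Longrightarrow> sharp J X = - X \<Longrightarrow>
      \<exists>c1 X1 c2 X2. X1 \<in> carrier_mat N N \<and> mat_adjoint X1 = - X1 \<and> sharp J X1 = - X1 \<and>
        X2 \<in> carrier_mat N N \<and> mat_adjoint X2 = - X2 \<and> sharp J X2 = - X2 \<and>
        (\<forall>p<N. \<forall>q<N. X $$ (p, q) = c1 * X1 $$ (p, q) + c2 * X2 $$ (p, q))"
begin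

lemma sharp_dim [simp]:
  assumes "A \<in> carrier_mat N N"
  shows "dim_row (sharp J A) = N" "dim_col (sharp J A) = N"
  using carrier_matD[OF sharp_carrier[OF assms]] by auto

lemma sharp_one: "sharp J (1\<^sub>m N) = 1\<^sub>m N"
  using J(1,2) by (simp add: sharp_def right_mult_one_mat[of _ N N])

lemma sharp_diff:
  assumes "A \<in> carrier_mat N N" "B \<in> carrier_mat N N"
  shows "sharp J (A - B) = sharp J A - sharp J B"
proof (rule eq_matI)
  fix i j assume "i < dim_row (sharp J A - sharp J B)" "j < dim_col (sharp J A - sharp J B)"
  then have ij: "i < N" "j < N" using sharp_carrier[OF assms(2)] by auto
  then show "sharp J (A - B) $$ (i, j) = (sharp J A - sharp J B) $$ (i, j)"
    using assms sharp_carrier[OF assms(1)] sharp_carrier[OF assms(2)]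
    by (simp add: sharp_index minus_carrier_mat[OF assms(2)] sum_subtractf left_diff_distrib right_diff_distrib)
qed (use sharp_carrier[OF assms(2)] sharp_carrier[OF minus_carrier_mat[OF assms(2)]] in auto)

lemma sharp_smult:
  assumes "A \<in> carrier_mat N N"
  shows "sharp J (c \<cdot>\<^sub>m A) = c \<cdot>\<^sub>m sharp J A"
proof (rule eq_matI)
  fix i j assume "i < dim_row (c \<cdot>\<^sub>m sharp J A)" "j < dim_col (c \<cdot>\<^sub>m sharp J A)"
  then have ij: "i < N" "j < N" using sharp_carrier[OF assms] by auto
  then show "sharp J (c \<cdot>\<^sub>m A) $$ (i, j) = (c \<cdot>\<^sub>m sharp J A) $$ (i, j)"
    using assms sharp_carrier[OF assms] smult_carrier_mat[OF assms, of c]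
    by (simp add: sharp_index sum_distrib_left ac_simps)
qed (use sharp_carrier[OF assms] sharp_carrier[OF smult_carrier_mat[OF assms, of c]] in auto)

text \<open>J and its transpose both square to \<sigma>, so applying \<open>sharp\<close> twice
  multiplies by \<sigma>^2.\<close>

lemma sharp_sharp:
  assumes Y: "Y \<in> carrier_mat N N"
  shows "sharp J (sharp J Y) = Y"
proof -
  have Jt: "J\<^sup>T \<in> carrier_mat N N" using J(1) by simp
  have JJ: "J = \<sigma> \<cdot>\<^sub>m J\<^sup>T"
    using J(1) by (intro eq_matI) (auto intro: J(3))
  have 1: "J * J = \<sigma> \<cdot>\<^sub>m 1\<^sub>m N"
    by (subst (1) JJ) (simp add: mult_smult_assoc_mat[OF Jt J(1)] J(2))
  have "(\<sigma> \<cdot>\<^sub>m 1\<^sub>m N)\<^sup>T = \<sigma> \<cdot>\<^sub>m 1\<^sub>m N" by (intro eq_matI) auto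
  then have 2: "J\<^sup>T * J\<^sup>T = \<sigma> \<cdot>\<^sub>m 1\<^sub>m N"
    using arg_cong[OF 1, of transpose_mat] J(1) by (simp add: transpose_mult[of _ N N])
  have "(J\<^sup>T * Y\<^sup>T * J)\<^sup>T = J\<^sup>T * (J\<^sup>T * Y\<^sup>T)\<^sup>T"
    using Y J(1) Jt by (intro transpose_mult[of _ N N]) auto
  also have "(J\<^sup>T * Y\<^sup>T)\<^sup>T = Y * J"
    using Y J(1) Jt by (simp add: transpose_mult[of _ N N])
  finally have "sharp J (sharp J Y) = J\<^sup>T * (J\<^sup>T * Y * J) * J"
    using Y J(1) Jt by (simp add: sharp_def mat_assoc)
  also have "\<dots> = (J\<^sup>T * J\<^sup>T) * Y * (J * J)"
    using Y J(1) Jt by (simp add: mat_assoc mult_carrier_mat[of _ N N _ N])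
  also have "\<dots> = (\<sigma> * \<sigma>) \<cdot>\<^sub>m Y"
    unfolding 1 2 using Y by (intro eq_matI) (auto simp: mult_smult_assoc_mat[of _ N N _ N] mult_smult_distrib[of _ N N _ N]
        left_mult_one_mat[of _ N N] right_mult_one_mat[of _ N N])
  also have "\<dots> = Y" using Y by (intro eq_matI) (auto simp: sign_square)
  finally show ?thesis .
qed

text \<open>R is (1 - S)^{-1} (1 + S) with S = s X. It is recorded through R - 1 = S (1 + R),
  because this identity together with the bound on the entries of R yields the whole expansion in
  s.\<close>

lemma cayley_transform:
  assumes X: "X \<in> carrier_mat N N" "mat_adjoint X = - X" "sharp J X = - X"
  obtains R where "R \<in> carrier G"
    "\<And>a b. a < N \<Longrightarrow> b < N \<Longrightarrow> R $$ (a, b) - 1\<^sub>m N $$ (a, b) =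
       of_real s * (\<Sum>p<N. X $$ (a, p) * (1\<^sub>m N $$ (p, b) + R $$ (p, b)))"
proof -
  define S where "S = of_real s \<cdot>\<^sub>m X"
  have S: "S \<in> carrier_mat N N" using X by (simp add: S_def)
  have Sskew: "mat_adjoint S = - S"
  proof (rule eq_matI)
    fix i j assume "i < dim_row (- S)" "j < dim_col (- S)"
    then have ij: "i < N" "j < N" using S by auto
    then show "mat_adjoint S $$ (i, j) = (- S) $$ (i, j)"
      using arg_cong[OF X(2), of "\<lambda>M. M $$ (i, j)"] X(1)
      by (simp add: S_def conjugate_dist_mul conj_of_real)
  qed (use S in auto)
  have Ssharp: "sharp J S = - S"
    using X by (simp add: S_def sharp_smult) (intro eq_matI, auto)
  let ?A = "1\<^sub>m N - S" and ?B = "1\<^sub>m N + S"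
  have AB: "?A \<in> carrier_mat N N" "?B \<in> carrier_mat N N" using S by auto
  obtain C where C: "C \<in> carrier_mat N N" "?A * C = 1\<^sub>m N"
    using skew_adjoint_invertible[OF S Sskew] .
  have comm: "?A * ?B = ?B * ?A"
    using S by (simp add: minus_mult_distrib_mat[of _ N N _ _ N] add_mult_distrib_mat[of _ N N _ _ N]
        mult_minus_distrib_mat[of _ N N _ N] mult_add_distrib_mat[of _ N N _ N])
  have B': "?B = 1\<^sub>m N - (- S)" using S by (intro eq_matI) auto
  have S': "- S \<in> carrier_mat N N" using S by simp
  have "sharp J ?A = 1\<^sub>m N - (- S)"
    by (simp only: sharp_diff[OF one_carrier_mat S] sharp_one Ssharp)
  then have sh1: "sharp J ?A = ?B" by (simp only: B')
  have "sharp J (- S) = S" using sharp_sharp[OF S] by (simp only: Ssharp)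
  then have sh2: "sharp J ?B = ?A"
    by (simp only: B' sharp_diff[OF one_carrier_mat S'] sharp_one)
  have one_adj: "mat_adjoint (1\<^sub>m N :: 'a mat) = 1\<^sub>m N"
    using conj_of_real[of 1] by (intro eq_matI) auto
  have Sc: "conjugate (S $$ (j, i)) = - S $$ (i, j)" if "i < N" "j < N" for i j
    using arg_cong[OF Sskew, of "\<lambda>M. M $$ (i, j)"] S that by simp
  have adj: "mat_adjoint ?A = ?B" "mat_adjoint ?B = ?A"
    using S Sc conj_of_real[of 1]
    by (intro eq_matI; simp add: conjugate_dist_add conjugate_neg diff_conv_add_uminus del: add_uminus_conv_diff)+
  define R where "R = C * ?B"
  have R: "R \<in> carrier_mat N N" using C AB by (simp add: R_def)
  have "R \<in> carrier G"
  proof (rule carrierI[OF R])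
    show "mat_adjoint R * R = 1\<^sub>m N"
      unfolding R_def
      by (rule cayley_isometry[OF AB C(1,2) comm]) (auto simp: mat_adjoint_mult mat_adjoint_carrier one_adj adj)
    show "sharp J R * R = 1\<^sub>m N"
      unfolding R_def
      by (rule cayley_isometry[OF AB C(1,2) comm]) (auto simp: sharp_mult sharp_one sh1 sh2)
  qed
  moreover have "R $$ (a, b) - 1\<^sub>m N $$ (a, b) = of_real s * (\<Sum>p<N. X $$ (a, p) * (1\<^sub>m N $$ (p, b) + R $$ (p, b)))"
    if ab: "a < N" "b < N" for a b
  proof -
    have "?A * R = ?B" using C AB by (simp add: R_def mat_assoc[symmetric] left_mult_one_mat[of _ N N])
    moreover have "?A * R = R - S * R"
      using S R by (simp add: minus_mult_distrib_mat[of _ N N _ _ N] left_mult_one_mat[of _ N N])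
    ultimately have "(R - S * R) $$ (a, b) = ?B $$ (a, b)" by simp
    moreover have "S * R \<in> carrier_mat N N" using S R by simp
    ultimately have "R $$ (a, b) - (S * R) $$ (a, b) = 1\<^sub>m N $$ (a, b) + S $$ (a, b)"
      using S R ab by (simp del: index_mult_mat(1) index_one_mat(1))
    then have "R $$ (a, b) - 1\<^sub>m N $$ (a, b) = S $$ (a, b) + (S * R) $$ (a, b)"
      by (simp add: diff_eq_eq ac_simps del: index_mult_mat(1) index_one_mat(1))
    also have "(S * R) $$ (a, b) = (\<Sum>p<N. S $$ (a, p) * R $$ (p, b))"
      using S R ab by (intro mat_mult_index[of _ N N _ N]) auto
    also have "S $$ (a, b) = (\<Sum>p<N. S $$ (a, p) * 1\<^sub>m N $$ (p, b))"
      using mat_mult_index[OF S one_carrier_mat ab] by (simp only: right_mult_one_mat[OF S])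
    finally have "R $$ (a, b) - 1\<^sub>m N $$ (a, b) =
        (\<Sum>p<N. S $$ (a, p) * 1\<^sub>m N $$ (p, b)) + (\<Sum>p<N. S $$ (a, p) * R $$ (p, b))" .
    also have "\<dots> = (\<Sum>p<N. S $$ (a, p) * (1\<^sub>m N $$ (p, b) + R $$ (p, b)))"
      by (simp only: sum.distrib distrib_left)
    also have "\<dots> = of_real s * (\<Sum>p<N. X $$ (a, p) * (1\<^sub>m N $$ (p, b) + R $$ (p, b)))"
      unfolding sum_distrib_left using X(1) ab by (intro sum.cong refl) (simp add: S_def mult.assoc)
    finally show ?thesis .
  qed
  ultimately show ?thesis by (rule that)
qed

text \<open>Taking s = t / 2 makes the velocity X, as 1 + R is 2 to leading order. Using the
  identity twice, R - 1 - t X = (t / 2) X (R - 1) = (t / 2)^2 X^2 (1 + R), and the entries of 1 + R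
  are at most 2 in norm. R is chosen separately for each t; its dependence on t is controlled by the
  identity.\<close>

lemma path_along_exists:
  assumes X: "X \<in> carrier_mat N N" "mat_adjoint X = - X" "sharp J X = - X"
  obtains R where "path_along X R"
proof -
  have "\<forall>t :: real. \<exists>R. R \<in> carrier G \<and> (\<forall>a<N. \<forall>b<N. R $$ (a, b) - 1\<^sub>m N $$ (a, b) =
       of_real (t / 2) * (\<Sum>p<N. X $$ (a, p) * (1\<^sub>m N $$ (p, b) + R $$ (p, b))))"
  proof
    fix t :: real
    show "\<exists>R. R \<in> carrier G \<and> (\<forall>a<N. \<forall>b<N. R $$ (a, b) - 1\<^sub>m N $$ (a, b) =
       of_real (t / 2) * (\<Sum>p<N. X $$ (a, p) * (1\<^sub>m N $$ (p, b) + R $$ (p, b))))"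
      by (rule cayley_transform[OF X, of "t / 2"]) blast
  qed
  from choice[OF this] obtain R where
    *: "\<forall>t :: real. R t \<in> carrier G \<and> (\<forall>a<N. \<forall>b<N. R t $$ (a, b) - 1\<^sub>m N $$ (a, b) =
       of_real (t / 2) * (\<Sum>p<N. X $$ (a, p) * (1\<^sub>m N $$ (p, b) + R t $$ (p, b))))" ..
  have R: "R t \<in> carrier G" for t using * by blast
  have eq: "R t $$ (a, b) - 1\<^sub>m N $$ (a, b) =
       of_real (t / 2) * (\<Sum>p<N. X $$ (a, p) * (1\<^sub>m N $$ (p, b) + R t $$ (p, b)))"
    if "a < N" "b < N" for t a b
    using * that by blast
  have "R 0 = 1\<^sub>m N"
    using eq[of _ _ 0] carrier_G_mat[OF R[of 0]]
    by (intro eq_matI) (simp_all del: index_one_mat(1))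
  moreover have "\<exists>B. \<forall>t. \<bar>t\<bar> \<le> 1 \<longrightarrow>
      norm (R t $$ (a, b) - 1\<^sub>m N $$ (a, b) - of_real t * X $$ (a, b)) \<le> B * t\<^sup>2" if ab: "a < N" "b < N" for a b
  proof (intro exI allI impI)
    fix t :: real
    let ?s = "of_real (t / 2) :: 'a"
    let ?D = "\<lambda>p. R t $$ (p, b) - 1\<^sub>m N $$ (p, b)"
    let ?U = "\<Sum>p<N. X $$ (a, p) * (1\<^sub>m N $$ (p, b) + R t $$ (p, b))"
    let ?V = "\<Sum>p<N. X $$ (a, p) * 1\<^sub>m N $$ (p, b)"
    have "X $$ (a, b) = ?V"
      using mat_mult_index[OF X(1) one_carrier_mat ab] by (simp only: right_mult_one_mat[OF X(1)])
    then have "of_real t * X $$ (a, b) = ?s * (2 * ?V)" by simp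
    then have "?D a - of_real t * X $$ (a, b) = ?s * (?U - 2 * ?V)"
      by (simp only: eq[OF ab] right_diff_distrib)
    also have "?U - 2 * ?V = (\<Sum>p<N. X $$ (a, p) * ?D p)"
      by (simp only: mult_2 distrib_left right_diff_distrib sum.distrib sum_subtractf) simp
    \<comment> \<open>The second use of the identity supplies the second factor t / 2.\<close>
    also have "(\<Sum>p<N. X $$ (a, p) * ?D p) = (\<Sum>p<N. X $$ (a, p) * (?s * (\<Sum>q<N. X $$ (p, q) * (1\<^sub>m N $$ (q, b) + R t $$ (q, b)))))"
      using ab by (intro arg_cong2[of _ _ _ _ "(*)"] sum.cong refl eq) auto
    finally have "norm (?D a - of_real t * X $$ (a, b)) =
       \<bar>t / 2\<bar> * norm (\<Sum>p<N. X $$ (a, p) * (?s * (\<Sum>q<N. X $$ (p, q) * (1\<^sub>m N $$ (q, b) + R t $$ (q, b)))))"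
      by (simp only: norm_mult norm_of_real)
    also have "\<dots> \<le> \<bar>t / 2\<bar> * (\<Sum>p<N. norm (X $$ (a, p)) * (\<bar>t / 2\<bar> * (\<Sum>q<N. norm (X $$ (p, q)) * 2)))"
    proof (intro mult_left_mono sum_norm_le)
      fix p assume p: "p \<in> {..<N}"
      have "norm (\<Sum>q<N. X $$ (p, q) * (1\<^sub>m N $$ (q, b) + R t $$ (q, b))) \<le> (\<Sum>q<N. norm (X $$ (p, q)) * 2)"
      proof (intro sum_norm_le)
        fix q assume q: "q \<in> {..<N}"
        have "norm (1\<^sub>m N $$ (q, b) + R t $$ (q, b)) \<le> 1 + 1"
          using q ab entry_bound[OF R, of q b] by (intro norm_triangle_mono) auto
        then show "norm (X $$ (p, q) * (1\<^sub>m N $$ (q, b) + R t $$ (q, b))) \<le> norm (X $$ (p, q)) * 2"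
          unfolding norm_mult by (intro mult_left_mono) auto
      qed
      then show "norm (X $$ (a, p) * (?s * (\<Sum>q<N. X $$ (p, q) * (1\<^sub>m N $$ (q, b) + R t $$ (q, b))))) \<le>
         norm (X $$ (a, p)) * (\<bar>t / 2\<bar> * (\<Sum>q<N. norm (X $$ (p, q)) * 2))"
        unfolding norm_mult norm_of_real by (intro mult_left_mono) auto
    qed simp
    also have "\<dots> = (\<Sum>p<N. norm (X $$ (a, p)) * (\<Sum>q<N. norm (X $$ (p, q)) * 2)) / 4 * t\<^sup>2"
    proof -
      have t2: "t\<^sup>2 = \<bar>t\<bar> * \<bar>t\<bar>" by (simp add: power2_eq_square)
      show ?thesis unfolding t2
        by (simp add: sum_distrib_left sum_divide_distrib ac_simps del: abs_mult_self_eq)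
    qed
    finally show "norm (?D a - of_real t * X $$ (a, b)) \<le>
      (\<Sum>p<N. norm (X $$ (a, p)) * (\<Sum>q<N. norm (X $$ (p, q)) * 2)) / 4 * t\<^sup>2" .
  qed
  ultimately have "path_along X R" using X R unfolding path_along_def by blast
  then show ?thesis by (rule that)
qed

sublocale tangent_matrix_model G N J \<sigma> \<mu>
proof
  fix Y :: "'a mat" assume Y: "Y \<in> carrier_mat N N"
  let ?X = "Y - sharp J Y"
  have X: "?X \<in> carrier_mat N N" using minus_carrier_mat[OF sharp_carrier[OF Y]] .
  have "sharp J ?X = - ?X"
    using sharp_carrier[OF Y] Y by (simp add: sharp_diff sharp_sharp) (intro eq_matI, auto)
  then obtain c1 X1 c2 X2 where
    X1: "X1 \<in> carrier_mat N N" "mat_adjoint X1 = - X1" "sharp J X1 = - X1" and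
    X2: "X2 \<in> carrier_mat N N" "mat_adjoint X2 = - X2" "sharp J X2 = - X2" and
    eq: "\<forall>p<N. \<forall>q<N. ?X $$ (p, q) = c1 * X1 $$ (p, q) + c2 * X2 $$ (p, q)"
    using skew_decomposition[OF X] by blast
  obtain R1 R2 where "path_along X1 R1" "path_along X2 R2"
    using path_along_exists X1 X2 by metis
  moreover have "\<forall>p<N. \<forall>q<N. Y $$ (p, q) - sharp J Y $$ (p, q) = c1 * X1 $$ (p, q) + c2 * X2 $$ (p, q)"
    using eq sharp_carrier[OF Y] Y by simp
  ultimately show "\<exists>c1 X1 R1 c2 X2 R2. path_along X1 R1 \<and> path_along X2 R2 \<and>
    (\<forall>p<N. \<forall>q<N. Y $$ (p, q) - sharp J Y $$ (p, q) = c1 * X1 $$ (p, q) + c2 * X2 $$ (p, q))"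
    by blast
qed

end

section \<open>The orthogonal and the symplectic model\<close>

lemma unitary_entry_bound:
  fixes A :: "'a::{real_normed_field, conjugatable_field} mat"
  assumes A: "A \<in> carrier_mat n n" "mat_adjoint A * A = 1\<^sub>m n"
    and norm: "\<And>x :: 'a. conjugate x * x = of_real ((norm x)\<^sup>2)"
    and ij: "i < n" "j < n"
  shows "norm (A $$ (i, j)) \<le> 1"
proof -
  have "(\<Sum>k<n. conjugate (A $$ (k, j)) * A $$ (k, j)) = (mat_adjoint A * A) $$ (j, j)"
    using A(1) ij mat_adjoint_carrier[OF A(1)] by (subst mat_mult_index[of _ n n _ n]) auto
  also have "\<dots> = 1" using A(2) ij by simp
  finally have "of_real (\<Sum>k<n. (norm (A $$ (k, j)))\<^sup>2) = (of_real 1 :: 'a)"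
    by (simp add: norm)
  then have "(\<Sum>k<n. (norm (A $$ (k, j)))\<^sup>2) = 1" by (simp only: of_real_eq_iff)
  moreover have "(norm (A $$ (i, j)))\<^sup>2 \<le> (\<Sum>k<n. (norm (A $$ (k, j)))\<^sup>2)"
    using ij by (intro member_le_sum) auto
  ultimately show ?thesis using abs_square_le_1[of "norm (A $$ (i, j))"] by simp
qed

lemma mat_adjoint_real [simp]: "mat_adjoint (A :: real mat) = A\<^sup>T"
  by (intro eq_matI) auto

lemma sharp_identity:
  assumes "A \<in> carrier_mat n n"
  shows "sharp (1\<^sub>m n) A = A\<^sup>T"
  using assms by (simp add: sharp_def left_mult_one_mat[of _ n n] right_mult_one_mat[of _ n n])

lemma orthogonal_model:
  assumes "haar_probability (orthogonal_group n) \<mu>"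
  shows "unitary_matrix_model (orthogonal_group n) n (1\<^sub>m n) 1 \<mu>"
proof -
  interpret group "orthogonal_group n" by (rule group_orthogonal_group)
  have char: "A \<in> carrier (orthogonal_group n) \<longleftrightarrow> A \<in> carrier_mat n n \<and> A\<^sup>T * A = 1\<^sub>m n" for A
    by (simp add: orthogonal_group_def)
  show ?thesis
  proof
    fix A i j assume "A \<in> carrier (orthogonal_group n)" "i < n" "j < n"
    then show "norm (A $$ (i, j)) \<le> 1"
      by (intro unitary_entry_bound[of A n]) (auto simp: char power2_eq_square)
  next
    fix X :: "real mat" assume "X \<in> carrier_mat n n" "sharp (1\<^sub>m n) X = - X"
    \<comment> \<open>Over the reals adjoint and \<open>sharp\<close> coincide, so X is already
      skew-adjoint and serves as its own decomposition.\<close>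
    then show "\<exists>c1 X1 c2 X2. X1 \<in> carrier_mat n n \<and> mat_adjoint X1 = - X1 \<and> sharp (1\<^sub>m n) X1 = - X1 \<and>
        X2 \<in> carrier_mat n n \<and> mat_adjoint X2 = - X2 \<and> sharp (1\<^sub>m n) X2 = - X2 \<and>
        (\<forall>p<n. \<forall>q<n. X $$ (p, q) = c1 * X1 $$ (p, q) + c2 * X2 $$ (p, q))"
      by (intro exI[of _ 1] exI[of _ X] exI[of _ 0]) (auto simp: sharp_identity)
  qed (use assms in \<open>auto simp: char sharp_identity orthogonal_group_def left_mult_one_mat[of _ n n]\<close>)
qed

lemma symplectic_form_index:
  "i < 2 * n \<Longrightarrow> j < 2 * n \<Longrightarrow>
    symplectic_form n $$ (i, j) = (if j = i + n then 1 else if i = j + n then - 1 else 0)"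
  by (auto simp: symplectic_form_def)

lemma symplectic_form_orthogonal: "(symplectic_form n)\<^sup>T * symplectic_form n = 1\<^sub>m (2 * n)"
proof -
  have z: "- 0\<^sub>m n n = (0\<^sub>m n n :: complex mat)" by (intro eq_matI) auto
  have "(symplectic_form n)\<^sup>T = four_block_mat (0\<^sub>m n n) (- 1\<^sub>m n) (1\<^sub>m n) (0\<^sub>m n n)"
    unfolding symplectic_form_def
    by (subst transpose_four_block_mat[of _ n n _ n _ n]) (auto simp: transpose_uminus)
  then have "(symplectic_form n)\<^sup>T * symplectic_form n =
      four_block_mat (0\<^sub>m n n) (- 1\<^sub>m n) (1\<^sub>m n) (0\<^sub>m n n) *
      four_block_mat (0\<^sub>m n n) (1\<^sub>m n) (- 1\<^sub>m n) (0\<^sub>m n n)"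
    by (simp add: symplectic_form_def)
  also have "\<dots> = four_block_mat (1\<^sub>m n) (0\<^sub>m n n) (0\<^sub>m n n) (1\<^sub>m n)"
    by (subst mult_four_block_mat[of _ n n _ n _ n]) (auto simp: z)
  finally show ?thesis unfolding mult_2 by simp
qed

lemma symplectic_model:
  assumes "haar_probability (symplectic_group n) \<mu>"
  shows "unitary_matrix_model (symplectic_group n) (2 * n) (symplectic_form n) (- 1) \<mu>"
proof -
  interpret group "symplectic_group n" by (rule group_symplectic_group)
  let ?m = "2 * n" and ?J = "symplectic_form n"
  note J = symplectic_form_carrier[of n]
  note assoc = assoc_mult_mat[of _ ?m ?m _ ?m _ ?m]
  have JJ: "?J * ?J\<^sup>T = 1\<^sub>m ?m"
    using mat_mult_left_right_inverse[OF _ J symplectic_form_orthogonal] J by simp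
  \<comment> \<open>Invariance of the form and sharp(A) A = 1 differ by multiplication with J or its
    transpose, which are inverse to each other.\<close>
  have char: "A \<in> carrier (symplectic_group n) \<longleftrightarrow>
      A \<in> carrier_mat ?m ?m \<and> mat_adjoint A * A = 1\<^sub>m ?m \<and> sharp ?J A * A = 1\<^sub>m ?m" for A
  proof -
    have "A\<^sup>T * ?J * A = ?J \<longleftrightarrow> sharp ?J A * A = 1\<^sub>m ?m" if A: "A \<in> carrier_mat ?m ?m"
    proof
      assume "A\<^sup>T * ?J * A = ?J"
      moreover have "sharp ?J A * A = ?J\<^sup>T * (A\<^sup>T * ?J * A)"
        using A J by (simp add: sharp_def assoc mult_carrier_mat[of _ ?m ?m _ ?m])
      ultimately show "sharp ?J A * A = 1\<^sub>m ?m" by (simp add: symplectic_form_orthogonal)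
    next
      assume *: "sharp ?J A * A = 1\<^sub>m ?m"
      have "?J * (sharp ?J A * A) = (?J * ?J\<^sup>T) * (A\<^sup>T * ?J * A)"
        using A J by (simp add: sharp_def assoc mult_carrier_mat[of _ ?m ?m _ ?m])
      then show "A\<^sup>T * ?J * A = ?J"
        using A J by (simp add: * JJ left_mult_one_mat[of _ ?m ?m] right_mult_one_mat[of _ ?m ?m]
            mult_carrier_mat[of _ ?m ?m _ ?m])
    qed
    then show ?thesis by (auto simp: symplectic_group_def)
  qed
  show ?thesis
  proof
    fix A i j assume "A \<in> carrier (symplectic_group n)" "i < ?m" "j < ?m"
    moreover have "conjugate x * x = of_real ((norm x)\<^sup>2)" for x :: complex
      using complex_norm_square[of x] by (simp only: conjugate_complex_def mult.commute)
    ultimately show "norm (A $$ (i, j)) \<le> 1"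
      by (intro unitary_entry_bound[of A ?m]) (simp_all add: char)
  next
    fix i j assume "i < ?m" "j < ?m"
    then show "?J $$ (j, i) = - 1 * ?J $$ (i, j)" by (auto simp: symplectic_form_index)
  next
    fix X :: "complex mat" assume X: "X \<in> carrier_mat ?m ?m" and skew: "sharp ?J X = - X"
    define X1 where "X1 = mat ?m ?m (\<lambda>(i, j). X $$ (i, j) - cnj (X $$ (j, i)))"
    define X2 where "X2 = mat ?m ?m (\<lambda>(i, j). \<i> * (X $$ (i, j) + cnj (X $$ (j, i))))"
    have Xc: "X1 \<in> carrier_mat ?m ?m" "X2 \<in> carrier_mat ?m ?m" by (auto simp: X1_def X2_def)
    have sharp_index: "sharp ?J A $$ (i, j) = (\<Sum>l<?m. \<Sum>k<?m. ?J $$ (k, i) * A $$ (l, k) * ?J $$ (l, j))"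
      if A: "A \<in> carrier_mat ?m ?m" and ij: "i < ?m" "j < ?m" for A i j
    proof -
      have "(?J\<^sup>T * A\<^sup>T) $$ (i, l) = (\<Sum>k<?m. ?J $$ (k, i) * A $$ (l, k))" if "l < ?m" for l
        using A ij J that by (subst mat_mult_index[of _ ?m ?m _ ?m]) auto
      moreover have "sharp ?J A $$ (i, j) = (\<Sum>l<?m. (?J\<^sup>T * A\<^sup>T) $$ (i, l) * ?J $$ (l, j))"
        unfolding sharp_def using A ij J by (intro mat_mult_index[of _ ?m ?m _ ?m]) auto
      ultimately show ?thesis by (simp add: sum_distrib_right del: index_mult_mat(1))
    qed
    have e: "(\<Sum>l<?m. \<Sum>k<?m. ?J $$ (k, i) * X $$ (l, k) * ?J $$ (l, j)) = - X $$ (i, j)"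
      if "i < ?m" "j < ?m" for i j
      using arg_cong[OF skew, of "\<lambda>M. M $$ (i, j)"] X that by (simp add: sharp_index[OF X])
    have Jr: "cnj (?J $$ (i, j)) = ?J $$ (i, j)" if "i < ?m" "j < ?m" for i j
      using that by (simp add: symplectic_form_index)
    have e': "(\<Sum>l<?m. \<Sum>k<?m. ?J $$ (k, i) * cnj (X $$ (k, l)) * ?J $$ (l, j)) = - cnj (X $$ (j, i))"
      if "i < ?m" "j < ?m" for i j
    proof -
      have "- cnj (X $$ (j, i)) = cnj (\<Sum>l<?m. \<Sum>k<?m. ?J $$ (k, j) * X $$ (l, k) * ?J $$ (l, i))"
        using e[OF that(2,1)] by simp
      also have "\<dots> = (\<Sum>l<?m. \<Sum>k<?m. ?J $$ (l, i) * cnj (X $$ (l, k)) * ?J $$ (k, j))"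
        using that Jr by (simp add: ac_simps)
      also have "\<dots> = (\<Sum>k<?m. \<Sum>l<?m. ?J $$ (l, i) * cnj (X $$ (l, k)) * ?J $$ (k, j))"
        by (rule sum.swap)
      finally show ?thesis by simp
    qed
    have Sc: "sharp ?J A \<in> carrier_mat ?m ?m" if "A \<in> carrier_mat ?m ?m" for A
      using that J by (simp add: sharp_def mult_carrier_mat[of _ ?m ?m _ ?m])
    have "sharp ?J X1 = - X1"
    proof (rule eq_matI)
      fix i j assume "i < dim_row (- X1)" "j < dim_col (- X1)"
      then have ij: "i < ?m" "j < ?m" using Xc by auto
      have "sharp ?J X1 $$ (i, j) = (\<Sum>l<?m. \<Sum>k<?m. ?J $$ (k, i) * X $$ (l, k) * ?J $$ (l, j)) -
          (\<Sum>l<?m. \<Sum>k<?m. ?J $$ (k, i) * cnj (X $$ (k, l)) * ?J $$ (l, j))"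
        unfolding sharp_index[OF Xc(1) ij] by (simp add: X1_def algebra_simps flip: sum_subtractf)
      then show "sharp ?J X1 $$ (i, j) = (- X1) $$ (i, j)"
        using ij by (simp add: e e' X1_def)
    qed (use Sc[OF Xc(1)] Xc in auto)
    moreover have "sharp ?J X2 = - X2"
    proof (rule eq_matI)
      fix i j assume "i < dim_row (- X2)" "j < dim_col (- X2)"
      then have ij: "i < ?m" "j < ?m" using Xc by auto
      have "sharp ?J X2 $$ (i, j) = \<i> * ((\<Sum>l<?m. \<Sum>k<?m. ?J $$ (k, i) * X $$ (l, k) * ?J $$ (l, j)) +
          (\<Sum>l<?m. \<Sum>k<?m. ?J $$ (k, i) * cnj (X $$ (k, l)) * ?J $$ (l, j)))"
        unfolding sharp_index[OF Xc(2) ij] sum.distrib[symmetric] sum_distrib_left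
        by (intro sum.cong refl) (simp add: X2_def algebra_simps)
      then show "sharp ?J X2 $$ (i, j) = (- X2) $$ (i, j)"
        using ij unfolding e[OF ij] e'[OF ij] by (simp add: X2_def algebra_simps)
    qed (use Sc[OF Xc(2)] Xc in auto)
    moreover have "mat_adjoint X1 = - X1" "mat_adjoint X2 = - X2"
      by (intro eq_matI; simp add: X1_def X2_def algebra_simps)+
    moreover have "\<forall>p<?m. \<forall>q<?m. X $$ (p, q) = (1 / 2) * X1 $$ (p, q) + (- \<i> / 2) * X2 $$ (p, q)"
      by (auto simp: X1_def X2_def algebra_simps)
    ultimately show "\<exists>c1 X1 c2 X2. X1 \<in> carrier_mat ?m ?m \<and> mat_adjoint X1 = - X1 \<and> sharp ?J X1 = - X1 \<and>
        X2 \<in> carrier_mat ?m ?m \<and> mat_adjoint X2 = - X2 \<and> sharp ?J X2 = - X2 \<and>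
        (\<forall>p<?m. \<forall>q<?m. X $$ (p, q) = c1 * X1 $$ (p, q) + c2 * X2 $$ (p, q))"
      using Xc by blast
  qed (use assms J in \<open>auto simp: char symplectic_form_orthogonal\<close>, simp_all add: symplectic_group_def)
qed

section \<open>Powers of primitive elements\<close>

lemma inv_word_word_pow: "inv_word (word_pow u n) = word_pow (inv_word u) n"
proof (induction n)
  case (Suc n)
  have "word_pow v n @ v = v @ word_pow v n" for v :: fg_word
    by (induction n) auto
  with Suc show ?case by simp
qed simp

lemma prim_word_inv_word:
  assumes "prim_word w" shows "prim_word (inv_word w)"
  unfolding prim_word_def
proof (intro conjI allI impI notI)
  show "inv_word w = [] \<Longrightarrow> False" using assms by (simp add: prim_word_def)
  fix n zs assume n: "1 < n" "word_pow zs n = inv_word w"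
  then have "word_pow (inv_word zs) n = w" by (simp flip: inv_word_word_pow)
  then show False using assms n(1) by (auto simp: prim_word_def)
qed

lemma free_group_mult: "x \<otimes>\<^bsub>free_group r\<^esub> y = foldr cons_reduce x y"
  and free_group_one: "\<one>\<^bsub>free_group r\<^esub> = []"
  and free_group_carrier: "x \<in> carrier (free_group r) \<longleftrightarrow> reduced_word x \<and> word_in r x"
  by (simp_all add: free_group_def word_in_def)

lemma foldr_red_red: "foldr cons_reduce (red u) (red v) = red (u @ v)"
  by (simp add: foldr_cons_reduce_red red_append)

lemma free_group_conj_pow:
  assumes "word_in r h" "word_in r z"
  shows "red (h @ z @ inv_word h) [^]\<^bsub>free_group r\<^esub> n = red (h @ word_pow z n @ inv_word h)"
proof (induction n)
  case 0
  interpret group "free_group r" by (rule group_free_group)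
  show ?case by (simp add: free_group_one)
next
  case (Suc n)
  interpret group "free_group r" by (rule group_free_group)
  have comm: "word_pow z n @ z = z @ word_pow z n" by (induction n) auto
  have "red (h @ z @ inv_word h) [^]\<^bsub>free_group r\<^esub> Suc n =
      foldr cons_reduce (red (h @ word_pow z n @ inv_word h)) (red (h @ z @ inv_word h))"
    by (simp add: nat_pow_Suc Suc free_group_mult)
  also have "\<dots> = red ((h @ word_pow z n @ inv_word h) @ (h @ z @ inv_word h))"
    by (rule foldr_red_red)
  also have "\<dots> = red ((h @ word_pow z n) @ (inv_word h @ h) @ (z @ inv_word h))" by simp
  also have "\<dots> = red ((h @ word_pow z n) @ [] @ (z @ inv_word h))"
    by (intro red_append_cong refl) simp
  also have "\<dots> = red (h @ word_pow z (Suc n) @ inv_word h)"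
  proof -
    have "word_pow z (Suc n) = word_pow z n @ z" using comm by simp
    then show ?thesis by (simp only: append_assoc append_Nil)
  qed
  finally show ?case .
qed

lemma red_conj_cancel:
  assumes "red (h @ x @ inv_word h) = red (h @ y @ inv_word h)"
  shows "red x = red y"
proof -
  have *: "red (inv_word h @ (h @ z @ inv_word h) @ h) = red z" for z
  proof -
    have "red (inv_word h @ (h @ z @ inv_word h) @ h) = red ((inv_word h @ h) @ z @ (inv_word h @ h))" by simp
    also have "\<dots> = red ([] @ z @ [])" by (intro red_append_cong refl) simp_all
    finally show ?thesis by simp
  qed
  have "red (inv_word h @ (h @ x @ inv_word h) @ h) = red (inv_word h @ (h @ y @ inv_word h) @ h)"
    by (rule red_append_cong[OF refl red_append_cong[OF assms refl]])
  then show ?thesis unfolding * .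
qed

text \<open>This links primitivity in the group with primitivity as a string: if x is the n-fold
  repetition of \<open>zs\<close>, then u is the n-th power of the conjugate of \<open>zs\<close> by
  h. As a factor of a reduced word, \<open>zs\<close> is reduced.\<close>

lemma not_proper_power_prim:
  assumes u: "\<not> proper_power (free_group r) u" "u = red (h @ x @ inv_word h)"
    and x: "reduced_word x" "x \<noteq> []" "word_in r x" "word_in r h"
  shows "prim_word x"
  unfolding prim_word_def
proof (intro conjI allI impI notI)
  show "x = [] \<Longrightarrow> False" using x by simp
  fix n zs assume n: "1 < n" and zs: "word_pow zs n = x"
  obtain m where m: "n = Suc m" "m \<ge> 1" using n by (cases n) auto
  have zs': "zs @ word_pow zs m = x" using zs m by simp
  then have z: "word_in r zs" "reduced_word zs" using x(1,3) by (auto simp: reduced_append)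
  let ?y = "red (h @ zs @ inv_word h)"
  have "?y \<in> carrier (free_group r)"
    using x z by (auto simp: free_group_carrier intro!: word_in_red)
  moreover have "u = ?y [^]\<^bsub>free_group r\<^esub> n"
    unfolding free_group_conj_pow[OF x(4) z(1)] using u(2) zs by simp
  \<comment> \<open>A proper power must be a power of another element. If y were u, cancelling h
    would give zs = x, and the remaining copies of \<open>zs\<close> would have to be empty.\<close>
  moreover have "?y \<noteq> u"
  proof
    assume "?y = u"
    then have "red zs = red x" unfolding u(2) by (rule red_conj_cancel)
    then have "zs = x" using z x by (simp add: red_reduced)
    then have "word_pow zs m = []" using zs' by simp
    then have "zs = []" using m by (cases m) auto
    then show False using \<open>zs = x\<close> x by simp
  qed
  ultimately have "proper_power (free_group r) u"
    using n unfolding proper_power_def by (intro bexI[of _ ?y] conjI exI[of _ n]) auto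
  then show False using u by simp
qed

text \<open>Replacing u by a conjugate, and possibly by its inverse, gives a string satisfying all
  assumptions of the limit theorem. The conjugator h and the choice of sign are recorded because
  traces ignore both.\<close>

lemma primitive_root_normal_form:
  assumes u: "u \<in> carrier (free_group r)" "\<not> proper_power (free_group r) u" "u \<noteq> []"
  obtains h x v i where "u = red (h @ x @ inv_word h)" "word_in r h" "word_in r x"
    "v = x \<or> v = inv_word x" "word_in r v" "prim_word v" "cyc_reduced v" "hd v = (i, True)"
proof -
  have ur: "reduced_word u" "word_in r u" using u(1) by (auto simp: free_group_carrier)
  obtain h0 v0 where hv: "u = h0 @ v0 @ inv_word h0" "cyc_reduced v0"
    using cyclic_reduction_reduced[OF ur(1)] by blast
  have v0: "v0 \<noteq> []"
  proof
    assume "v0 = []"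
    then have "red u = []" using hv by simp
    then show False using ur u(3) by (simp add: red_reduced)
  qed
  obtain v i where v: "cyc_reduced v" "hd v = (i, True)" "length v = length v0"
    "word_in r v \<longleftrightarrow> word_in r v0" "v = v0 \<or> v = inv_word (tl v0 @ [hd v0])"
    using positive_start[OF hv(2) v0] by metis
  have r: "word_in r h0" "word_in r v0" "word_in r v" using ur hv v by auto
  have vn: "v \<noteq> []" using v(3) v0 by auto
  obtain h x where hx: "u = red (h @ x @ inv_word h)" "word_in r h" "word_in r x" "v = x \<or> v = inv_word x"
    "reduced_word x" "x \<noteq> []"
  proof (cases "v = v0")
    case True
    have "u = red (h0 @ v0 @ inv_word h0)" using ur by (simp add: red_reduced flip: hv(1))
    then show ?thesis using that[of h0 v0] r True v0 hv(2) by (simp add: cyc_reduced_def)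
  next
    case False
    \<comment> \<open>The first letter is moved into the conjugator: h0 a t h0^{-1} = (h0 a) (t a)
      (h0 a)^{-1}. The inverse of t a then starts with a generator.\<close>
    obtain a t where at: "v0 = a # t" using v0 by (cases v0) auto
    then have va: "v = inv_word (t @ [a])" using v False by simp
    have "u = red (h0 @ [a] @ t @ inv_word h0)" using ur hv at by (simp add: red_reduced)
    also have "\<dots> = red ((h0 @ [a] @ t) @ ([a] @ inv_word [a]) @ inv_word h0)"
    proof -
      have "red ((h0 @ [a] @ t) @ [] @ inv_word h0) = red ((h0 @ [a] @ t) @ ([a] @ inv_word [a]) @ inv_word h0)"
        by (intro red_append_cong refl) (simp only: red_inv_self red_Nil)
      then show ?thesis by simp
    qed
    finally have "u = red ((h0 @ [a]) @ (t @ [a]) @ inv_word (h0 @ [a]))" by simp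
    then show ?thesis
      using that[of "h0 @ [a]" "t @ [a]"] r at va cyc_reduced_snoc[of a t] hv(2)
      by (simp add: cyc_reduced_def)
  qed
  have "prim_word x" using not_proper_power_prim[OF u(2) hx(1,5,6,3,2)] .
  then have "prim_word v" using hx(4) prim_word_inv_word by auto
  then show ?thesis using that hx r v by blast
qed

section \<open>Traces of powers in terms of the normal form\<close>

context matrix_model
begin

lemma mat_trace_conj:
  assumes "h \<in> carrier G" "x \<in> carrier G"
  shows "mat_trace (h \<otimes>\<^bsub>G\<^esub> x \<otimes>\<^bsub>G\<^esub> inv\<^bsub>G\<^esub> h) = mat_trace x"
proof -
  have "mat_trace (h \<otimes>\<^bsub>G\<^esub> x \<otimes>\<^bsub>G\<^esub> inv\<^bsub>G\<^esub> h) = mat_trace (inv\<^bsub>G\<^esub> h \<otimes>\<^bsub>G\<^esub> (h \<otimes>\<^bsub>G\<^esub> x))"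
    using assms mat_trace_comm[of "h * x" N N "inv\<^bsub>G\<^esub> h"] carrier_G_mat[of h] carrier_G_mat[of x]
      carrier_G_mat[of "inv\<^bsub>G\<^esub> h"] by (simp add: mult_G)
  also have "inv\<^bsub>G\<^esub> h \<otimes>\<^bsub>G\<^esub> (h \<otimes>\<^bsub>G\<^esub> x) = x" using assms by (simp add: m_assoc[symmetric])
  finally show ?thesis .
qed

lemma conj_nat_pow:
  assumes "h \<in> carrier G" "x \<in> carrier G"
  shows "(h \<otimes>\<^bsub>G\<^esub> x \<otimes>\<^bsub>G\<^esub> inv\<^bsub>G\<^esub> h) [^]\<^bsub>G\<^esub> (n :: nat) = h \<otimes>\<^bsub>G\<^esub> x [^]\<^bsub>G\<^esub> n \<otimes>\<^bsub>G\<^esub> inv\<^bsub>G\<^esub> h"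
proof (induction n)
  case (Suc n)
  have "(h \<otimes>\<^bsub>G\<^esub> x \<otimes>\<^bsub>G\<^esub> inv\<^bsub>G\<^esub> h) [^]\<^bsub>G\<^esub> Suc n =
     (h \<otimes>\<^bsub>G\<^esub> x [^]\<^bsub>G\<^esub> n \<otimes>\<^bsub>G\<^esub> inv\<^bsub>G\<^esub> h) \<otimes>\<^bsub>G\<^esub> (h \<otimes>\<^bsub>G\<^esub> x \<otimes>\<^bsub>G\<^esub> inv\<^bsub>G\<^esub> h)"
    by (simp only: nat_pow_Suc Suc)
  moreover have "inv\<^bsub>G\<^esub> h \<otimes>\<^bsub>G\<^esub> (h \<otimes>\<^bsub>G\<^esub> (x \<otimes>\<^bsub>G\<^esub> inv\<^bsub>G\<^esub> h)) = x \<otimes>\<^bsub>G\<^esub> inv\<^bsub>G\<^esub> h"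
    using assms by (simp flip: m_assoc)
  ultimately show ?case using assms by (simp add: m_assoc)
qed (use assms in simp)

lemma wv_word_pow:
  assumes g: "g \<in> space (prod_haar r)" and v: "word_in r v"
  shows "wv g (word_pow v n) = wv g v [^]\<^bsub>G\<^esub> n"
proof (induction n)
  case 0
  then show ?case by (simp add: one_G)
next
  case (Suc n)
  then show ?case
    using wv_append[OF g v, of "word_pow v n"] word_in_word_pow[OF v, of n] nat_pow_Suc2[OF wv_closed[OF g v], of n]
    by (simp add: mult_G)
qed

lemma wv_hom:
  assumes g: "g \<in> space (prod_haar r)"
  shows "group_hom (free_group r) G (wv g)"
proof (intro group_hom.intro group_hom_axioms.intro group_free_group is_group)
  show "wv g \<in> hom (free_group r) G"
  proof (rule homI)
    fix x assume "x \<in> carrier (free_group r)"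
    then show "wv g x \<in> carrier G" using wv_closed[OF g] by (simp add: free_group_carrier)
  next
    fix x y assume xy: "x \<in> carrier (free_group r)" "y \<in> carrier (free_group r)"
    then have "x \<otimes>\<^bsub>free_group r\<^esub> y = red (x @ y)"
      by (simp add: free_group_mult free_group_carrier red_append red_reduced)
    then show "wv g (x \<otimes>\<^bsub>free_group r\<^esub> y) = wv g x \<otimes>\<^bsub>G\<^esub> wv g y"
      using xy wv_red[OF g, of "x @ y"] wv_append[OF g, of x y] by (simp add: free_group_carrier mult_G)
  qed
qed

text \<open>Evaluation is a homomorphism, and the trace on the group is invariant under conjugation
  and inversion. So h, the sign of j and the choice between x and its inverse all drop out, and only
  the exponent d |j| remains.\<close>

lemma mat_trace_power:
  assumes g: "g \<in> space (prod_haar r)" and u: "u \<in> carrier (free_group r)"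
    and hx: "u = red (h @ x @ inv_word h)" "word_in r h" "word_in r x" "v = x \<or> v = inv_word x"
  shows "mat_trace (wv g ((u [^]\<^bsub>free_group r\<^esub> (d :: nat)) [^]\<^bsub>free_group r\<^esub> (j :: int))) =
    mat_trace (wv g (word_pow v (d * nat \<bar>j\<bar>)))"
proof -
  interpret H: group_hom "free_group r" G "wv g" by (rule wv_hom[OF g])
  let ?m = "nat \<bar>j\<bar>"
  let ?X = "wv g x" and ?H = "wv g h"
  have X: "?X \<in> carrier G" and Hc: "?H \<in> carrier G" using wv_closed[OF g] hx by auto
  have U: "wv g u = ?H \<otimes>\<^bsub>G\<^esub> ?X \<otimes>\<^bsub>G\<^esub> inv\<^bsub>G\<^esub> ?H"
  proof -
    have "wv g u = wv g (h @ x @ inv_word h)" unfolding hx(1) using hx by (intro wv_red[OF g]) auto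
    also have "\<dots> = ?H \<otimes>\<^bsub>G\<^esub> (?X \<otimes>\<^bsub>G\<^esub> inv\<^bsub>G\<^esub> ?H)"
      using hx by (simp add: wv_append[OF g] wv_inv[OF g] mult_G)
    finally show ?thesis using X Hc by (simp add: m_assoc)
  qed
  have Uc: "wv g u \<in> carrier G" using H.hom_closed u by blast
  have "wv g ((u [^]\<^bsub>free_group r\<^esub> d) [^]\<^bsub>free_group r\<^esub> j) = (wv g u [^]\<^bsub>G\<^esub> d) [^]\<^bsub>G\<^esub> j"
    using u H.hom_int_pow[of "u [^]\<^bsub>free_group r\<^esub> d" j] H.hom_nat_pow[of u d] by simp
  also have "mat_trace \<dots> = mat_trace ((wv g u [^]\<^bsub>G\<^esub> d) [^]\<^bsub>G\<^esub> ?m)"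
  proof (cases "j < 0")
    case True
    then have "?m = nat (- j)" by simp
    then have "(wv g u [^]\<^bsub>G\<^esub> d) [^]\<^bsub>G\<^esub> j = inv\<^bsub>G\<^esub> ((wv g u [^]\<^bsub>G\<^esub> d) [^]\<^bsub>G\<^esub> ?m)"
      using True by (simp only: int_pow_def2 if_True)
    then show ?thesis using mat_trace_inv[of "(wv g u [^]\<^bsub>G\<^esub> d) [^]\<^bsub>G\<^esub> ?m"] Uc by simp
  next
    case False
    then have "?m = nat j" by simp
    then show ?thesis using False by (simp only: int_pow_def2 if_False)
  qed
  also have "(wv g u [^]\<^bsub>G\<^esub> d) [^]\<^bsub>G\<^esub> ?m = wv g u [^]\<^bsub>G\<^esub> (d * ?m)" using Uc by (rule nat_pow_pow)
  also have "\<dots> = ?H \<otimes>\<^bsub>G\<^esub> ?X [^]\<^bsub>G\<^esub> (d * ?m) \<otimes>\<^bsub>G\<^esub> inv\<^bsub>G\<^esub> ?H"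
    unfolding U using X Hc by (intro conj_nat_pow)
  also have "mat_trace \<dots> = mat_trace (?X [^]\<^bsub>G\<^esub> (d * ?m))"
    using X Hc by (intro mat_trace_conj) auto
  also have "\<dots> = mat_trace (wv g v [^]\<^bsub>G\<^esub> (d * ?m))"
    using hx(4)
  proof
    assume "v = inv_word x"
    then have "wv g v [^]\<^bsub>G\<^esub> (d * ?m) = inv\<^bsub>G\<^esub> (?X [^]\<^bsub>G\<^esub> (d * ?m))"
      using wv_inv[OF g hx(3)] nat_pow_inv[OF X] by simp
    then show ?thesis using mat_trace_inv[of "?X [^]\<^bsub>G\<^esub> (d * ?m)"] X by simp
  qed simp
  also have "\<dots> = mat_trace (wv g (word_pow v (d * ?m)))"
    using wv_word_pow[OF g, of v] hx by auto
  finally show ?thesis .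
qed

lemma trace_integral_power:
  assumes u: "u \<in> carrier (free_group r)"
    and hx: "u = red (h @ x @ inv_word h)" "word_in r h" "word_in r x" "v = x \<or> v = inv_word x"
  shows "trace_integral G \<mu> r (map (\<lambda>j. (u [^]\<^bsub>free_group r\<^esub> (d :: nat)) [^]\<^bsub>free_group r\<^esub> (j :: int)) js) =
    trace_integral G \<mu> r (map (word_pow v) (map (\<lambda>j. d * nat \<bar>j\<bar>) js))"
  unfolding trace_integral_eq trace_prod_def
proof (rule Bochner_Integration.integral_cong[OF refl])
  fix g assume g: "g \<in> space (prod_haar r)"
  show "(\<Prod>w\<leftarrow>map (\<lambda>j. (u [^]\<^bsub>free_group r\<^esub> d) [^]\<^bsub>free_group r\<^esub> j) js. mat_trace (wv g w)) =
    (\<Prod>w\<leftarrow>map (word_pow v) (map (\<lambda>j. d * nat \<bar>j\<bar>) js). mat_trace (wv g w))"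
    unfolding map_map o_def mat_trace_power[OF g u hx] ..
qed

end

section \<open>The limits and the recovery of d\<close>

lemma tendsto_trace_integral_power:
  fixes G :: "nat \<Rightarrow> 'a::{real_normed_field, banach, second_countable_topology, conjugatable_ordered_field} mat monoid"
  assumes model: "\<And>n. n \<ge> 1 \<Longrightarrow> unitary_matrix_model (G n) (N n) (J n) \<sigma> (\<mu> n)"
    and N: "filterlim N at_top sequentially"
    and u: "u \<in> carrier (free_group r)" "\<not> proper_power (free_group r) u" "u \<noteq> []"
    and d: "d \<ge> 1" and js: "0 \<notin> set js"
  shows "(\<lambda>n. trace_integral (G n) (\<mu> n) r
      (map (\<lambda>j. (u [^]\<^bsub>free_group r\<^esub> (d :: nat)) [^]\<^bsub>free_group r\<^esub> (j :: int)) js))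
    \<longlonglongrightarrow> loop_limit \<sigma> (map (\<lambda>j. d * nat \<bar>j\<bar>) js)"
proof -
  obtain h x v i where hx: "u = red (h @ x @ inv_word h)" "word_in r h" "word_in r x" "v = x \<or> v = inv_word x"
    and v: "word_in r v" "prim_word v" "cyc_reduced v" "hd v = (i, True)"
    using primitive_root_normal_form[OF u] by blast
  let ?ps = "map (\<lambda>j. d * nat \<bar>j\<bar>) js"
  interpret loop_system_sequence r N \<sigma> "\<lambda>n. trace_integral (G n) (\<mu> n) r"
  proof
    show "\<forall>\<^sub>F n in sequentially. loop_system r (N n) \<sigma> (trace_integral (G n) (\<mu> n) r)"
      using eventually_ge_at_top[of 1]
    proof eventually_elim
      case (elim n)
      then interpret unitary_matrix_model "G n" "N n" "J n" \<sigma> "\<mu> n" by (rule model)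
      show ?case by (rule loop_system)
    qed
  qed (rule N)
  have "\<forall>p\<in>set ?ps. 1 \<le> p" using d js by (auto simp: Suc_le_eq)
  then have lim: "(\<lambda>n. trace_integral (G n) (\<mu> n) r (map (word_pow v) ?ps)) \<longlonglongrightarrow> loop_limit \<sigma> ?ps"
    using v by (intro tendsto_loop_limit) auto
  have "\<forall>\<^sub>F n in sequentially. trace_integral (G n) (\<mu> n) r (map (word_pow v) ?ps) =
     trace_integral (G n) (\<mu> n) r (map (\<lambda>j. (u [^]\<^bsub>free_group r\<^esub> d) [^]\<^bsub>free_group r\<^esub> j) js)"
    using eventually_ge_at_top[of 1]
  proof eventually_elim
    case (elim n)
    then interpret unitary_matrix_model "G n" "N n" "J n" \<sigma> "\<mu> n" by (rule model)
    show ?case using trace_integral_power[OF u(1) hx] by simp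
  qed
  then show ?thesis by (rule Lim_transform_eventually[OF lim])
qed

text \<open>The first moment is \<sigma> for even d and 0 for odd d, which reveals the parity. The
  second moment is d + 1 or d accordingly, since \<sigma>^2 = 1; with equal parities it yields
  d.\<close>

lemma loop_limit_determines:
  fixes \<sigma> :: "'a::field_char_0"
  assumes \<sigma>: "\<sigma> = 1 \<or> \<sigma> = - 1"
    and eq: "\<And>js :: int list. js \<noteq> [] \<Longrightarrow> 0 \<notin> set js \<Longrightarrow>
      loop_limit \<sigma> (map (\<lambda>j. d * nat \<bar>j\<bar>) js) = loop_limit \<sigma> (map (\<lambda>j. d' * nat \<bar>j\<bar>) js)"
  shows "d = d'"
proof -
  have parity: "even d \<longleftrightarrow> even d'"
    using eq[of "[1]"] \<sigma> by (auto split: if_splits)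
  have "loop_limit \<sigma> [d, d] = loop_limit \<sigma> [d', d']"
    using eq[of "[1, 1]"] by simp
  with parity have "(of_nat d :: 'a) = of_nat d'"
    by (cases "even d") (simp_all add: remove_nth_def)
  then show ?thesis by simp
qed

theorem corollary1p18:
  fixes \<mu>O :: "nat \<Rightarrow> real mat measure" and \<mu>Sp :: "nat \<Rightarrow> complex mat measure"
  assumes haar_O: "\<And>n. n \<ge> 1 \<Longrightarrow> haar_probability (orthogonal_group n) (\<mu>O n)"
    and haar_Sp: "\<And>n. n \<ge> 1 \<Longrightarrow> haar_probability (symplectic_group n) (\<mu>Sp n)"
  shows "(\<exists>L :: nat \<Rightarrow> int list \<Rightarrow> real.
      (\<forall>r u w d js.
          u \<in> carrier (free_group r) \<and> \<not> proper_power (free_group r) u \<and> d \<ge> 1 \<and>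
          w = u [^]\<^bsub>free_group r\<^esub> (d::nat) \<and> w \<noteq> \<one>\<^bsub>free_group r\<^esub> \<and>
          js \<noteq> [] \<and> 0 \<notin> set js \<longrightarrow>
          (\<lambda>n. trace_integral (orthogonal_group n) (\<mu>O n) r
                 (map (\<lambda>j. w [^]\<^bsub>free_group r\<^esub> j) js)) \<longlonglongrightarrow> L d js) \<and>
      (\<forall>d d'. d \<ge> 1 \<and> d' \<ge> 1 \<and> (\<forall>js. js \<noteq> [] \<and> 0 \<notin> set js \<longrightarrow> L d js = L d' js) \<longrightarrow> d = d'))
    \<and> (\<exists>L :: nat \<Rightarrow> int list \<Rightarrow> complex.
      (\<forall>r u w d js.
          u \<in> carrier (free_group r) \<and> \<not> proper_power (free_group r) u \<and> d \<ge> 1 \<and>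
          w = u [^]\<^bsub>free_group r\<^esub> (d::nat) \<and> w \<noteq> \<one>\<^bsub>free_group r\<^esub> \<and>
          js \<noteq> [] \<and> 0 \<notin> set js \<longrightarrow>
          (\<lambda>n. trace_integral (symplectic_group n) (\<mu>Sp n) r
                 (map (\<lambda>j. w [^]\<^bsub>free_group r\<^esub> j) js)) \<longlonglongrightarrow> L d js) \<and>
      (\<forall>d d'. d \<ge> 1 \<and> d' \<ge> 1 \<and> (\<forall>js. js \<noteq> [] \<and> 0 \<notin> set js \<longrightarrow> L d js = L d' js) \<longrightarrow> d = d'))"
proof -
  have ne: "u \<noteq> []" if "u [^]\<^bsub>free_group r\<^esub> (d::nat) \<noteq> \<one>\<^bsub>free_group r\<^esub>" for u r d
  proof
    interpret group "free_group r" by (rule group_free_group)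
    assume "u = []"
    then show False using that nat_pow_one[of d] by (simp add: free_group_one)
  qed
  note O = tendsto_trace_integral_power[where G = orthogonal_group and \<mu> = \<mu>O, OF orthogonal_model[OF haar_O] filterlim_ident]
  \<comment> \<open>The matrices of Sp(n) have size 2 n, which is the N of the loop system.\<close>
  have "filterlim (\<lambda>n :: nat. 2 * n) at_top sequentially"
    by (rule filterlim_at_top_mono[OF filterlim_ident]) auto
  note Sp = tendsto_trace_integral_power[where G = symplectic_group and \<mu> = \<mu>Sp, OF symplectic_model[OF haar_Sp] this]
  show ?thesis
  \<comment> \<open>The witnesses L are introduced before r and u and so cannot depend on them. They
    are fixed by unification as \<open>loop_limit\<close> with parameter 1 or -1 at the exponents d
    |j|.\<close>
  proof (intro conjI exI allI impI; (elim conjE)?)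
    fix r u w d js
    assume "u \<in> carrier (free_group r)" "\<not> proper_power (free_group r) u" "d \<ge> 1"
      "w = u [^]\<^bsub>free_group r\<^esub> (d::nat)" "w \<noteq> \<one>\<^bsub>free_group r\<^esub>" "(0 :: int) \<notin> set js"
    then show "(\<lambda>n. trace_integral (orthogonal_group n) (\<mu>O n) r
                 (map (\<lambda>j. w [^]\<^bsub>free_group r\<^esub> j) js)) \<longlonglongrightarrow> loop_limit 1 (map (\<lambda>j. d * nat \<bar>j\<bar>) js)"
      using O[where u = u and r = r and d = d and js = js] ne[where u = u and r = r and d = d] by simp
  next
    fix d d' :: nat
    assume "\<forall>js. js \<noteq> [] \<and> 0 \<notin> set js \<longrightarrow>
      loop_limit (1 :: real) (map (\<lambda>j. d * nat \<bar>j\<bar>) js) = loop_limit 1 (map (\<lambda>j. d' * nat \<bar>j\<bar>) js)"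
    then show "d = d'" by (intro loop_limit_determines[of "1 :: real" d d']) auto
  next
    fix r u w d js
    assume "u \<in> carrier (free_group r)" "\<not> proper_power (free_group r) u" "d \<ge> 1"
      "w = u [^]\<^bsub>free_group r\<^esub> (d::nat)" "w \<noteq> \<one>\<^bsub>free_group r\<^esub>" "(0 :: int) \<notin> set js"
    then show "(\<lambda>n. trace_integral (symplectic_group n) (\<mu>Sp n) r
                 (map (\<lambda>j. w [^]\<^bsub>free_group r\<^esub> j) js)) \<longlonglongrightarrow> loop_limit (- 1) (map (\<lambda>j. d * nat \<bar>j\<bar>) js)"
      using Sp[where u = u and r = r and d = d and js = js] ne[where u = u and r = r and d = d] by simp
  next
    fix d d' :: nat
    assume "\<forall>js. js \<noteq> [] \<and> 0 \<notin> set js \<longrightarrow>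
      loop_limit (- 1 :: complex) (map (\<lambda>j. d * nat \<bar>j\<bar>) js) = loop_limit (- 1) (map (\<lambda>j. d' * nat \<bar>j\<bar>) js)"
    then show "d = d'" by (intro loop_limit_determines[of "(- 1) :: complex" d d']) auto
  qed
qed

end
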